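(* Let $n\ge2$, $0\le l<k\le n$ and $\theta\in(0,\pi)$. Suppose $h$ is an admissible solution of $$\frac{\sigma_k(\nabla^2h+h\sigma)}{\sigma_l(\nabla^2h+h\sigma)}=\frac{\binom{n}{k}}{\binom{n}{l}}\ \text{ in }\mathcal{C}_\theta,$$ with $\nabla_\mu h=\cot\theta\,h$ on $\partial\mathcal{C}_\theta$. Then $$h(\xi)=\ell(\xi)+\sum_{\alpha=1}^n a_\alpha\langle\xi,E_\alpha\rangle,\qquad \xi\in\mathcal{C}_\theta,$$ for some constants $a_1,\dots,a_n\in\mathbb{R}$.
   Context: $E_1,\dots,E_{n+1}$ is the standard basis of $\mathbb{R}^{n+1}$ ($E_1,\dots,E_n$ horizontal), $e=-E_{n+1}$, $\overline{\mathbb{R}^{n+1}_+}=\{x_{n+1}\ge0\}$. $\mathcal{C}_\theta=\{\xi\in\overline{\mathbb{R}^{n+1}_+}:|\xi-\cos\theta\,e|=1\}$ with round metric $\sigma$, connection $\nabla$, unit outward conormal $\mu$ of $\partial\mathcal{C}_\theta$; $\ell(\xi)=\sin^2\theta+\cos\theta\langle\xi,e\rangle$. $\sigma_j(W)$ is the $j$-th elementary symmetric function of the eigenvalues of $W$ ($\sigma_0=1$); $\Gamma_k=\{\lambda\in\mathbb{R}^n:\sigma_i(\lambda)>0,1\le i\le k\}$; $h\in C^2(\mathcal{C}_\theta)$ is admissible if the eigenvalues of $\nabla^2h+h\sigma$ lie in $\Gamma_k$ everywhere. *)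

theory Defs
  imports "HOL-Analysis.Analysis"
begin

text \<open>Ambient space R^{n+1} is real^('n option): the coordinates Some i (i :: 'n,
  so n = CARD('n)) are horizontal, None is the vertical (n+1)-st coordinate.\<close>

definition EE :: "'n::finite option \<Rightarrow> real^('n option)" where
  "EE i = axis i 1"

definition evec :: "real^('n::finite option)" where
  "evec = - EE None"

definition cap :: "real \<Rightarrow> (real^('n::finite option)) set" where
  "cap \<theta> = {\<xi>. \<xi> $ None \<ge> 0 \<and> norm (\<xi> - cos \<theta> *\<^sub>R evec) = 1}"

definition cap_boundary :: "real \<Rightarrow> (real^('n::finite option)) set" where
  "cap_boundary \<theta> = {\<xi> \<in> cap \<theta>. \<xi> $ None = 0}"

definition snormal :: "real \<Rightarrow> real^('n::finite option) \<Rightarrow> real^('n option)" where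
  "snormal \<theta> \<xi> = \<xi> - cos \<theta> *\<^sub>R evec"

text \<open>Unit outward conormal mu of the boundary of the cap: normalized tangential
  projection of the outward direction e = -E_{n+1}.\<close>
definition conormal :: "real \<Rightarrow> real^('n::finite option) \<Rightarrow> real^('n option)" where
  "conormal \<theta> \<xi> =
     (let N = snormal \<theta> \<xi>; p = evec - (evec \<bullet> N) *\<^sub>R N in (1 / norm p) *\<^sub>R p)"

definition ell :: "real \<Rightarrow> real^('n::finite option) \<Rightarrow> real" where
  "ell \<theta> \<xi> = (sin \<theta>)\<^sup>2 + cos \<theta> * (\<xi> \<bullet> evec)"

text \<open>h is C^2 on the closed cap: it is the restriction of a function H that is C^2
  on an open set U containing the cap, with gradient G and Hessian G' (as linear map).\<close>
definition C2_ext ::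
  "(real^'m::finite) set \<Rightarrow> (real^'m \<Rightarrow> real) \<Rightarrow> (real^'m \<Rightarrow> real^'m)
    \<Rightarrow> (real^'m \<Rightarrow> real^'m \<Rightarrow> real^'m) \<Rightarrow> bool" where
  "C2_ext U H G G' \<longleftrightarrow> open U \<and>
     (\<forall>x\<in>U. (H has_derivative (\<lambda>v. G x \<bullet> v)) (at x)) \<and>
     (\<forall>x\<in>U. (G has_derivative G' x) (at x)) \<and>
     (\<forall>v. continuous_on U (\<lambda>x. G' x v))"

text \<open>The tensor W = nabla^2 h + h sigma on the tangent space of the sphere at xi:
  nabla^2 h(u,v) = D^2H(u,v) - <u,v> dH(N).\<close>
definition Wform ::
  "real \<Rightarrow> (real^('n::finite option) \<Rightarrow> real) \<Rightarrow> (real^('n option) \<Rightarrow> real^('n option))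
    \<Rightarrow> (real^('n option) \<Rightarrow> real^('n option) \<Rightarrow> real^('n option))
    \<Rightarrow> real^('n option) \<Rightarrow> real^('n option) \<Rightarrow> real^('n option) \<Rightarrow> real" where
  "Wform \<theta> H G G' \<xi> u v =
     u \<bullet> G' \<xi> v - (u \<bullet> v) * (G \<xi> \<bullet> snormal \<theta> \<xi>) + H \<xi> * (u \<bullet> v)"

definition eigvals ::
  "real \<Rightarrow> (real^('n::finite option) \<Rightarrow> real) \<Rightarrow> (real^('n option) \<Rightarrow> real^('n option))
    \<Rightarrow> (real^('n option) \<Rightarrow> real^('n option) \<Rightarrow> real^('n option))
    \<Rightarrow> real^('n option) \<Rightarrow> ('n \<Rightarrow> real) \<Rightarrow> bool" where
  "eigvals \<theta> H G G' \<xi> lam \<longleftrightarrow>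
     (\<exists>b :: 'n \<Rightarrow> real^('n option).
        (\<forall>i j. b i \<bullet> b j = (if i = j then 1 else 0)) \<and>
        (\<forall>i. b i \<bullet> snormal \<theta> \<xi> = 0) \<and>
        (\<forall>i j. Wform \<theta> H G G' \<xi> (b i) (b j) = (if i = j then lam i else 0)))"

definition esym :: "nat \<Rightarrow> ('n::finite \<Rightarrow> real) \<Rightarrow> real" where
  "esym j lam = (\<Sum>S\<in>{S :: 'n set. card S = j}. \<Prod>i\<in>S. lam i)"

definition Gamma_cone :: "nat \<Rightarrow> ('n::finite \<Rightarrow> real) set" where
  "Gamma_cone k = {lam. \<forall>i. 1 \<le> i \<and> i \<le> k \<longrightarrow> esym i lam > 0}"

definition admissible ::
  "real \<Rightarrow> nat \<Rightarrow> (real^('n::finite option) \<Rightarrow> real) \<Rightarrow> (real^('n option) \<Rightarrow> real^('n option))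
    \<Rightarrow> (real^('n option) \<Rightarrow> real^('n option) \<Rightarrow> real^('n option)) \<Rightarrow> bool" where
  "admissible \<theta> k H G G' \<longleftrightarrow>
     (\<forall>\<xi>\<in>cap \<theta>. \<forall>lam. eigvals \<theta> H G G' \<xi> lam \<longrightarrow> lam \<in> Gamma_cone k)"

end

theory Submission
  imports Defs "HOL-Computational_Algebra.Fundamental_Theorem_Algebra"
begin

text \<open>
  In terms of the unit normal \<open>N = \<xi> - cos \<theta> e\<close>, the equation and the Robin condition are invariant
  under reflections \<open>\<rho>\<close> in vertical hyperplanes through the axis. Let \<open>n\<close> be the horizontal unit
  normal of such a hyperplane and \<open>x = \<langle>N, n\<rangle>\<close>. Since \<open>x\<close> has zero Hessian tensor
  \<open>\<nabla>\<^sup>2x + x\<sigma>\<close> and satisfies the Robin condition, the quotient \<open>q = (h \<circ> \<rho> - h) / x\<close> on \<open>x > 0\<close>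
  obeys a maximum principle with Neumann condition, and the task is to show that it is constant. For
  \<open>\<zeta> = (\<langle>N, P\<rangle> - 1) / x\<close> the barrier \<open>x g(\<zeta>)\<close> has the tensor
  \<open>x g'' d\<zeta>\<^sup>2 - g' \<sigma>\<close>, and \<open>\<zeta>\<close> has the right Neumann sign when \<open>P\<close> lies above the boundary plane.
  With \<open>g = M + \<epsilon> sqrt (- \<zeta>)\<close> the supremum of \<open>q\<close> is attained away from \<open>x = 0\<close>, and with
  \<open>g = M - \<epsilon> exp (A \<zeta>)\<close>, where \<open>P\<close> is a point at which \<open>q\<close> is not maximal, one obtains the strong
  maximum principle. Hence \<open>h \<circ> \<rho> - h\<close> is a multiple of \<open>x\<close>, so \<open>h\<close> becomes rotationally symmetric
  after subtracting a horizontal linear function, and a Gronwall argument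
  for the resulting ODE gives \<open>\<nabla>\<^sup>2h + h\<sigma> = \<sigma>\<close>.
\<close>

text \<open>The tensor \<open>\<nabla>\<^sup>2u + u\<sigma>\<close> has a zeroth-order term of the
  wrong sign, so the difference of h and its reflection obeys no maximum principle by itself. A
  positive divisor with vanishing tensor would remove that term. The candidates are the linear
  functions, of which the Robin condition keeps only the horizontal ones, and these change sign on
  the cap. The reflection is what makes the division possible: the difference is odd, so the half x
  > 0 suffices, where x is positive. The price is that x vanishes on the mirror and q might approach
  its supremum only there; the first barrier exists to exclude this. The -1 in \<zeta> makes \<zeta>
  negative and, since constants have multiples of \<sigma> as tensors, creates the error -g'
  \<sigma>. Both barriers work because the concavity of g along d\<zeta> beats this error. How much
  concavity is needed is measured by a single ellipticity constant, \<open>Cell\<close>, obtained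
  from the compactness of the set of spectra. Only eigenvalues are compared and the equation is
  never differentiated, so C^2 regularity is enough.\<close>

section \<open>Newton inequalities and ellipticity on the cones\<close>

inductive real_split :: "real poly \<Rightarrow> bool" where
  const: "real_split [:c:]"
| mult: "real_split p \<Longrightarrow> real_split ([:- r, 1:] * p)"

lemma real_split_smult: "real_split p \<Longrightarrow> real_split (smult c p)"
proof (induction rule: real_split.induct)
  case (const d) then show ?case using real_split.const[of "c*d"] by simp
next
  case (mult p r)
  have "smult c ([:- r, 1:] * p) = [:- r, 1:] * smult c p" by simp
  then show ?case using real_split.mult[OF mult.IH] by simp
qed

abbreviation cpoly :: "real poly \<Rightarrow> complex poly" where
  "cpoly \<equiv> map_poly complex_of_real"

lemma cpoly_mult: "cpoly (p * q) = cpoly p * cpoly q"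
  by (intro poly_eqI) (simp add: coeff_map_poly coeff_mult)

lemma cpoly_add: "cpoly (p + q) = cpoly p + cpoly q"
  by (intro poly_eqI) (simp add: coeff_map_poly)

lemma cpoly_linear: "cpoly [:a, b:] = [:of_real a, of_real b:]"
  by (intro poly_eqI) (simp add: coeff_map_poly coeff_pCons split: nat.splits)

lemma poly_cpoly_of_real: "poly (cpoly p) (of_real x) = of_real (poly p x)"
  by (simp add: poly_altdef coeff_map_poly degree_map_poly)

text \<open>The fundamental theorem of algebra, applied to the complexified polynomial, supplies one
  root at a time. This turns absence of zeros off the real line into a factorization, which is how
  the class is shown to be closed under derivatives.\<close>

lemma real_splitI:
  assumes "\<And>z. poly (cpoly p) z = 0 \<Longrightarrow> z \<in> \<real>"
  shows "real_split p"
  using assms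
proof (induction "degree p" arbitrary: p)
  case 0
  then obtain c where "p = [:c:]" by (metis degree_eq_zeroE)
  then show ?case using real_split.const by simp
next
  case (Suc n)
  have "degree (cpoly p) \<noteq> 0" using Suc(2) by (simp add: degree_map_poly)
  then have "\<not> constant (poly (cpoly p))" by (simp add: constant_degree)
  then obtain z where z: "poly (cpoly p) z = 0" using fundamental_theorem_of_algebra by blast
  then obtain r where r: "z = of_real r" using Suc(3) Reals_cases by blast
  then have "poly p r = 0" using z poly_cpoly_of_real by simp
  then obtain q where q: "p = [:- r, 1:] * q" using poly_eq_0_iff_dvd by (metis dvd_def)
  have "q \<noteq> 0" using q Suc(2) by auto
  then have "degree p = Suc (degree q)" unfolding q by (subst degree_mult_eq) auto
  then have "n = degree q" using Suc(2) by simp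
  moreover have "\<And>z. poly (cpoly q) z = 0 \<Longrightarrow> z \<in> \<real>"
    using Suc(3) q by (simp add: cpoly_mult del: mult_pCons_left)
  ultimately have "real_split q" using Suc(1) by blast
  then show ?case using q real_split.mult by simp
qed

text \<open>Gauss--Lucas for real roots: the logarithmic derivative has no zeros off the real line.\<close>
lemma real_split_log_deriv:
  assumes "real_split p" "p \<noteq> 0" "Im z \<noteq> 0"
  shows "poly (cpoly p) z \<noteq> 0 \<and>
    (if degree p = 0 then poly (cpoly (pderiv p)) z = 0
     else Im (poly (cpoly (pderiv p)) z / poly (cpoly p) z) * Im z < 0)"
  using assms
proof (induction rule: real_split.induct)
  case (const c)
  then show ?case by (simp add: map_poly_pCons)
next
  case (mult p r)
  let ?P = "poly (cpoly p) z" and ?P' = "poly (cpoly (pderiv p)) z"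
  have p0: "p \<noteq> 0" using mult.prems by auto
  note IH = mult.IH[OF p0 mult.prems(2)]
  let ?w = "z - of_real r"
  have w0: "?w \<noteq> 0" using mult.prems(2) by (metis Im_complex_of_real eq_iff_diff_eq_0)
  have d: "degree ([:- r, 1:] * p) = Suc (degree p)" using p0 by (subst degree_mult_eq) auto
  have v: "poly (cpoly ([:- r, 1:] * p)) z = ?w * ?P"
    unfolding cpoly_mult cpoly_linear by (simp add: algebra_simps)
  have v': "poly (cpoly (pderiv ([:- r, 1:] * p))) z = ?P + ?w * ?P'"
    unfolding pderiv_mult
    by (simp add: pderiv_pCons cpoly_mult cpoly_linear cpoly_add algebra_simps map_poly_pCons del: mult_pCons_left mult_pCons_right)
  \<comment> \<open>A linear factor adds 1 / (z - r) to the logarithmic derivative, and the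
    imaginary part of this has the sign opposite to Im z for every real r.\<close>
  have "Im (1 / ?w) * Im z < 0"
  proof -
    have "Im (1 / ?w) = - Im z / (norm ?w)\<^sup>2"
      by (simp add: Im_divide cmod_power2)
    moreover have "(norm ?w)\<^sup>2 > 0" using w0 by simp
    ultimately have "Im (1 / ?w) * Im z = - ((Im z)\<^sup>2 / (norm ?w)\<^sup>2)"
      by (simp add: power2_eq_square)
    then show ?thesis using mult.prems(2) \<open>(norm ?w)\<^sup>2 > 0\<close> by simp
  qed
  moreover have "Im (?P' / ?P) * Im z \<le> 0" using IH by (auto split: if_splits)
  moreover have "(?P + ?w * ?P') / (?w * ?P) = 1 / ?w + ?P' / ?P"
    using IH w0 by (simp add: field_simps)
  ultimately have "Im ((?P + ?w * ?P') / (?w * ?P)) * Im z < 0"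
    by (simp add: distrib_right)
  then show ?case using v v' w0 IH d by auto
qed

text \<open>Off the real line p'/p has nonzero imaginary part, so p' has no zeros there. For
  constant p the derivative is \<open>[:0:]\<close>, which belongs to the class by the rule
  \<open>const\<close>.\<close>

lemma real_split_pderiv:
  assumes "real_split p"
  shows "real_split (pderiv p)"
proof (cases "degree p = 0")
  case True
  then have "pderiv p = [:0:]" by (simp add: pderiv_eq_0_iff)
  then show ?thesis using real_split.const by metis
next
  case False
  show ?thesis
  proof (rule real_splitI)
    fix z assume "poly (cpoly (pderiv p)) z = 0"
    moreover have "p \<noteq> 0" using False by auto
    ultimately have "Im z = 0" using real_split_log_deriv[OF assms, of z] False by fastforce
    then show "z \<in> \<real>" by (simp add: complex_is_Real_iff)
  qed
qed

text \<open>Concavity of log |p| in a form without division: (p'^2 - p p'') / p^2 is the sum of 1 /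
  (x - r)^2 over the roots r. The induction over factors also covers the zeros of p.\<close>

lemma real_split_laguerre:
  assumes "real_split p"
  shows "poly p x * poly (pderiv (pderiv p)) x \<le> (poly (pderiv p) x)\<^sup>2"
  using assms
proof (induction rule: real_split.induct)
  case (const c)
  then show ?case by simp
next
  case (mult p r)
  let ?a = "poly p x" and ?b = "poly (pderiv p) x" and ?c = "poly (pderiv (pderiv p)) x"
  have 1: "pderiv ([:- r, 1:] * p) = p + [:- r, 1:] * pderiv p"
    unfolding pderiv_mult by (simp add: pderiv_pCons)
  have 2: "pderiv (p + [:- r, 1:] * pderiv p) = 2 * pderiv p + [:- r, 1:] * pderiv (pderiv p)"
    unfolding pderiv_add pderiv_mult by (simp add: pderiv_pCons)
  have "(?a + (x - r) * ?b)\<^sup>2 - (x - r) * ?a * (2 * ?b + (x - r) * ?c)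
     = ?a\<^sup>2 + (x - r)\<^sup>2 * (?b\<^sup>2 - ?a * ?c)"
    by (simp add: power2_eq_square algebra_simps)
  moreover have "(x - r)\<^sup>2 * (?b\<^sup>2 - ?a * ?c) \<ge> 0" using mult.IH by simp
  moreover have "?a\<^sup>2 \<ge> 0" by simp
  ultimately have "(x - r) * ?a * (2 * ?b + (x - r) * ?c) \<le> (?a + (x - r) * ?b)\<^sup>2" by linarith
  moreover have "poly [:- r, 1:] x = x - r" by simp
  ultimately show ?case unfolding 1 2 by (simp only: poly_mult poly_add poly_numeral)
qed

section \<open>Elementary symmetric functions as coefficients of a real-rooted polynomial\<close>

definition es :: "'a set \<Rightarrow> ('a \<Rightarrow> real) \<Rightarrow> nat \<Rightarrow> real" where
  "es A f j = coeff (\<Prod>i\<in>A. [:1, f i:]) j"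

lemma es_0: "finite A \<Longrightarrow> es A f 0 = 1"
  unfolding es_def by (induction rule: finite_induct) (auto simp: coeff_mult_0)

lemma es_insert:
  assumes "finite A" "i \<notin> A"
  shows "es (insert i A) f (Suc j) = es A f (Suc j) + f i * es A f j"
  using assms unfolding es_def by simp

lemma real_split_es: "finite A \<Longrightarrow> real_split (\<Prod>i\<in>A. [:1, f i:])"
proof (induction rule: finite_induct)
  case empty then show ?case using real_split.const[of 1] by (simp add: one_pCons)
next
  case (insert i A)
  show ?case
  proof (cases "f i = 0")
    case True then show ?thesis using insert by (simp flip: one_pCons)
  next
    case False
    then have e: "[:1, f i:] = smult (f i) [:- (- (1 / f i)), 1:]" by simp
    have "(\<Prod>i\<in>insert i A. [:1, f i:]) = smult (f i) ([:- (- (1 / f i)), 1:] * (\<Prod>i\<in>A. [:1, f i:]))"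
      unfolding prod.insert[OF insert(1,2)] e mult_smult_left ..
    then show ?thesis
      by (simp only: real_split_smult real_split.mult insert.IH)
  qed
qed

lemma real_split_higher_pderiv: "real_split p \<Longrightarrow> real_split ((pderiv ^^ m) p)"
  by (induction m) (auto intro: real_split_pderiv)

text \<open>Newton's inequality, with a weaker constant than the sharp one; it comes from evaluating the
  Laguerre inequality for a higher derivative at \<open>0\<close>, and still yields strict log-concavity.\<close>
lemma es_newton:
  assumes "finite A"
  shows "(real j + 2) * es A f j * es A f (Suc (Suc j)) \<le> (real j + 1) * (es A f (Suc j))\<^sup>2"
proof -
  define p where "p = (\<Prod>i\<in>A. [:1, f i:])"
  define q where "q = (pderiv ^^ j) p"
  have c0: "poly q 0 = fact j * es A f j"
    unfolding q_def poly_0_coeff_0 coeff_higher_pderiv es_def p_def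
    by (simp add: pochhammer_fact)
  have q1: "pderiv q = (pderiv ^^ Suc j) p" and q2: "pderiv (pderiv q) = (pderiv ^^ Suc (Suc j)) p"
    unfolding q_def by simp_all
  have c1: "poly (pderiv q) 0 = fact (Suc j) * es A f (Suc j)"
    unfolding q1 poly_0_coeff_0 coeff_higher_pderiv es_def p_def
    by (metis One_nat_def add_0 of_nat_1 pochhammer_fact of_nat_fact)
  have c2: "poly (pderiv (pderiv q)) 0 = fact (Suc (Suc j)) * es A f (Suc (Suc j))"
    unfolding q2 poly_0_coeff_0 coeff_higher_pderiv es_def p_def
    by (metis One_nat_def add_0 of_nat_1 pochhammer_fact of_nat_fact)
  have "real_split q" unfolding q_def p_def
    using assms by (intro real_split_higher_pderiv real_split_es)
  from real_split_laguerre[OF this, of 0]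
  have "(fact j * es A f j) * (fact (Suc (Suc j)) * es A f (Suc (Suc j))) \<le> (fact (Suc j) * es A f (Suc j))\<^sup>2"
    unfolding c0 c1 c2 .
  then have "(fact j * fact j * (real j + 1)) * ((real j + 2) * es A f j * es A f (Suc (Suc j)))
     \<le> (fact j * fact j * (real j + 1)) * ((real j + 1) * (es A f (Suc j))\<^sup>2)"
    by (simp add: power2_eq_square algebra_simps)
  then show ?thesis by (subst (asm) mult_le_cancel_left_pos) auto
qed

lemma es_log_concave:
  assumes "finite A"
  shows "es A f j * es A f (Suc (Suc j)) \<le> (es A f (Suc j))\<^sup>2"
proof (cases "es A f j * es A f (Suc (Suc j)) \<le> 0")
  case True then show ?thesis by (smt (verit) zero_le_power2)
next
  case False
  then have "(real j + 1) * (es A f j * es A f (Suc (Suc j))) \<le> (real j + 2) * (es A f j * es A f (Suc (Suc j)))"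
    by (intro mult_right_mono) auto
  also have "\<dots> \<le> (real j + 1) * (es A f (Suc j))\<^sup>2" using es_newton[OF assms, of j f] by (simp add: mult.assoc)
  finally show ?thesis by (subst (asm) mult_le_cancel_left_pos) auto
qed

text \<open>The factor (j+1)/(j+2) in \<open>es_newton\<close> is still less than 1, which gives
  strictness when the left product is positive; otherwise the nonzero square on the right
  does.\<close>

lemma es_log_concave_strict:
  assumes "finite A" "es A f (Suc j) \<noteq> 0"
  shows "es A f j * es A f (Suc (Suc j)) < (es A f (Suc j))\<^sup>2"
proof (cases "es A f j * es A f (Suc (Suc j)) \<le> 0")
  case True then show ?thesis using assms(2) by (smt (verit) zero_less_power2)
next
  case False
  then have "(real j + 1) * (es A f j * es A f (Suc (Suc j))) < (real j + 2) * (es A f j * es A f (Suc (Suc j)))"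
    by (intro mult_strict_right_mono) auto
  also have "\<dots> \<le> (real j + 1) * (es A f (Suc j))\<^sup>2" using es_newton[OF assms(1), of j f] by (simp add: mult.assoc)
  finally show ?thesis by (subst (asm) mult_less_cancel_left_pos) auto
qed

text \<open>Deleting a variable leads from Gamma_k to Gamma_(k-1). At a first nonpositive
  \<open>es A f (Suc j)\<close>, eliminating \<open>f i\<close> from the positivity of two
  consecutive functions of the full set gives the reverse of log-concavity.\<close>

lemma es_Gamma_remove:
  assumes "finite A" "i \<notin> A" and pos: "\<And>j. 1 \<le> j \<Longrightarrow> j \<le> k \<Longrightarrow> es (insert i A) f j > 0"
  shows "j < k \<Longrightarrow> es A f j > 0"
proof (induction j)
  case 0 then show ?case using es_0[OF assms(1)] by simp
next
  case (Suc j)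
  let ?s = "es A f"
  have s: "?s j > 0" using Suc by simp
  have 1: "?s (Suc j) + f i * ?s j > 0"
    using pos[of "Suc j"] Suc.prems es_insert[OF assms(1,2)] by simp
  have 2: "?s (Suc (Suc j)) + f i * ?s (Suc j) > 0"
    using pos[of "Suc (Suc j)"] Suc.prems es_insert[OF assms(1,2)] by simp
  show ?case
  proof (rule ccontr)
    assume n: "\<not> ?s (Suc j) > 0"
    have "0 \<le> - ?s (Suc j) * (?s (Suc j) + f i * ?s j)" using n 1 by (intro mult_nonneg_nonneg) auto
    moreover have "0 < ?s j * (?s (Suc (Suc j)) + f i * ?s (Suc j))" using 2 s by simp
    ultimately have "?s j * ?s (Suc (Suc j)) > (?s (Suc j))\<^sup>2"
      by (simp add: algebra_simps power2_eq_square)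
    then show False using es_log_concave[OF assms(1), of f j] by simp
  qed
qed

text \<open>The ratios \<open>es A f (Suc j) / es A f j\<close> decrease strictly. The form without
  division matters: the top index \<open>Suc (Suc l + m)\<close> may equal \<open>k\<close>, where
  no sign is known.\<close>

lemma es_cross:
  assumes "finite A" and pos: "\<And>j. j < k \<Longrightarrow> es A f j > 0"
  shows "Suc l + m < k \<Longrightarrow> es A f (Suc (Suc l + m)) * es A f l < es A f (Suc l + m) * es A f (Suc l)"
proof (induction m)
  case 0
  then have "es A f (Suc l) \<noteq> 0" using pos[of "Suc l"] by simp
  from es_log_concave_strict[OF assms(1) this] show ?case by (simp add: power2_eq_square mult.commute)
next
  case (Suc m)
  let ?s = "es A f"
  let ?u = "?s (Suc l + m)" and ?v = "?s (Suc l + Suc m)" and ?w = "?s (Suc (Suc l + Suc m))"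
  have IH: "?v * ?s l < ?u * ?s (Suc l)" using Suc by simp
  have u: "?u > 0" "?v > 0" "?s l > 0" "?s (Suc l) > 0" using pos Suc.prems by auto
  have lc: "?u * ?w < ?v\<^sup>2" using es_log_concave_strict[OF assms(1), of f "Suc l + m"] u by simp
  have "?u * (?w * ?s l) < ?v\<^sup>2 * ?s l" using lc u by (metis mult.assoc mult_strict_right_mono)
  also have "\<dots> = ?v * (?v * ?s l)" by (simp add: power2_eq_square)
  also have "\<dots> < ?v * (?u * ?s (Suc l))" using IH u by simp
  also have "\<dots> = ?u * (?v * ?s (Suc l))" by simp
  finally show ?case using u by simp
qed

text \<open>Expansion of the product over subsets. The coefficient form carries real-rootedness and
  the deletion of a single index, neither of which is visible in the subset sum.\<close>

lemma esym_eq_es: "esym j f = es (UNIV :: 'n::finite set) f j"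
proof -
  have m: "(\<Prod>i\<in>X. [:0, f i:]) = monom (\<Prod>i\<in>X. f i) (card X)" if "finite X" for X :: "'n set"
    using that by (induction rule: finite_induct) (auto simp: monom_Suc mult_monom one_pCons monom_0 smult_monom)
  have "(\<Prod>i\<in>(UNIV::'n set). [:1, f i:]) = (\<Prod>i\<in>(UNIV::'n set). [:0, f i:] + 1)"
    by (simp add: one_pCons)
  also have "\<dots> = (\<Sum>X\<in>Pow UNIV. (\<Prod>i\<in>X. [:0, f i:]) * (\<Prod>i\<in>UNIV - X. 1))"
    by (rule prod_add) simp
  also have "\<dots> = (\<Sum>X\<in>UNIV. monom (\<Prod>i\<in>X. f i) (card X))"
    by (simp add: m)
  finally have "es UNIV f j = (\<Sum>X\<in>UNIV. if card X = j then (\<Prod>i\<in>X. f i) else 0)"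
    unfolding es_def by (simp add: coeff_sum)
  also have "\<dots> = esym j f"
    unfolding esym_def by (subst sum.inter_filter[symmetric]) auto
  finally show ?thesis by simp
qed

lemma es_cong: "(\<And>i. i \<in> A \<Longrightarrow> f i = g i) \<Longrightarrow> es A f j = es A g j"
  unfolding es_def by simp

lemma continuous_on_es:
  fixes A :: "'a::finite set"
  shows "continuous_on UNIV (\<lambda>f :: 'a \<Rightarrow> real. es A f j)"
proof -
  have "finite A" by simp
  then show ?thesis
  proof (induction A arbitrary: j rule: finite_induct)
    case empty
    then show ?case by (simp add: es_def)
  next
    case (insert i A)
    show ?case
    proof (cases j)
      case 0
      then show ?thesis using es_0[of "insert i A"] insert.hyps by simp
    next
      case (Suc m)
      show ?thesis unfolding Suc es_insert[OF insert.hyps]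
        by (intro continuous_intros insert.IH continuous_on_product_coordinates)
    qed
  qed
qed

lemma insert_Compl_singleton: "insert i (- {i}) = UNIV"
  by auto

lemma esym_split:
  fixes f :: "'n::finite \<Rightarrow> real"
  shows "esym (Suc j) f = es (- {i}) f (Suc j) + f i * es (- {i}) f j"
  using es_insert[of "- {i}" i f j] unfolding esym_eq_es insert_Compl_singleton by simp

lemma esym_0: "esym 0 f = 1"
  unfolding esym_eq_es by (simp add: es_0)

lemma esym_upd:
  fixes f :: "'n::finite \<Rightarrow> real"
  shows "esym (Suc j) (f(i := f i + s)) = esym (Suc j) f + s * es (- {i}) f j"
proof -
  have "es (- {i}) (f(i := f i + s)) m = es (- {i}) f m" for m
    by (rule es_cong) auto
  then show ?thesis unfolding esym_split[where i = i] by (simp add: algebra_simps)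
qed

section \<open>The quotient equation with denominators cleared, which makes it affine in each
  eigenvalue\<close>

definition gap :: "nat \<Rightarrow> nat \<Rightarrow> real \<Rightarrow> ('n::finite \<Rightarrow> real) \<Rightarrow> real" where
  "gap k l c f = esym k f - c * esym l f"

text \<open>The partial derivative of \<open>gap\<close> in the variable \<open>i\<close>. The case
  l = 0 is separate because truncated subtraction would give 1 instead of the derivative 0 of the
  constant \<open>esym 0\<close>.\<close>

definition gap_slope :: "nat \<Rightarrow> nat \<Rightarrow> real \<Rightarrow> 'n::finite \<Rightarrow> ('n \<Rightarrow> real) \<Rightarrow> real" where
  "gap_slope k l c i f = es (- {i}) f (k - 1) - c * (if l = 0 then 0 else es (- {i}) f (l - 1))"

lemma gap_upd:
  assumes "0 < k"
  shows "gap k l c (f(i := f i + s)) = gap k l c f + s * gap_slope k l c i f"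
proof -
  obtain k' where k: "k = Suc k'" using assms gr0_conv_Suc by auto
  show ?thesis
    using esym_upd[of k' f i s] esym_upd[of "l - 1" f i s]
    by (cases "l = 0") (simp_all add: gap_def gap_slope_def k esym_0 algebra_simps)
qed

lemma Gamma_remove:
  fixes f :: "'n::finite \<Rightarrow> real"
  assumes "f \<in> Gamma_cone k" "j < k"
  shows "es (- {i}) f j > 0"
  by (rule es_Gamma_remove[of "- {i}" i k]) (use assms in \<open>auto simp: Gamma_cone_def esym_eq_es insert_Compl_singleton\<close>)

lemma esym_pos:
  assumes "f \<in> Gamma_cone k" "j \<le> k"
  shows "esym j f > 0"
  using assms by (cases j) (auto simp: Gamma_cone_def esym_0)

text \<open>Equivalent to the positivity of the derivative of the quotient. With s for the functions
  without variable i, sigma_k s_(l-1) < s_(k-1) sigma_l holds because the terms containing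
  \<open>f i\<close> cancel and the rest is \<open>es_cross\<close>; nonnegative gap then allows c
  sigma_l to replace sigma_k on the left.\<close>

lemma gap_slope_pos:
  fixes f :: "'n::finite \<Rightarrow> real"
  assumes G: "f \<in> Gamma_cone k" and lk: "l < k" and g: "gap k l c f \<ge> 0"
  shows "gap_slope k l c i f > 0"
proof (cases l)
  case 0
  then show ?thesis using Gamma_remove[OF G, of "k - 1" i] lk by (simp add: gap_slope_def)
next
  case (Suc l')
  obtain m where m: "k = Suc (Suc l' + m)" using lk Suc less_iff_Suc_add by auto
  let ?s = "es (- {i}) f"
  have pos: "\<And>j. j < k \<Longrightarrow> ?s j > 0" using Gamma_remove[OF G] by blast
  have "?s (Suc (Suc l' + m)) * ?s l' < ?s (Suc l' + m) * ?s (Suc l')"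
    by (rule es_cross[of _ k]) (use pos m in auto)
  moreover have "esym k f = ?s (Suc (Suc l' + m)) + f i * ?s (Suc l' + m)"
    unfolding m by (rule esym_split)
  moreover have el: "esym l f = ?s (Suc l') + f i * ?s l'" unfolding Suc by (rule esym_split)
  ultimately have "esym k f * ?s l' < ?s (Suc l' + m) * esym l f"
    by (simp add: algebra_simps)
  moreover have "c * esym l f * ?s l' \<le> esym k f * ?s l'"
    using g pos[of l'] m by (intro mult_right_mono) (auto simp: gap_def)
  ultimately have "(c * ?s l') * esym l f < ?s (Suc l' + m) * esym l f" by (simp add: mult_ac)
  then have "c * ?s l' < ?s (Suc l' + m)"
    using esym_pos[OF G, of l] lk by (simp add: mult_less_cancel_right)
  then show ?thesis using m Suc by (simp add: gap_slope_def)
qed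

lemma Gamma_upd:
  assumes G: "f \<in> Gamma_cone k" and s: "s \<ge> 0"
  shows "f(i := f i + s) \<in> Gamma_cone k"
  unfolding Gamma_cone_def
proof (intro CollectI allI impI)
  fix j assume j: "1 \<le> j \<and> j \<le> k"
  then obtain j' where j': "j = Suc j'" by (cases j) auto
  have "esym j f > 0" using esym_pos[OF G] j by simp
  moreover have "s * es (- {i}) f j' \<ge> 0" using Gamma_remove[OF G, of j' i] j j' s by simp
  ultimately show "esym j (f(i := f i + s)) > 0" unfolding j' esym_upd by simp
qed

text \<open>The variables are raised one at a time. Both the cone and the sign of the gap survive
  each step, and together they keep the next slope positive.\<close>

lemma gap_mono:
  fixes f g :: "'n::finite \<Rightarrow> real"
  assumes lk: "l < k" and G: "f \<in> Gamma_cone k" and g0: "gap k l c f \<ge> 0" and le: "\<And>i. f i \<le> g i"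
  shows "gap k l c f \<le> gap k l c g"
proof -
  have "finite A \<Longrightarrow> (\<lambda>i. if i \<in> A then g i else f i) \<in> Gamma_cone k \<and>
      gap k l c f \<le> gap k l c (\<lambda>i. if i \<in> A then g i else f i)" for A :: "'n set"
  proof (induction A rule: finite_induct)
    case empty
    then show ?case using G by simp
  next
    case (insert a A)
    let ?h = "\<lambda>i. if i \<in> A then g i else f i"
    have e: "(\<lambda>i. if i \<in> insert a A then g i else f i) = ?h(a := ?h a + (g a - f a))"
      using insert.hyps by auto
    have "gap_slope k l c a ?h > 0"
      using insert.IH g0 by (intro gap_slope_pos[OF _ lk]) auto
    then have "gap k l c ?h \<le> gap k l c (?h(a := ?h a + (g a - f a)))"
      using le[of a] lk by (subst gap_upd) auto
    moreover have "?h(a := ?h a + (g a - f a)) \<in> Gamma_cone k"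
      using insert.IH le[of a] by (intro Gamma_upd) auto
    ultimately show ?case unfolding e using insert.IH by auto
  qed
  from this[of UNIV] show ?thesis by simp
qed

text \<open>Raising variable \<open>i\<close> first costs nothing, since the gap is affine in it,
  and leaves the slope evaluated at \<open>f\<close> itself, where compactness will bound it from
  below.\<close>

lemma gap_mono_strict:
  fixes f g :: "'n::finite \<Rightarrow> real"
  assumes lk: "l < k" and G: "f \<in> Gamma_cone k" and g0: "gap k l c f \<ge> 0" and le: "\<And>i. f i \<le> g i"
  shows "gap k l c f + (g i - f i) * gap_slope k l c i f \<le> gap k l c g"
proof -
  let ?h = "f(i := f i + (g i - f i))"
  have e: "gap k l c ?h = gap k l c f + (g i - f i) * gap_slope k l c i f"
    using lk by (intro gap_upd) auto
  have "gap_slope k l c i f > 0" using gap_slope_pos[OF G lk g0] .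
  then have "gap k l c ?h \<ge> 0" unfolding e using g0 le[of i] by simp
  moreover have "?h \<in> Gamma_cone k" using G le[of i] by (intro Gamma_upd) auto
  ultimately have "gap k l c ?h \<le> gap k l c g" using le by (intro gap_mono[OF lk]) auto
  then show ?thesis unfolding e .
qed

section \<open>Uniform estimates for spectra in a compact set\<close>

lemma prod_shift_bound:
  fixes f :: "'a \<Rightarrow> real"
  assumes "finite S" "\<And>i. \<bar>f i\<bar> \<le> R" "0 \<le> t" "t \<le> 1" "0 \<le> R"
  shows "\<bar>\<Prod>i\<in>S. f i\<bar> \<le> (R + 1) ^ card S \<and>
    \<bar>(\<Prod>i\<in>S. f i + t) - (\<Prod>i\<in>S. f i)\<bar> \<le> real (card S) * (R + 1) ^ card S * t"
  using assms(1)
proof (induction S rule: finite_induct)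
  case empty
  then show ?case by simp
next
  case (insert a S)
  let ?P = "\<Prod>i\<in>S. f i" and ?Q = "\<Prod>i\<in>S. f i + t" and ?M = "(R + 1) ^ card S"
  have M: "0 \<le> ?M" using assms by simp
  have fa: "\<bar>f a\<bar> \<le> R + 1" "\<bar>f a + t\<bar> \<le> R + 1" using assms(2)[of a] assms(3,4) by linarith+
  have 1: "\<bar>f a * ?P\<bar> \<le> (R + 1) * ?M"
    unfolding abs_mult using insert.IH fa assms by (intro mult_mono) auto
  have "(f a + t) * ?Q - f a * ?P = (f a + t) * (?Q - ?P) + t * ?P" by (simp add: algebra_simps)
  then have "\<bar>(f a + t) * ?Q - f a * ?P\<bar> \<le> \<bar>f a + t\<bar> * \<bar>?Q - ?P\<bar> + t * \<bar>?P\<bar>"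
    using assms(3) abs_triangle_ineq[of "(f a + t) * (?Q - ?P)" "t * ?P"] by (simp only: abs_mult abs_of_nonneg)
  also have "\<dots> \<le> (R + 1) * (real (card S) * ?M * t) + t * ?M"
    using insert.IH fa assms by (intro add_mono mult_mono) auto
  also have "\<dots> \<le> (R + 1) * (real (card S) * ?M * t) + (R + 1) * (t * ?M)"
  proof -
    have "1 * (t * ?M) \<le> (R + 1) * (t * ?M)" using assms M by (intro mult_right_mono) auto
    then show ?thesis by simp
  qed
  finally show ?case using 1 insert.hyps by (simp add: algebra_simps)
qed

lemma esym_shift_bound:
  fixes f :: "'n::finite \<Rightarrow> real"
  assumes "0 \<le> R"
  shows "\<exists>B\<ge>0. \<forall>f t. (\<forall>i :: 'n. \<bar>f i\<bar> \<le> R) \<longrightarrow> 0 \<le> t \<longrightarrow> t \<le> 1 \<longrightarrow>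
    \<bar>esym j (\<lambda>i. f i + t) - esym j f\<bar> \<le> B * t"
proof -
  let ?I = "{S :: 'n set. card S = j}" and ?b = "real j * (R + 1) ^ j"
  have "\<bar>esym j (\<lambda>i. f i + t) - esym j f\<bar> \<le> (real (card ?I) * ?b) * t"
    if f: "\<forall>i. \<bar>f i\<bar> \<le> R" and t: "0 \<le> t" "t \<le> 1" for f :: "'n \<Rightarrow> real" and t
  proof -
    have "\<bar>esym j (\<lambda>i. f i + t) - esym j f\<bar> = \<bar>\<Sum>S\<in>?I. (\<Prod>i\<in>S. f i + t) - (\<Prod>i\<in>S. f i)\<bar>"
      unfolding esym_def sum_subtractf ..
    also have "\<dots> \<le> (\<Sum>S\<in>?I. \<bar>(\<Prod>i\<in>S. f i + t) - (\<Prod>i\<in>S. f i)\<bar>)" by (rule sum_abs)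
    also have "\<dots> \<le> (\<Sum>S\<in>?I. ?b * t)"
      using prod_shift_bound[of _ f R t] f t assms by (intro sum_mono) auto
    finally show ?thesis by simp
  qed
  moreover have "0 \<le> real (card ?I) * ?b" using assms by simp
  ultimately show ?thesis by blast
qed

text \<open>Quantitative ellipticity, in the form needed at contact points, where the tensors are compared
  only up to an error \<open>\<tau>\<close>.\<close>
lemma level_set_elliptic:
  fixes K :: "('n::finite \<Rightarrow> real) set"
  assumes K: "compact K" and lk: "l < k" and c: "0 < c"
    and KG: "\<And>f. f \<in> K \<Longrightarrow> f \<in> Gamma_cone k \<and> gap k l c f = 0"
  shows "\<exists>C\<ge>0. \<forall>f\<in>K. \<forall>g\<in>K. \<forall>\<tau>\<ge>0. (\<forall>i. f i \<le> g i + \<tau>) \<longrightarrow> (\<Sum>i\<in>UNIV. g i + \<tau> - f i) \<le> C * \<tau>"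
proof (cases "K = {}")
  case True
  then show ?thesis by auto
next
  case ne: False
  have "\<exists>r. \<forall>f\<in>K. \<bar>f i\<bar> \<le> r" for i
  proof -
    have "continuous_on K (\<lambda>f. \<bar>f i\<bar>)"
      by (intro continuous_intros continuous_on_subset[OF continuous_on_product_coordinates]) auto
    from continuous_attains_sup[OF K ne this] show ?thesis by blast
  qed
  then obtain r where r: "\<And>i f. f \<in> K \<Longrightarrow> \<bar>f i\<bar> \<le> r i" by metis
  define R where "R = (\<Sum>i\<in>UNIV. \<bar>r i\<bar>)"
  have "\<bar>r i\<bar> \<le> R" for i unfolding R_def by (rule member_le_sum) auto
  then have R: "\<bar>f i\<bar> \<le> R" if "f \<in> K" for f i using r[OF that, of i] by (smt (verit))
  have R0: "0 \<le> R" unfolding R_def by (simp add: sum_nonneg)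
  have "\<exists>m>0. \<forall>f\<in>K. m \<le> gap_slope k l c i f" for i
  proof -
    have "continuous_on UNIV (\<lambda>f. gap_slope k l c i f)"
      unfolding gap_slope_def by (cases "l = 0") (auto intro!: continuous_intros continuous_on_es)
    then have "continuous_on K (\<lambda>f. gap_slope k l c i f)" by (rule continuous_on_subset) simp
    from continuous_attains_inf[OF K ne this]
    obtain f where "f \<in> K" "\<forall>g\<in>K. gap_slope k l c i f \<le> gap_slope k l c i g" by blast
    moreover have "gap_slope k l c i f > 0" using KG[OF \<open>f \<in> K\<close>] by (intro gap_slope_pos[OF _ lk]) auto
    ultimately show ?thesis by blast
  qed
  then obtain m where m: "\<And>i. m i > 0" "\<And>i f. f \<in> K \<Longrightarrow> m i \<le> gap_slope k l c i f" by metis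
  obtain B1 where B1: "B1 \<ge> 0" "\<And>f t. (\<forall>i :: 'n. \<bar>f i\<bar> \<le> R) \<Longrightarrow> 0 \<le> t \<Longrightarrow> t \<le> 1 \<Longrightarrow>
    \<bar>esym k (\<lambda>i. f i + t) - esym k f\<bar> \<le> B1 * t" using esym_shift_bound[OF R0, of k] by blast
  obtain B2 where B2: "B2 \<ge> 0" "\<And>f t. (\<forall>i :: 'n. \<bar>f i\<bar> \<le> R) \<Longrightarrow> 0 \<le> t \<Longrightarrow> t \<le> 1 \<Longrightarrow>
    \<bar>esym l (\<lambda>i. f i + t) - esym l f\<bar> \<le> B2 * t" using esym_shift_bound[OF R0, of l] by blast
  define B where "B = B1 + c * B2"
  have B0: "B \<ge> 0" unfolding B_def using B1(1) B2(1) c by simp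
  have B: "gap k l c (\<lambda>i. g i + t) \<le> B * t" if g: "g \<in> K" and t: "0 \<le> t" "t \<le> 1" for g t
  proof -
    have "c * (esym l g - esym l (\<lambda>i. g i + t)) \<le> c * (B2 * t)"
      using B2(2)[of g t] R[OF g] t c by (intro mult_left_mono) (auto simp: abs_le_iff)
    moreover have "esym k (\<lambda>i. g i + t) - esym k g \<le> B1 * t"
      using B1(2)[of g t] R[OF g] t by (auto simp: abs_le_iff)
    ultimately show ?thesis using KG[OF g] unfolding gap_def B_def by (simp add: algebra_simps)
  qed
  let ?n = "real CARD('n)"
  \<comment> \<open>The first summand serves \<tau> at most 1, where ellipticity is used; the second
    serves larger \<tau>, where boundedness of K suffices.\<close>
  define C where "C = (\<Sum>i\<in>UNIV. B / m i) + ?n * (2 * R + 1)"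
  have C1: "(\<Sum>i\<in>UNIV. B / m i) \<ge> 0" using B0 m(1) by (intro sum_nonneg) (simp add: less_imp_le)
  have C2: "?n * (2 * R + 1) \<ge> 0" using R0 by simp
  have "(\<Sum>i\<in>UNIV. g i + \<tau> - f i) \<le> C * \<tau>"
    if f: "f \<in> K" and g: "g \<in> K" and t: "\<tau> \<ge> 0" and le: "\<forall>i. f i \<le> g i + \<tau>" for f g \<tau>
  proof (cases "\<tau> \<le> 1")
    case True
    have "g i + \<tau> - f i \<le> B / m i * \<tau>" for i
    proof -
      \<comment> \<open>Both spectra lie on the zero level. Shifting \<open>g\<close> by \<tau>
        raises its gap by at most B \<tau>, and this total bounds the gain in every single
        variable.\<close>
      have "gap k l c f + (g i + \<tau> - f i) * gap_slope k l c i f \<le> gap k l c (\<lambda>i. g i + \<tau>)"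
        using KG[OF f] le by (intro gap_mono_strict[OF lk]) auto
      also have "\<dots> \<le> B * \<tau>" using B[OF g t True] .
      finally have "(g i + \<tau> - f i) * gap_slope k l c i f \<le> B * \<tau>" using KG[OF f] by simp
      moreover have "(g i + \<tau> - f i) * m i \<le> (g i + \<tau> - f i) * gap_slope k l c i f"
        using m(2)[OF f, of i] le[rule_format, of i] by (intro mult_left_mono) auto
      ultimately have "(g i + \<tau> - f i) * m i \<le> B * \<tau>" by simp
      then show ?thesis using m(1)[of i] by (simp add: field_simps)
    qed
    then have "(\<Sum>i\<in>UNIV. g i + \<tau> - f i) \<le> (\<Sum>i\<in>UNIV. B / m i * \<tau>)" by (rule sum_mono)
    also have "\<dots> = (\<Sum>i\<in>UNIV. B / m i) * \<tau>" by (simp add: sum_distrib_right)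
    also have "\<dots> \<le> C * \<tau>" unfolding C_def using t C2 by (intro mult_right_mono) auto
    finally show ?thesis .
  next
    case False
    have "g i + \<tau> - f i \<le> (2 * R + 1) * \<tau>" for i
    proof -
      have "2 * R * 1 \<le> 2 * R * \<tau>" using False R0 by (intro mult_left_mono) auto
      moreover have "g i - f i \<le> 2 * R" using R[OF f, of i] R[OF g, of i] by (simp add: abs_le_iff)
      ultimately show ?thesis by (simp add: algebra_simps)
    qed
    then have "(\<Sum>i\<in>UNIV. g i + \<tau> - f i) \<le> (\<Sum>i\<in>(UNIV::'n set). (2 * R + 1) * \<tau>)" by (rule sum_mono)
    also have "\<dots> = ?n * (2 * R + 1) * \<tau>" by simp
    also have "\<dots> \<le> C * \<tau>" unfolding C_def using t C1 by (intro mult_right_mono) auto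
    finally show ?thesis .
  qed
  moreover have "C \<ge> 0" unfolding C_def using C1 C2 by simp
  ultimately show ?thesis by blast
qed
section \<open>Eigenbases of symmetric forms\<close>

text \<open>Indexed by natural numbers, not by the dimension type, because Weyl's principle compares
  eigenvalues in a fixed order.\<close>

definition ortho_fam :: "nat \<Rightarrow> (nat \<Rightarrow> 'a::euclidean_space) \<Rightarrow> bool" where
  "ortho_fam d b \<longleftrightarrow> (\<forall>i<d. \<forall>j<d. b i \<bullet> b j = (if i = j then 1 else 0))"

lemma ortho_fam_independent:
  assumes "ortho_fam d b" "I \<subseteq> {..<d}"
  shows "independent (b ` I)" "dim (span (b ` I)) = card I"
proof -
  have inj: "inj_on b I"
  proof (rule inj_onI)
    fix i j assume "i \<in> I" "j \<in> I" "b i = b j"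
    then show "i = j" using assms unfolding ortho_fam_def by (metis lessThan_iff subsetD zero_neq_one)
  qed
  have "pairwise orthogonal (b ` I)"
    unfolding pairwise_def orthogonal_def using assms by (auto simp: ortho_fam_def subset_iff)
  moreover have "0 \<notin> b ` I"
    using assms unfolding ortho_fam_def by (metis image_iff inner_zero_left lessThan_iff subsetD zero_neq_one)
  ultimately show ind: "independent (b ` I)" by (rule pairwise_orthogonal_independent)
  then show "dim (span (b ` I)) = card I"
    by (simp add: dim_span dim_eq_card_independent card_image[OF inj])
qed

lemma ortho_fam_span_expand:
  assumes b: "ortho_fam d b" and I: "I \<subseteq> {..<d}" and u: "u \<in> span (b ` I)"
  shows "u = (\<Sum>i\<in>I. (u \<bullet> b i) *\<^sub>R b i)"
proof -
  have fin: "finite I" using I finite_subset by blast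
  show ?thesis using u
  proof (induction rule: span_induct_alt)
    case base
    then show ?case by simp
  next
    case (step c x y)
    then obtain j where j: "j \<in> I" "x = b j" by blast
    have "(\<Sum>i\<in>I. ((c *\<^sub>R x + y) \<bullet> b i) *\<^sub>R b i) = c *\<^sub>R (\<Sum>i\<in>I. (x \<bullet> b i) *\<^sub>R b i) + (\<Sum>i\<in>I. (y \<bullet> b i) *\<^sub>R b i)"
      by (simp add: inner_add_left scaleR_add_left sum.distrib scaleR_sum_right)
    also have "(\<Sum>i\<in>I. (x \<bullet> b i) *\<^sub>R b i) = (\<Sum>i\<in>I. if i = j then b j else 0)"
      using j b I by (intro sum.cong) (auto simp: ortho_fam_def subset_iff)
    also have "\<dots> = x" using j fin by (simp add: sum.delta)
    finally show ?case using step by simp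
  qed
qed

lemma ortho_fam_expand:
  assumes b: "ortho_fam d b" and S: "subspace S" "dim S = d" "\<And>i. i < d \<Longrightarrow> b i \<in> S" and u: "u \<in> S"
  shows "u = (\<Sum>i<d. (u \<bullet> b i) *\<^sub>R b i)"
proof -
  have "span (b ` {..<d}) = S"
    using S ortho_fam_independent(2)[OF b order.refl]
    by (intro subspace_dim_equal span_minimal) auto
  then show ?thesis using ortho_fam_span_expand[OF b order.refl] u by blast
qed

lemma ortho_fam_parseval:
  assumes b: "ortho_fam d b" and S: "subspace S" "dim S = d" "\<And>i. i < d \<Longrightarrow> b i \<in> S" and u: "u \<in> S"
  shows "u \<bullet> v = (\<Sum>i<d. (u \<bullet> b i) * (v \<bullet> b i))"
  by (subst ortho_fam_expand[OF assms])
    (simp_all add: inner_sum_left inner_commute[of v])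

definition bil_sym :: "('a::euclidean_space \<Rightarrow> 'a \<Rightarrow> real) \<Rightarrow> bool" where
  "bil_sym B \<longleftrightarrow> bilinear B \<and> (\<forall>u v. B u v = B v u)"

text \<open>Eigenvectors are found as successive maximizers of the quadratic form, hence in decreasing
  order of the eigenvalues.\<close>
lemma sorted_eigenbasis:
  fixes S :: "'a::euclidean_space set"
  assumes B: "bil_sym B" and "subspace S"
  shows "\<exists>b. ortho_fam (dim S) b \<and> (\<forall>i<dim S. b i \<in> S) \<and>
    (\<forall>i<dim S. \<forall>j<dim S. i \<noteq> j \<longrightarrow> B (b i) (b j) = 0) \<and>
    (\<forall>i<dim S. \<forall>u\<in>S. (\<forall>j<i. u \<bullet> b j = 0) \<longrightarrow> B u u \<le> B (b i) (b i) * (u \<bullet> u))"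
  using assms(2)
proof (induction "dim S" arbitrary: S)
  case 0
  then show ?case by (simp only: ortho_fam_def) auto
next
  case (Suc d)
  have bl: "bilinear B" and sym: "\<And>u v. B u v = B v u" using B by (auto simp: bil_sym_def)
  note bs = bilinear_ladd[OF bl] bilinear_radd[OF bl] bilinear_lmul[OF bl] bilinear_rmul[OF bl]
  let ?X = "sphere 0 1 \<inter> S"
  have "compact ?X" using closed_subspace[OF Suc.prems] by (simp add: compact_Int_closed)
  moreover have "?X \<noteq> {}"
  proof -
    have "dim S \<noteq> 0" using Suc.hyps(2) by linarith
    then obtain x where "x \<in> S" "x \<noteq> 0" by (auto simp: dim_eq_0)
    then have "x /\<^sub>R norm x \<in> ?X" using Suc.prems by (simp add: subspace_scale)
    then show ?thesis by blast
  qed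
  moreover have "continuous_on ?X (\<lambda>u. B u u)"
    using bl unfolding bilinear_conv_bounded_bilinear
    by (rule bounded_bilinear.continuous_on) (rule continuous_on_id)+
  ultimately obtain e where e: "e \<in> ?X" and mx: "\<And>u. u \<in> ?X \<Longrightarrow> B u u \<le> B e e"
    using continuous_attains_sup[of ?X "\<lambda>u. B u u"] by blast
  have ee: "e \<bullet> e = 1" "e \<in> S" using e by (auto simp: dot_square_norm)
  let ?m = "B e e"
  have mx': "B u u \<le> ?m * (u \<bullet> u)" if "u \<in> S" for u
  proof (cases "u = 0")
    case True then show ?thesis using bilinear_lzero[OF bl] by simp
  next
    case False
    then have "B (u /\<^sub>R norm u) (u /\<^sub>R norm u) \<le> ?m"
      using that Suc.prems by (intro mx) (simp add: subspace_scale)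
    then show ?thesis using False by (simp add: bs divide_simps dot_square_norm power2_eq_square)
  qed
  have orth: "B e v = 0" if v: "v \<in> S" "v \<bullet> e = 0" for v
  proof -
    \<comment> \<open>First variation at the maximizer e: a term linear in s, of either sign, is
      dominated by a quadratic one, so its coefficient must vanish.\<close>
    have "2 * s * B e v \<le> s\<^sup>2 * (?m * (v \<bullet> v) - B v v)" for s
    proof -
      have "B (e + s *\<^sub>R v) (e + s *\<^sub>R v) \<le> ?m * ((e + s *\<^sub>R v) \<bullet> (e + s *\<^sub>R v))"
        using ee v Suc.prems by (intro mx') (simp add: subspace_add subspace_scale)
      then show ?thesis using sym[of v e] v ee
        by (simp add: bs inner_add_left inner_add_right inner_commute power2_eq_square algebra_simps)
    qed
    then have H: "2 * s * B e v \<le> s\<^sup>2 * q" if "q = ?m * (v \<bullet> v) - B v v" for s q using that by blast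
    \<comment> \<open>A positive upper bound for the quadratic coefficient, so that s = B e v / q
      can be inserted.\<close>
    define q where "q = \<bar>?m * (v \<bullet> v) - B v v\<bar> + 1"
    have q: "q > 0" unfolding q_def by simp
    have "2 * s * B e v \<le> s\<^sup>2 * q" for s
    proof -
      have "?m * (v \<bullet> v) - B v v \<le> q" unfolding q_def by linarith
      then have "s\<^sup>2 * (?m * (v \<bullet> v) - B v v) \<le> s\<^sup>2 * q" by (rule mult_left_mono) simp
      then show ?thesis using H[OF refl, of s] by linarith
    qed
    from this[of "B e v / q"] have "2 * (B e v)\<^sup>2 / q \<le> (B e v)\<^sup>2 / q"
      using q by (simp add: power2_eq_square)
    then have "(B e v)\<^sup>2 \<le> 0" using q by (simp add: divide_simps split: if_splits)
    then show ?thesis by simp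
  qed
  define S' where "S' = S \<inter> {v. v \<bullet> e = 0}"
  have sub': "subspace S'" unfolding S'_def using Suc.prems
    by (auto simp: subspace_def inner_add_left)
  have "d = dim S'"
  proof -
    have "dim {x + y |x y. x \<in> S' \<and> y \<in> span {e}} + dim (S' \<inter> span {e}) = dim S' + dim (span {e})"
      by (rule dim_sums_Int[OF sub' subspace_span])
    moreover have "S' \<inter> span {e} = {0}"
      using ee subspace_0[OF sub'] by (auto simp: S'_def span_singleton)
    moreover have "{x + y |x y. x \<in> S' \<and> y \<in> span {e}} = S"
    proof (intro equalityI subsetI)
      fix u assume "u \<in> {x + y |x y. x \<in> S' \<and> y \<in> span {e}}"
      then show "u \<in> S" using Suc.prems ee by (auto simp: S'_def span_singleton subspace_add subspace_scale)
    next
      fix u assume u: "u \<in> S"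
      have "u - (u \<bullet> e) *\<^sub>R e \<in> S'"
        unfolding S'_def using u ee Suc.prems by (simp add: subspace_diff subspace_scale inner_diff_left)
      moreover have "(u \<bullet> e) *\<^sub>R e \<in> span {e}" by (simp add: span_base span_scale)
      moreover have "u = (u - (u \<bullet> e) *\<^sub>R e) + (u \<bullet> e) *\<^sub>R e" by simp
      ultimately show "u \<in> {x + y |x y. x \<in> S' \<and> y \<in> span {e}}" by blast
    qed
    moreover have "dim (span {e}) = 1" using ee dim_eq_card_independent[of "{e}"] by auto
    ultimately show ?thesis using Suc.hyps by simp
  qed
  note dS = this
  have "\<exists>b. ortho_fam d b \<and> (\<forall>i<d. b i \<in> S') \<and>
    (\<forall>i<d. \<forall>j<d. i \<noteq> j \<longrightarrow> B (b i) (b j) = 0) \<and>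
    (\<forall>i<d. \<forall>u\<in>S'. (\<forall>j<i. u \<bullet> b j = 0) \<longrightarrow> B u u \<le> B (b i) (b i) * (u \<bullet> u))"
    unfolding dS by (rule Suc.hyps(1)[OF dS sub'])
  then obtain b where b: "ortho_fam d b" "\<forall>i<d. b i \<in> S'"
    "\<forall>i<d. \<forall>j<d. i \<noteq> j \<longrightarrow> B (b i) (b j) = 0"
    "\<forall>i<d. \<forall>u\<in>S'. (\<forall>j<i. u \<bullet> b j = 0) \<longrightarrow> B u u \<le> B (b i) (b i) * (u \<bullet> u)"
    by (elim exE conjE) (rule that)
  have be: "b i \<bullet> e = 0" "b i \<in> S" if "i < d" for i using b(2) that by (auto simp: S'_def)
  have oe: "B e (b i) = 0" "B (b i) e = 0" if "i < d" for i
    using orth[OF be(2)[OF that] be(1)[OF that]] sym[of "b i" e] by simp_all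
  let ?b = "case_nat e b"
  have "ortho_fam (Suc d) ?b"
    unfolding ortho_fam_def using b(1) be ee
    by (auto simp: ortho_fam_def inner_commute split: nat.split)
  moreover have "\<forall>i<Suc d. ?b i \<in> S" using be ee by (auto split: nat.split)
  moreover have "\<forall>i<Suc d. \<forall>j<Suc d. i \<noteq> j \<longrightarrow> B (?b i) (?b j) = 0"
    using b(3) oe by (auto split: nat.split)
  moreover have "B u u \<le> B (?b i) (?b i) * (u \<bullet> u)"
    if i: "i < Suc d" and u: "u \<in> S" and z: "\<forall>j<i. u \<bullet> ?b j = 0" for i u
  proof (cases i)
    case 0 then show ?thesis using mx' u by simp
  next
    case (Suc i')
    have "u \<bullet> e = 0" using z[rule_format, of 0] Suc by simp
    moreover have "\<forall>j<i'. u \<bullet> b j = 0" using z Suc by (metis Suc_less_eq old.nat.simps(5))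
    ultimately show ?thesis using b(4) i u Suc by (simp add: S'_def)
  qed
  ultimately show ?case unfolding Suc.hyps(2)[symmetric] by blast
qed

lemma diag_expand:
  assumes B: "bil_sym B" and b: "ortho_fam d b" "\<forall>i<d. \<forall>j<d. i \<noteq> j \<longrightarrow> B (b i) (b j) = 0"
    and I: "I \<subseteq> {..<d}" and u: "u \<in> span (b ` I)"
  shows "B u u = (\<Sum>i\<in>I. B (b i) (b i) * (u \<bullet> b i)\<^sup>2)" "u \<bullet> u = (\<Sum>i\<in>I. (u \<bullet> b i)\<^sup>2)"
proof -
  have bl: "bilinear B" using B by (auto simp: bil_sym_def)
  have fin: "finite I" using I finite_subset by blast
  have ex: "u = (\<Sum>i\<in>I. (u \<bullet> b i) *\<^sub>R b i)" by (rule ortho_fam_span_expand[OF b(1) I u])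
  have "B u u = B (\<Sum>i\<in>I. (u \<bullet> b i) *\<^sub>R b i) (\<Sum>j\<in>I. (u \<bullet> b j) *\<^sub>R b j)" using ex by simp
  also have "\<dots> = (\<Sum>(i,j)\<in>I \<times> I. B ((u \<bullet> b i) *\<^sub>R b i) ((u \<bullet> b j) *\<^sub>R b j))"
    by (rule bilinear_sum[OF bl])
  also have "\<dots> = (\<Sum>i\<in>I. \<Sum>j\<in>I. if i = j then B (b i) (b i) * (u \<bullet> b i)\<^sup>2 else 0)"
    unfolding sum.cartesian_product[symmetric] using b(2) I
    by (intro sum.cong refl) (auto simp: bilinear_lmul[OF bl] bilinear_rmul[OF bl] power2_eq_square subset_iff)
  finally show "B u u = (\<Sum>i\<in>I. B (b i) (b i) * (u \<bullet> b i)\<^sup>2)" using fin by simp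
  have "u \<bullet> u = u \<bullet> (\<Sum>i\<in>I. (u \<bullet> b i) *\<^sub>R b i)" using ex by simp
  then show "u \<bullet> u = (\<Sum>i\<in>I. (u \<bullet> b i)\<^sup>2)" by (simp add: inner_sum_right power2_eq_square)
qed

text \<open>Weyl's monotonicity principle, by a dimension count.\<close>
lemma weyl_monotone:
  fixes S :: "'a::euclidean_space set"
  assumes A: "bil_sym A" and B: "bil_sym B" and S: "subspace S" "dim S = d"
    and a: "ortho_fam d a" "\<forall>i<d. a i \<in> S" "\<forall>i<d. \<forall>j<d. i \<noteq> j \<longrightarrow> A (a i) (a j) = 0"
      "\<forall>i<d. \<forall>u\<in>S. (\<forall>j<i. u \<bullet> a j = 0) \<longrightarrow> A u u \<le> A (a i) (a i) * (u \<bullet> u)"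
    and b: "ortho_fam d b" "\<forall>i<d. b i \<in> S"
      "\<forall>i<d. \<forall>u\<in>S. (\<forall>j<i. u \<bullet> b j = 0) \<longrightarrow> B u u \<le> B (b i) (b i) * (u \<bullet> u)"
    and le: "\<And>u. u \<in> S \<Longrightarrow> A u u \<le> B u u + \<tau> * (u \<bullet> u)" and i: "i < d"
  shows "A (a i) (a i) \<le> B (b i) (b i) + \<tau>"
proof -
  \<comment> \<open>The first i + 1 vectors of \<open>a\<close> and the last d - i of
    \<open>b\<close>: the dimensions add up to d + 1, so the two spans share a nonzero
    vector.\<close>
  let ?U = "span (a ` {..i})" and ?V = "span (b ` {i..<d})"
  have sub: "?U \<subseteq> S" "?V \<subseteq> S" using a(2) b(2) i S by (intro span_minimal; auto)+
  have "dim ?U = Suc i" using ortho_fam_independent(2)[OF a(1), of "{..i}"] i by (simp add: subset_iff)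
  moreover have "dim ?V = d - i" using ortho_fam_independent(2)[OF b(1), of "{i..<d}"] by (simp add: subset_iff)
  moreover have "dim {x + y |x y. x \<in> ?U \<and> y \<in> ?V} + dim (?U \<inter> ?V) = dim ?U + dim ?V"
    by (rule dim_sums_Int) auto
  moreover have "dim {x + y |x y. x \<in> ?U \<and> y \<in> ?V} \<le> d"
  proof -
    have "{x + y |x y. x \<in> ?U \<and> y \<in> ?V} \<subseteq> S"
    proof
      fix w assume "w \<in> {x + y |x y. x \<in> ?U \<and> y \<in> ?V}"
      then obtain x y where "w = x + y" "x \<in> ?U" "y \<in> ?V" by blast
      then show "w \<in> S" using sub subspace_add[OF S(1), of x y] by auto
    qed
    from dim_subset[OF this] show ?thesis unfolding S(2) .
  qed
  ultimately have "dim (?U \<inter> ?V) \<noteq> 0" using i by linarith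
  then obtain u where u: "u \<in> ?U" "u \<in> ?V" "u \<noteq> 0" by (auto simp: dim_eq_0)
  have uS: "u \<in> S" using u sub by blast
  have "A (a i) (a i) * (u \<bullet> u) \<le> A u u"
  proof -
    have I: "{..i} \<subseteq> {..<d}" using i by auto
    have "A (a i) (a i) \<le> A (a j) (a j)" if "j \<le> i" for j
    proof -
      have "\<forall>m<j. a i \<bullet> a m = 0" using a(1) that i by (auto simp: ortho_fam_def)
      then have "A (a i) (a i) \<le> A (a j) (a j) * (a i \<bullet> a i)" using a(2,4) i that by simp
      then show ?thesis using a(1) i by (simp add: ortho_fam_def)
    qed
    then have "(\<Sum>j\<le>i. A (a i) (a i) * (u \<bullet> a j)\<^sup>2) \<le> (\<Sum>j\<le>i. A (a j) (a j) * (u \<bullet> a j)\<^sup>2)"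
      by (intro sum_mono mult_right_mono) auto
    then show ?thesis using diag_expand[OF A a(1,3) I u(1)] by (simp add: sum_distrib_left)
  qed
  also have "\<dots> \<le> B u u + \<tau> * (u \<bullet> u)" by (rule le[OF uS])
  also have "B u u \<le> B (b i) (b i) * (u \<bullet> u)"
  proof -
    have "u \<bullet> b j = 0" if "j < i" for j
    proof -
      have "u = (\<Sum>m\<in>{i..<d}. (u \<bullet> b m) *\<^sub>R b m)" by (rule ortho_fam_span_expand[OF b(1) _ u(2)]) auto
      then have "u \<bullet> b j = (\<Sum>m\<in>{i..<d}. (u \<bullet> b m) *\<^sub>R b m) \<bullet> b j" by simp
      also have "\<dots> = (\<Sum>m\<in>{i..<d}. (u \<bullet> b m) * (b m \<bullet> b j))" by (simp add: inner_sum_left)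
      also have "\<dots> = 0" using b(1) that i by (intro sum.neutral) (auto simp: ortho_fam_def)
      finally show ?thesis .
    qed
    then show ?thesis using b(3) i uS by blast
  qed
  finally have "A (a i) (a i) * (u \<bullet> u) \<le> (B (b i) (b i) + \<tau>) * (u \<bullet> u)" by (simp add: algebra_simps)
  then show ?thesis using u(3) by (simp add: mult_le_cancel_right)
qed

text \<open>Needed because the eigenvalue sums of two tensors are compared in the eigenbasis of only
  one of them.\<close>

lemma trace_invariant:
  assumes A: "bil_sym A" and S: "subspace S" "dim S = d"
    and a: "ortho_fam d a" "\<forall>i<d. a i \<in> S" "\<forall>i<d. \<forall>j<d. i \<noteq> j \<longrightarrow> A (a i) (a j) = 0"
    and b: "ortho_fam d b" "\<forall>i<d. b i \<in> S"
  shows "(\<Sum>j<d. A (b j) (b j)) = (\<Sum>i<d. A (a i) (a i))"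
proof -
  have sp: "span (a ` {..<d}) = S"
    using S a(2) ortho_fam_independent(2)[OF a(1) order.refl]
    by (intro subspace_dim_equal span_minimal) auto
  have "(\<Sum>j<d. A (b j) (b j)) = (\<Sum>j<d. \<Sum>i<d. A (a i) (a i) * (b j \<bullet> a i)\<^sup>2)"
    using b(2) by (intro sum.cong refl diag_expand(1)[OF A a(1,3) order.refl]) (simp add: sp)
  also have "\<dots> = (\<Sum>i<d. \<Sum>j<d. A (a i) (a i) * (b j \<bullet> a i)\<^sup>2)" by (rule sum.swap)
  also have "\<dots> = (\<Sum>i<d. A (a i) (a i))"
  proof (intro sum.cong refl)
    fix i assume i: "i \<in> {..<d}"
    have "a i \<bullet> a i = (\<Sum>j<d. (a i \<bullet> b j) * (a i \<bullet> b j))"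
      using b i a(2) by (intro ortho_fam_parseval[OF b(1) S]) auto
    then have "(\<Sum>j<d. (b j \<bullet> a i)\<^sup>2) = 1"
      using a(1) i by (simp add: ortho_fam_def power2_eq_square inner_commute)
    then show "(\<Sum>j<d. A (a i) (a i) * (b j \<bullet> a i)\<^sup>2) = A (a i) (a i)"
      by (simp flip: sum_distrib_left)
  qed
  finally show ?thesis .
qed
section \<open>Spectra over the cap\<close>

text \<open>The second difference of H over the parallelogram spanned by s u and s v is symmetric in
  u and v, and divided by s^2 it tends to \<open>u \<bullet> G' v\<close>. The mean value theorem
  reduces it to increments of G, controlled by differentiability at the single point x.\<close>

lemma hessian_symmetric:
  fixes H :: "'a::real_inner \<Rightarrow> real"
  assumes U: "open U" "x \<in> U"
    and H: "\<And>y. y \<in> U \<Longrightarrow> (H has_derivative (\<lambda>v. G y \<bullet> v)) (at y)"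
    and G: "(G has_derivative G') (at x)"
  shows "u \<bullet> G' v = v \<bullet> G' u"
proof -
  have lin: "linear G'" using G has_derivative_linear by blast
  define M where "M = norm u + norm v + 1"
  have M: "M > 0" "norm u \<le> M" "norm v \<le> M" "norm u + norm v \<le> M" unfolding M_def by (auto simp: add_nonneg_pos)
  have key: "\<exists>d>0. \<forall>s. 0 < s \<and> s < d \<longrightarrow>
      \<bar>(H (x + s *\<^sub>R u + s *\<^sub>R v) - H (x + s *\<^sub>R u) - H (x + s *\<^sub>R v) + H x) - s\<^sup>2 * (u \<bullet> G' v)\<bar> \<le> e * s\<^sup>2"
    if e: "e > 0" and Mn: "norm u \<le> M" "norm v \<le> M" "norm u + norm v \<le> M" for e u v
  proof -
    \<comment> \<open>Chosen so that the final error s * (2 e' s M) * M equals e s^2.\<close>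
    define e' where "e' = e / (2 * M * M)"
    have e': "e' > 0" unfolding e'_def using e M by simp
    from G[unfolded has_derivative_at_alt] e' obtain d1 where d1: "d1 > 0"
      "\<And>y. norm (y - x) < d1 \<Longrightarrow> norm (G y - G x - G' (y - x)) \<le> e' * norm (y - x)" by blast
    obtain d2 where d2: "d2 > 0" "ball x d2 \<subseteq> U" using U open_contains_ball by blast
    define d where "d = min d1 d2 / M"
    have "d > 0" unfolding d_def using d1 d2 M by simp
    moreover have "\<bar>(H (x + s *\<^sub>R u + s *\<^sub>R v) - H (x + s *\<^sub>R u) - H (x + s *\<^sub>R v) + H x) - s\<^sup>2 * (u \<bullet> G' v)\<bar> \<le> e * s\<^sup>2"
      if s: "0 < s" "s < d" for s
    proof -
      have sM: "s * M < d1" "s * M < d2" using s M unfolding d_def by (auto simp: field_simps)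
      have nb: "norm (t *\<^sub>R (s *\<^sub>R u) + r *\<^sub>R (s *\<^sub>R v)) \<le> s * M" if "0 \<le> t" "t \<le> 1" "0 \<le> r" "r \<le> 1" for t r
      proof -
        have "norm (t *\<^sub>R (s *\<^sub>R u) + r *\<^sub>R (s *\<^sub>R v)) \<le> t * (s * norm u) + r * (s * norm v)"
          using norm_triangle_ineq[of "t *\<^sub>R (s *\<^sub>R u)" "r *\<^sub>R (s *\<^sub>R v)"] that s by simp
        also have "\<dots> \<le> 1 * (s * norm u) + 1 * (s * norm v)"
          using that s by (intro add_mono mult_right_mono) auto
        also have "\<dots> = s * (norm u + norm v)" by (simp add: algebra_simps)
        also have "\<dots> \<le> s * M" using Mn s by (intro mult_left_mono) auto
        finally show ?thesis .
      qed
      \<comment> \<open>The increment along v as a function of the position along u; its total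
        change from t = 0 to t = 1 is the second difference.\<close>
      define p where "p t = H (x + t *\<^sub>R (s *\<^sub>R u) + 1 *\<^sub>R (s *\<^sub>R v)) - H (x + t *\<^sub>R (s *\<^sub>R u) + 0 *\<^sub>R (s *\<^sub>R v))" for t :: real
      have inU: "x + t *\<^sub>R (s *\<^sub>R u) + r *\<^sub>R (s *\<^sub>R v) \<in> U" if "0 \<le> t" "t \<le> 1" "0 \<le> r" "r \<le> 1" for t r
        using nb[OF that] sM d2(2) by (auto simp: subset_iff dist_norm norm_minus_commute add.assoc)
      have der: "((\<lambda>t. H (x + t *\<^sub>R (s *\<^sub>R u) + r *\<^sub>R (s *\<^sub>R v))) has_derivative
          (\<lambda>h. h * (s * (G (x + t *\<^sub>R (s *\<^sub>R u) + r *\<^sub>R (s *\<^sub>R v)) \<bullet> u)))) (at t)"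
        if "0 \<le> t" "t \<le> 1" "0 \<le> r" "r \<le> 1" for t r
      proof -
        have "((\<lambda>t. x + t *\<^sub>R (s *\<^sub>R u) + r *\<^sub>R (s *\<^sub>R v)) has_derivative (\<lambda>h. h *\<^sub>R (s *\<^sub>R u))) (at t)"
          by (auto intro!: derivative_eq_intros)
        from has_derivative_compose[OF this H[OF inU[OF that]]] show ?thesis by (simp add: mult.assoc)
      qed
      define q where "q t r = G (x + t *\<^sub>R (s *\<^sub>R u) + r *\<^sub>R (s *\<^sub>R v)) - G x - G' (t *\<^sub>R (s *\<^sub>R u) + r *\<^sub>R (s *\<^sub>R v))" for t r :: real
      have q: "norm (q t r) \<le> e' * (s * M)" if "0 \<le> t" "t \<le> 1" "0 \<le> r" "r \<le> 1" for t r
      proof -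
        have "norm (t *\<^sub>R (s *\<^sub>R u) + r *\<^sub>R (s *\<^sub>R v)) < d1" using nb[OF that] sM by simp
        then have "norm (q t r) \<le> e' * norm (t *\<^sub>R (s *\<^sub>R u) + r *\<^sub>R (s *\<^sub>R v))"
          using d1(2)[of "x + (t *\<^sub>R (s *\<^sub>R u) + r *\<^sub>R (s *\<^sub>R v))"] unfolding q_def by (simp add: add.assoc)
        also have "\<dots> \<le> e' * (s * M)" using nb[OF that] e' by simp
        finally show ?thesis .
      qed
      have "\<exists>t\<in>{0<..<1}. p 1 - p 0 = (1 - 0) * (s * ((G (x + t *\<^sub>R (s *\<^sub>R u) + 1 *\<^sub>R (s *\<^sub>R v))
          - G (x + t *\<^sub>R (s *\<^sub>R u) + 0 *\<^sub>R (s *\<^sub>R v))) \<bullet> u))"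
      proof (rule mvt_simple)
        fix t :: real assume "0 \<le> t" "t \<le> 1"
        then have "(p has_derivative (\<lambda>h. h * (s * (G (x + t *\<^sub>R (s *\<^sub>R u) + 1 *\<^sub>R (s *\<^sub>R v)) \<bullet> u))
            - h * (s * (G (x + t *\<^sub>R (s *\<^sub>R u) + 0 *\<^sub>R (s *\<^sub>R v)) \<bullet> u)))) (at t)"
          unfolding p_def by (intro has_derivative_diff der) auto
        then show "(p has_derivative (\<lambda>h. h * (s * ((G (x + t *\<^sub>R (s *\<^sub>R u) + 1 *\<^sub>R (s *\<^sub>R v))
          - G (x + t *\<^sub>R (s *\<^sub>R u) + 0 *\<^sub>R (s *\<^sub>R v))) \<bullet> u)))) (at t within {0..1})"
          by (simp only: inner_diff_left right_diff_distrib has_derivative_at_withinI)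
      qed simp
      then obtain t where t': "t \<in> {0<..<1}" and pt': "p 1 - p 0 = (1 - 0) * (s * ((G (x + t *\<^sub>R (s *\<^sub>R u) + 1 *\<^sub>R (s *\<^sub>R v))
          - G (x + t *\<^sub>R (s *\<^sub>R u) + 0 *\<^sub>R (s *\<^sub>R v))) \<bullet> u))" by (rule bexE)
      have t: "0 < t" "t < 1" using t' by auto
      have pt: "p 1 - p 0 = s * ((G (x + t *\<^sub>R (s *\<^sub>R u) + 1 *\<^sub>R (s *\<^sub>R v))
          - G (x + t *\<^sub>R (s *\<^sub>R u) + 0 *\<^sub>R (s *\<^sub>R v))) \<bullet> u)" unfolding pt' by (simp only: diff_zero mult_1)
      have gd: "G (x + t *\<^sub>R (s *\<^sub>R u) + 1 *\<^sub>R (s *\<^sub>R v)) - G (x + t *\<^sub>R (s *\<^sub>R u) + 0 *\<^sub>R (s *\<^sub>R v))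
          = q t 1 - q t 0 + s *\<^sub>R G' v"
        unfolding q_def by (simp add: linear_add[OF lin] linear_scale[OF lin])
      have "p 1 - p 0 - s\<^sup>2 * (u \<bullet> G' v) = s * ((q t 1 - q t 0) \<bullet> u)"
        unfolding pt gd by (simp add: inner_add_left power2_eq_square algebra_simps inner_commute)
      then have "\<bar>p 1 - p 0 - s\<^sup>2 * (u \<bullet> G' v)\<bar> \<le> s * (norm (q t 1 - q t 0) * norm u)"
        using s Cauchy_Schwarz_ineq2[of "q t 1 - q t 0" u] by (simp add: abs_mult)
      also have "\<dots> \<le> s * ((2 * (e' * (s * M))) * M)"
      proof -
        have "norm (q t 1 - q t 0) \<le> norm (q t 1) + norm (q t 0)" by (rule norm_triangle_ineq4)
        also have "\<dots> \<le> 2 * (e' * (s * M))" using q[of t 1] q[of t 0] t by simp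
        finally show ?thesis using s Mn M e' by (intro mult_left_mono mult_mono) auto
      qed
      also have "\<dots> = e * s\<^sup>2" unfolding e'_def using M by (simp add: power2_eq_square)
      finally show ?thesis unfolding p_def by (simp add: algebra_simps)
    qed
    ultimately show ?thesis by blast
  qed
  have "\<bar>u \<bullet> G' v - v \<bullet> G' u\<bar> \<le> 2 * e" if e: "e > 0" for e
  proof -
    obtain d1 where d1: "d1 > 0" "\<And>s. 0 < s \<and> s < d1 \<Longrightarrow>
      \<bar>(H (x + s *\<^sub>R u + s *\<^sub>R v) - H (x + s *\<^sub>R u) - H (x + s *\<^sub>R v) + H x) - s\<^sup>2 * (u \<bullet> G' v)\<bar> \<le> e * s\<^sup>2"
      using key[OF e, of u v] M by auto
    obtain d2 where d2: "d2 > 0" "\<And>s. 0 < s \<and> s < d2 \<Longrightarrow>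
      \<bar>(H (x + s *\<^sub>R v + s *\<^sub>R u) - H (x + s *\<^sub>R v) - H (x + s *\<^sub>R u) + H x) - s\<^sup>2 * (v \<bullet> G' u)\<bar> \<le> e * s\<^sup>2"
      using key[OF e, of v u] M by auto
    define s where "s = min d1 d2 / 2"
    have s: "0 < s \<and> s < d1" "0 < s \<and> s < d2" unfolding s_def using d1(1) d2(1) by auto
    have e1: "x + s *\<^sub>R v + s *\<^sub>R u = x + s *\<^sub>R u + s *\<^sub>R v" by (simp add: algebra_simps)
    have "\<bar>s\<^sup>2 * (u \<bullet> G' v) - s\<^sup>2 * (v \<bullet> G' u)\<bar> \<le> 2 * (e * s\<^sup>2)"
      using d1(2)[OF s(1)] d2(2)[OF s(2), unfolded e1] by linarith
    then have "s\<^sup>2 * \<bar>u \<bullet> G' v - v \<bullet> G' u\<bar> \<le> s\<^sup>2 * (2 * e)"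
      unfolding right_diff_distrib[symmetric] abs_mult by (simp add: mult_ac)
    then show ?thesis using s by (simp add: mult_le_cancel_left)
  qed
  from this[of "\<bar>u \<bullet> G' v - v \<bullet> G' u\<bar> / 4"] show ?thesis by (cases "u \<bullet> G' v = v \<bullet> G' u") auto
qed

section \<open>Functions on the cap, parametrized by the unit normal\<close>

definition Cap :: "real \<Rightarrow> (real^('n::finite option)) set" where
  "Cap c = {N. norm N = 1 \<and> c \<le> N $ None}"

lemma compact_Cap: "compact (Cap c :: (real^('n::finite option)) set)"
proof -
  have "(Cap c :: (real^('n option)) set) = sphere 0 1 \<inter> {N. c \<le> N $ None}"
    by (auto simp: Cap_def)
  moreover have "closed {N :: real^('n option). c \<le> N $ None}"
    by (intro closed_Collect_le continuous_intros)
  ultimately show ?thesis by (simp add: compact_Int_closed)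
qed

locale sphere_C2 =
  fixes F :: "real^('n::finite option) \<Rightarrow> real"
    and D :: "real^('n option) \<Rightarrow> real^('n option)"
    and D' :: "real^('n option) \<Rightarrow> real^('n option) \<Rightarrow> real^('n option)"
    and U :: "(real^('n option)) set"
    and c :: real
  assumes C2: "C2_ext U F D D'" and CapU: "Cap c \<subseteq> U" and c: "- 1 < c" "c < 1"
begin

definition W :: "real^('n option) \<Rightarrow> real^('n option) \<Rightarrow> real^('n option) \<Rightarrow> real" where
  "W N u v = u \<bullet> D' N v - (u \<bullet> v) * (D N \<bullet> N) + F N * (u \<bullet> v)"

definition frame :: "real^('n option) \<Rightarrow> ('n \<Rightarrow> real^('n option)) \<Rightarrow> bool" where
  "frame N b \<longleftrightarrow> (\<forall>i j. b i \<bullet> b j = (if i = j then 1 else 0)) \<and> (\<forall>i. b i \<bullet> N = 0)"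

definition eig :: "real^('n option) \<Rightarrow> ('n \<Rightarrow> real) \<Rightarrow> bool" where
  "eig N lam \<longleftrightarrow> (\<exists>b. frame N b \<and> (\<forall>i j. W N (b i) (b j) = (if i = j then lam i else 0)))"

lemma open_U: "open U"
  and F_deriv: "x \<in> U \<Longrightarrow> (F has_derivative (\<lambda>v. D x \<bullet> v)) (at x)"
  and D_deriv: "x \<in> U \<Longrightarrow> (D has_derivative D' x) (at x)"
  and D'_cont: "continuous_on U (\<lambda>x. D' x v)"
  using C2 by (auto simp: C2_ext_def)

lemma D'_linear: "x \<in> U \<Longrightarrow> linear (D' x)"
  using D_deriv has_derivative_linear by blast

lemma bil_sym_W:
  assumes "N \<in> U"
  shows "bil_sym (W N)"
proof -
  note l = D'_linear[OF assms]
  have "u \<bullet> D' N v = v \<bullet> D' N u" for u v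
    by (rule hessian_symmetric[OF open_U assms F_deriv D_deriv[OF assms]])
  then have "W N u v = W N v u" for u v by (simp add: W_def inner_commute)
  moreover have "bilinear (W N)"
    unfolding bilinear_def W_def
    by (auto intro!: linearI simp: inner_add_left inner_add_right linear_add[OF l] linear_scale[OF l] algebra_simps)
  ultimately show ?thesis by (auto simp: bil_sym_def)
qed

lemma F_cont: "continuous_on U F"
  by (meson F_deriv continuous_at_imp_continuous_on has_derivative_continuous)

lemma D_cont: "continuous_on U D"
  by (meson D_deriv continuous_at_imp_continuous_on has_derivative_continuous)

lemma W_cont:
  assumes g: "continuous_on A g" "g ` A \<subseteq> U" and u: "continuous_on A u" and v: "continuous_on A v"
  shows "continuous_on A (\<lambda>z. W (g z) (u z) (v z))"
proof -
  have "D' (g z) (v z) = (\<Sum>i\<in>UNIV. v z $ i *\<^sub>R D' (g z) (axis i 1))" if "z \<in> A" for z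
  proof -
    have l: "linear (D' (g z))" using D'_linear g(2) that by blast
    have "D' (g z) (v z) = D' (g z) (\<Sum>i\<in>UNIV. v z $ i *\<^sub>R axis i 1)"
      using basis_expansion[of "v z"] by (simp add: scalar_mult_eq_scaleR)
    then show ?thesis by (simp add: linear_sum[OF l] linear_scale[OF l])
  qed
  moreover have "continuous_on A (\<lambda>z. \<Sum>i\<in>UNIV. v z $ i *\<^sub>R D' (g z) (axis i 1))"
    by (intro continuous_intros v continuous_on_compose2[OF D'_cont g(1) g(2)])
  ultimately have "continuous_on A (\<lambda>z. D' (g z) (v z))" by (subst continuous_on_cong[OF refl]) auto
  then show ?thesis unfolding W_def
    by (intro continuous_intros u v g(1) continuous_on_compose2[OF F_cont g(1) g(2)]
        continuous_on_compose2[OF D_cont g(1) g(2)])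
qed

text \<open>Eigenframes need not depend continuously on the point. Compactness is therefore proved
  for the set of all pairs of a point and a diagonalizing frame, and the eigenvalues are a
  continuous image of it.\<close>

lemma compact_eigs: "compact {lam. \<exists>N\<in>Cap c. eig N lam}"
proof -
  let ?A = "Cap c \<times> (UNIV :: ((real^('n option))^'n) set)"
  \<comment> \<open>A sum of absolute values collects orthonormality, tangency and diagonality into
    one continuous equation, so that its zero set is closed.\<close>
  define \<Phi> where "\<Phi> = (\<lambda>z :: (real^('n option)) \<times> ((real^('n option))^'n).
    (\<Sum>i\<in>UNIV. \<Sum>j\<in>UNIV. \<bar>snd z $ i \<bullet> snd z $ j - (if i = j then 1 else 0)\<bar>)
    + (\<Sum>i\<in>UNIV. \<bar>snd z $ i \<bullet> fst z\<bar>)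
    + (\<Sum>i\<in>UNIV. \<Sum>j\<in>UNIV. if i = j then 0 else \<bar>W (fst z) (snd z $ i) (snd z $ j)\<bar>))"
  define Z where "Z = {z \<in> ?A. \<Phi> z = 0}"
  define L where "L z = (\<lambda>i. W (fst z) (snd z $ i) (snd z $ i))" for z :: "(real^('n option)) \<times> ((real^('n option))^'n)"
  have img: "fst ` ?A \<subseteq> U" using CapU by auto
  have cW: "continuous_on ?A (\<lambda>z. W (fst z) (snd z $ i) (snd z $ j))" for i j
    by (intro W_cont img continuous_intros)
  have "continuous_on ?A \<Phi>" unfolding \<Phi>_def
  proof (intro continuous_intros)
    show "continuous_on ?A (\<lambda>z. if i = j then 0 else \<bar>W (fst z) (snd z $ i) (snd z $ j)\<bar>)" for i j
      by (cases "i = j") (auto intro!: continuous_intros cW)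
  qed
  moreover have "closed ?A" using compact_Cap compact_imp_closed by (intro closed_Times) auto
  ultimately have "closed Z" unfolding Z_def by (rule continuous_closed_preimage_constant)
  have Zi: "z \<in> Z \<longleftrightarrow> fst z \<in> Cap c \<and> frame (fst z) (\<lambda>i. snd z $ i) \<and>
     (\<forall>i j. i \<noteq> j \<longrightarrow> W (fst z) (snd z $ i) (snd z $ j) = 0)" for z
  proof -
    have d0: "(\<Sum>i\<in>UNIV. \<Sum>j\<in>UNIV. f i j) = 0 \<longleftrightarrow> (\<forall>i j. f i j = 0)"
      if "\<And>i j. f i j \<ge> 0" for f :: "'n \<Rightarrow> 'n \<Rightarrow> real"
      using that by (subst sum_nonneg_eq_0_iff) (auto intro: sum_nonneg simp: sum_nonneg_eq_0_iff)
    have e0: "(\<Sum>i\<in>UNIV. f i) = 0 \<longleftrightarrow> (\<forall>i. f i = 0)" if "\<And>i. f i \<ge> 0" for f :: "'n \<Rightarrow> real"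
      using that by (subst sum_nonneg_eq_0_iff) auto
    define s1 s2 s3 where "s1 = (\<Sum>i\<in>UNIV. \<Sum>j\<in>UNIV. \<bar>snd z $ i \<bullet> snd z $ j - (if i = j then 1 else 0)\<bar>)"
      and "s2 = (\<Sum>i\<in>UNIV. \<bar>snd z $ i \<bullet> fst z\<bar>)"
      and "s3 = (\<Sum>i\<in>UNIV. \<Sum>j\<in>UNIV. if i = j then 0 else \<bar>W (fst z) (snd z $ i) (snd z $ j)\<bar>)"
    have nn: "s1 \<ge> 0" "s2 \<ge> 0" "s3 \<ge> 0" unfolding s1_def s2_def s3_def by (auto intro!: sum_nonneg)
    have "s1 = 0 \<longleftrightarrow> (\<forall>i j. snd z $ i \<bullet> snd z $ j = (if i = j then 1 else 0))"
      unfolding s1_def by (subst d0) auto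
    moreover have "s2 = 0 \<longleftrightarrow> (\<forall>i. snd z $ i \<bullet> fst z = 0)"
      unfolding s2_def by (subst e0) auto
    moreover have "s3 = 0 \<longleftrightarrow> (\<forall>i j. i \<noteq> j \<longrightarrow> W (fst z) (snd z $ i) (snd z $ j) = 0)"
      unfolding s3_def by (subst d0) (auto split: if_splits)
    moreover have "\<Phi> z = s1 + s2 + s3" unfolding \<Phi>_def s1_def s2_def s3_def ..
    ultimately have "\<Phi> z = 0 \<longleftrightarrow> (\<forall>i j. snd z $ i \<bullet> snd z $ j = (if i = j then 1 else 0)) \<and> (\<forall>i. snd z $ i \<bullet> fst z = 0)
       \<and> (\<forall>i j. i \<noteq> j \<longrightarrow> W (fst z) (snd z $ i) (snd z $ j) = 0)"
      using nn by (simp add: add_nonneg_eq_0_iff)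
    then show ?thesis unfolding Z_def frame_def by (cases z) auto
  qed
  have "bounded Z"
  proof -
    have "norm z \<le> 1 + real CARD('n)" if "z \<in> Z" for z
    proof -
      have "norm (snd z $ i) = 1" for i
        using that unfolding Zi frame_def norm_eq_sqrt_inner by auto
      then have "norm (snd z) \<le> real CARD('n)"
        using L2_set_le_sum[of UNIV "\<lambda>i. norm (snd z $ i)"] by (simp add: norm_vec_def)
      moreover have "norm (fst z) = 1" using that unfolding Zi Cap_def by auto
      ultimately show ?thesis using norm_Pair_le[of "fst z" "snd z"] by simp
    qed
    then show ?thesis by (rule boundedI)
  qed
  have "compact Z" using \<open>closed Z\<close> \<open>bounded Z\<close> by (simp add: compact_eq_bounded_closed)
  moreover have "continuous_on Z L"
    unfolding L_def
    by (intro continuous_on_coordinatewise_then_product continuous_on_subset[OF cW]) (auto simp: Z_def)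
  ultimately have "compact (L ` Z)" by (rule compact_continuous_image[rotated])
  moreover have "L ` Z = {lam. \<exists>N\<in>Cap c. eig N lam}"
  proof (intro equalityI subsetI)
    fix lam assume "lam \<in> L ` Z"
    then obtain z where z: "z \<in> Z" "lam = L z" by blast
    then show "lam \<in> {lam. \<exists>N\<in>Cap c. eig N lam}"
      unfolding Zi eig_def L_def by (auto intro!: bexI[of _ "fst z"] exI[of _ "\<lambda>i. snd z $ i"])
  next
    fix lam assume "lam \<in> {lam. \<exists>N\<in>Cap c. eig N lam}"
    then obtain N b where b: "N \<in> Cap c" "frame N b" "\<And>i j. W N (b i) (b j) = (if i = j then lam i else 0)"
      unfolding eig_def by blast
    then have "(N, \<chi> i. b i) \<in> Z" unfolding Zi frame_def by simp
    moreover have "lam = L (N, \<chi> i. b i)" unfolding L_def using b(3) by auto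
    ultimately show "lam \<in> L ` Z" by blast
  qed
  ultimately show ?thesis by simp
qed

end

section \<open>The curvature equation and its ellipticity constant\<close>

locale curvature_eq = sphere_C2 F D D' U c
  for F :: "real^('n::finite option) \<Rightarrow> real"
    and D :: "real^('n option) \<Rightarrow> real^('n option)"
    and D' :: "real^('n option) \<Rightarrow> real^('n option) \<Rightarrow> real^('n option)"
    and U :: "(real^('n option)) set"
    and c :: real +
  fixes k l :: nat and c0 :: real
  assumes lk: "l < k" and kn: "k \<le> CARD('n)"
    and c0: "c0 = real (CARD('n) choose k) / real (CARD('n) choose l)"
    and adm: "\<And>N lam. N \<in> Cap c \<Longrightarrow> eig N lam \<Longrightarrow> lam \<in> Gamma_cone k"
    and eqn: "\<And>N lam. N \<in> Cap c \<Longrightarrow> eig N lam \<Longrightarrow> gap k l c0 lam = 0"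
begin

lemma esym_one: "esym j (\<lambda>i :: 'n. 1) = real (CARD('n) choose j)"
  unfolding esym_def using n_subsets[of "UNIV :: 'n set" j] by simp

text \<open>The vector of ones is the spectrum of the model solution, whose tensor is \<sigma>. With
  it in the set, the same constant also compares h with the model.\<close>

definition spectra :: "('n \<Rightarrow> real) set" where
  "spectra = insert (\<lambda>_. 1) {lam. \<exists>N\<in>Cap c. eig N lam}"

lemma spectra_elliptic:
  "\<exists>C\<ge>0. \<forall>f\<in>spectra. \<forall>g\<in>spectra. \<forall>\<tau>\<ge>0. (\<forall>i. f i \<le> g i + \<tau>) \<longrightarrow> (\<Sum>i\<in>UNIV. g i + \<tau> - f i) \<le> C * \<tau>"
proof (rule level_set_elliptic[OF _ lk])
  show "compact spectra" unfolding spectra_def by (intro compact_insert compact_eigs)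
  have ln: "CARD('n) choose l > 0" using lk kn by (simp add: zero_less_binomial)
  have kn': "CARD('n) choose k > 0" using kn by (simp add: zero_less_binomial)
  show "0 < c0" unfolding c0 using ln kn' by simp
  fix f assume "f \<in> spectra"
  then consider "f = (\<lambda>_. 1)" | N where "N \<in> Cap c" "eig N f" unfolding spectra_def by blast
  then show "f \<in> Gamma_cone k \<and> gap k l c0 f = 0"
  proof cases
    case 1
    then show ?thesis using kn ln unfolding Gamma_cone_def gap_def
      by (auto simp: esym_one c0 zero_less_binomial)
  next
    case 2
    then show ?thesis using adm eqn by blast
  qed
qed

text \<open>One constant for the whole cap, fixed in advance so that the barrier parameters can be
  chosen in terms of it.\<close>

definition Cell :: real where
  "Cell = (SOME C. C \<ge> 0 \<and> (\<forall>f\<in>spectra. \<forall>g\<in>spectra. \<forall>\<tau>\<ge>0. (\<forall>i. f i \<le> g i + \<tau>) \<longrightarrow> (\<Sum>i\<in>UNIV. g i + \<tau> - f i) \<le> C * \<tau>))"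

lemma Cell: "Cell \<ge> 0"
    "f \<in> spectra \<Longrightarrow> g \<in> spectra \<Longrightarrow> \<tau> \<ge> 0 \<Longrightarrow> (\<And>i. f i \<le> g i + \<tau>) \<Longrightarrow> (\<Sum>i\<in>UNIV. g i + \<tau> - f i) \<le> Cell * \<tau>"
  using someI_ex[OF spectra_elliptic, folded Cell_def] by blast+

text \<open>By Weyl's principle the ordered eigenvalues at \<open>N2\<close> exceed those at
  \<open>N1\<close> by at most \<tau>, so ellipticity bounds the sum of the slacks by Cell \<tau>.
  That sum is a trace, and the term with t contributes to it t times the squared length of the
  tangential part of w.\<close>

lemma elliptic_comparison:
  assumes N: "N1 \<in> Cap c" "N2 \<in> Cap c" and R: "orthogonal_transformation R" "R N1 = N2"
    and t: "0 \<le> t" and tau: "0 \<le> \<tau>"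
    and le: "\<And>u. u \<bullet> N1 = 0 \<Longrightarrow> W N2 (R u) (R u) + t * (u \<bullet> w)\<^sup>2 \<le> W N1 u u + \<tau> * (u \<bullet> u)"
  shows "t * (w \<bullet> w - (w \<bullet> N1)\<^sup>2) \<le> Cell * \<tau>"
proof -
  define S where "S = {u. N1 \<bullet> u = 0}"
  let ?d = "CARD('n)"
  have n1: "N1 \<bullet> N1 = 1" using N(1) by (simp add: Cap_def dot_square_norm)
  have S: "subspace S" "dim S = ?d"
  proof -
    show "subspace S" unfolding S_def by (rule subspace_hyperplane)
    have "N1 \<noteq> 0" using n1 by auto
    then show "dim S = ?d" unfolding S_def by (simp add: dim_hyperplane)
  qed
  have U: "N1 \<in> U" "N2 \<in> U" using N CapU by auto
  have linR: "linear R" and Ri: "\<And>u v. R u \<bullet> R v = u \<bullet> v"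
    using R(1) by (auto simp: orthogonal_transformation_def)
  define A where "A u v = W N2 (R u) (R v)" for u v
  define B where "B = W N1"
  have B: "bil_sym B" unfolding B_def by (rule bil_sym_W[OF U(1)])
  have A: "bil_sym A"
  proof -
    have "bil_sym (W N2)" by (rule bil_sym_W[OF U(2)])
    then have b: "bilinear (W N2)" and s: "\<And>u v. W N2 u v = W N2 v u" by (auto simp: bil_sym_def)
    have "bilinear A" unfolding bilinear_def A_def
      by (auto intro!: linearI simp: linear_add[OF linR] linear_scale[OF linR]
          bilinear_ladd[OF b] bilinear_radd[OF b] bilinear_lmul[OF b] bilinear_rmul[OF b])
    then show ?thesis using s by (simp add: bil_sym_def A_def)
  qed
  obtain a where a: "ortho_fam ?d a" "\<forall>i<?d. a i \<in> S" "\<forall>i<?d. \<forall>j<?d. i \<noteq> j \<longrightarrow> A (a i) (a j) = 0"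
      "\<forall>i<?d. \<forall>u\<in>S. (\<forall>j<i. u \<bullet> a j = 0) \<longrightarrow> A u u \<le> A (a i) (a i) * (u \<bullet> u)"
    using sorted_eigenbasis[OF A S(1)] unfolding S(2) by (elim exE conjE) (rule that)
  obtain b where b: "ortho_fam ?d b" "\<forall>i<?d. b i \<in> S" "\<forall>i<?d. \<forall>j<?d. i \<noteq> j \<longrightarrow> B (b i) (b j) = 0"
      "\<forall>i<?d. \<forall>u\<in>S. (\<forall>j<i. u \<bullet> b j = 0) \<longrightarrow> B u u \<le> B (b i) (b i) * (u \<bullet> u)"
    using sorted_eigenbasis[OF B S(1)] unfolding S(2) by (elim exE conjE) (rule that)
  obtain h :: "'n \<Rightarrow> nat" where h: "bij_betw h UNIV {..<?d}"
    using ex_bij_betw_finite_nat[of "UNIV :: 'n set"] by (auto simp: atLeast0LessThan)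
  have hd: "h i < ?d" for i using h by (auto simp: bij_betw_def)
  have hi: "h i = h j \<longleftrightarrow> i = j" for i j using h by (auto simp: bij_betw_def inj_on_def)
  define lam where "lam i = A (a (h i)) (a (h i))" for i
  define mu where "mu i = B (b (h i)) (b (h i))" for i
  have "eig N2 lam"
    unfolding eig_def
  proof (intro exI conjI allI)
    show "frame N2 (\<lambda>i. R (a (h i)))"
      unfolding frame_def R(2)[symmetric] Ri using a(1,2) hd hi
      by (auto simp: ortho_fam_def S_def inner_commute)
    show "W N2 (R (a (h i))) (R (a (h j))) = (if i = j then lam i else 0)" for i j
      using a(3) hd hi by (auto simp: A_def lam_def)
  qed
  then have lam: "lam \<in> spectra" using N(2) by (auto simp: spectra_def)
  have "eig N1 mu"
    unfolding eig_def
  proof (intro exI conjI allI)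
    show "frame N1 (\<lambda>i. b (h i))"
      unfolding frame_def using b(1,2) hd hi
      by (auto simp: ortho_fam_def S_def inner_commute)
    show "W N1 (b (h i)) (b (h j)) = (if i = j then mu i else 0)" for i j
      using b(3) hd hi by (auto simp: B_def mu_def)
  qed
  then have mu: "mu \<in> spectra" using N(1) by (auto simp: spectra_def)
  have leS: "A u u + t * (u \<bullet> w)\<^sup>2 \<le> B u u + \<tau> * (u \<bullet> u)" if "u \<in> S" for u
    using le[of u] that by (simp add: S_def A_def B_def inner_commute)
  have "A u u \<le> B u u + \<tau> * (u \<bullet> u)" if "u \<in> S" for u
  proof -
    have "t * (u \<bullet> w)\<^sup>2 \<ge> 0" using t by simp
    then show ?thesis using leS[OF that] by linarith
  qed
  then have "A (a i) (a i) \<le> B (b i) (b i) + \<tau>" if "i < ?d" for i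
    using weyl_monotone[OF A B S a b(1,2,4) _ that] by blast
  then have "lam i \<le> mu i + \<tau>" for i using hd by (simp add: lam_def mu_def)
  then have C: "(\<Sum>i\<in>UNIV. mu i + \<tau> - lam i) \<le> Cell * \<tau>" by (rule Cell(2)[OF lam mu tau])
  have re: "(\<Sum>i\<in>UNIV. f (h i)) = (\<Sum>j<?d. f j)" for f :: "nat \<Rightarrow> real"
    by (rule sum.reindex_bij_betw[OF h])
  have "(\<Sum>i\<in>UNIV. lam i) = (\<Sum>j<?d. A (b j) (b j))"
    unfolding lam_def trace_invariant[OF A S a(1-3) b(1,2)] by (rule re)
  moreover have "(\<Sum>i\<in>UNIV. mu i) = (\<Sum>j<?d. B (b j) (b j))" unfolding mu_def by (rule re)
  moreover have "(\<Sum>j<?d. A (b j) (b j) + t * (b j \<bullet> w)\<^sup>2) \<le> (\<Sum>j<?d. B (b j) (b j) + \<tau>)"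
  proof (rule sum_mono)
    fix j assume "j \<in> {..<?d}"
    then show "A (b j) (b j) + t * (b j \<bullet> w)\<^sup>2 \<le> B (b j) (b j) + \<tau>"
      using leS[of "b j"] b(1,2) by (simp add: ortho_fam_def)
  qed
  moreover have "(\<Sum>j<?d. (b j \<bullet> w)\<^sup>2) = w \<bullet> w - (w \<bullet> N1)\<^sup>2"
  proof -
    define v where "v = w - (w \<bullet> N1) *\<^sub>R N1"
    have v: "v \<in> S" unfolding S_def v_def using n1 by (simp add: inner_diff_right inner_commute)
    have "b j \<bullet> w = v \<bullet> b j" if "j < ?d" for j
      using b(2) that unfolding v_def S_def by (simp add: inner_diff_left inner_diff_right inner_commute)
    then have "(\<Sum>j<?d. (b j \<bullet> w)\<^sup>2) = (\<Sum>j<?d. (v \<bullet> b j) * (v \<bullet> b j))"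
      by (intro sum.cong) (auto simp: power2_eq_square)
    also have "\<dots> = v \<bullet> v" using b(2) v by (intro ortho_fam_parseval[OF b(1) S, symmetric]) auto
    also have "\<dots> = w \<bullet> w - (w \<bullet> N1)\<^sup>2"
      unfolding v_def using n1 by (simp add: inner_diff_left inner_diff_right inner_commute power2_eq_square)
    finally show ?thesis .
  qed
  ultimately show ?thesis using C
    by (simp add: sum.distrib sum_subtractf flip: sum_distrib_left)
qed

end
section \<open>Reflections, geodesics and barriers\<close>

lemma second_derivative_at_max:
  fixes f :: "real \<Rightarrow> real"
  assumes e: "0 < e" and mx: "\<And>s. \<bar>s\<bar> < e \<Longrightarrow> f s \<le> f 0"
    and f': "\<And>s. \<bar>s\<bar> < e \<Longrightarrow> (f has_real_derivative f' s) (at s)"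
    and d: "(f' has_real_derivative d) (at 0)"
  shows "d \<le> 0"
proof (rule ccontr)
  assume "\<not> d \<le> 0"
  then have "d > 0" by simp
  have f0: "f' 0 = 0"
    using DERIV_local_max[OF f'[of 0] e] mx e by simp
  from DERIV_pos_inc_right[OF d \<open>d > 0\<close>] obtain r where r: "r > 0" "\<And>h. 0 < h \<Longrightarrow> h < r \<Longrightarrow> f' 0 < f' (0 + h)"
    by auto
  define h where "h = min e r / 2"
  have h: "0 < h" "h < e" "h < r" using e r by (auto simp: h_def)
  have "\<exists>z. 0 < z \<and> z < h \<and> f h - f 0 = (h - 0) * f' z"
    by (rule MVT2) (use h f' in auto)
  then obtain z where "0 < z" "z < h" "f h - f 0 = h * f' z" by auto
  moreover have "f' z > 0" using r(2)[of z] f0 calculation h by simp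
  ultimately have "f h > f 0" using h by (simp add: zero_less_mult_iff algebra_simps)
  then show False using mx[of h] h by simp
qed

section \<open>Reflections and great circles\<close>

definition mirror :: "'a::euclidean_space \<Rightarrow> 'a \<Rightarrow> 'a" where
  "mirror n u = u - (2 * (u \<bullet> n)) *\<^sub>R n"

lemma mirror_linear: "linear (mirror n)"
  unfolding mirror_def by (auto intro!: linearI simp: inner_add_left algebra_simps)

lemma mirror_inner: "n \<bullet> n = 1 \<Longrightarrow> mirror n u \<bullet> mirror n v = u \<bullet> v"
  unfolding mirror_def by (simp add: inner_diff_left inner_diff_right algebra_simps inner_commute)

lemma mirror_orthogonal: "n \<bullet> n = 1 \<Longrightarrow> orthogonal_transformation (mirror n)"
  unfolding orthogonal_transformation_def using mirror_linear mirror_inner by blast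

lemma mirror_normal: "n \<bullet> n = 1 \<Longrightarrow> mirror n u \<bullet> n = - (u \<bullet> n)"
  unfolding mirror_def by (simp add: inner_diff_left)

lemma mirror_mirror: "n \<bullet> n = 1 \<Longrightarrow> mirror n (mirror n u) = u"
  unfolding mirror_def by (simp add: inner_diff_left algebra_simps)

lemma mirror_nth: "n $ i = 0 \<Longrightarrow> mirror n u $ i = (u :: real^'m::finite) $ i"
  unfolding mirror_def by simp

lemma mirror_Cap:
  fixes n :: "real^('n::finite option)"
  assumes "n \<bullet> n = 1" "n $ None = 0" "N \<in> Cap c"
  shows "mirror n N \<in> Cap c"
  using assms mirror_inner[OF assms(1), of N N] by (simp add: Cap_def mirror_nth norm_eq_sqrt_inner)

text \<open>For orthonormal N and u, the unit-speed great circle leaving N in direction u;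
  \<open>geo'\<close> is its velocity.\<close>

definition geo :: "'a::real_normed_vector \<Rightarrow> 'a \<Rightarrow> real \<Rightarrow> 'a" where
  "geo N u s = cos s *\<^sub>R N + sin s *\<^sub>R u"

definition geo' :: "'a::real_normed_vector \<Rightarrow> 'a \<Rightarrow> real \<Rightarrow> 'a" where
  "geo' N u s = cos s *\<^sub>R u - sin s *\<^sub>R N"

lemma geo_0: "geo N u 0 = N" "geo' N u 0 = u"
  by (simp_all add: geo_def geo'_def)

lemma geo_has_derivative: "((\<lambda>s. geo N u s) has_derivative (\<lambda>h. h *\<^sub>R geo' N u s)) (at s)"
  unfolding geo_def geo'_def
  by (auto intro!: derivative_eq_intros simp: algebra_simps)

lemma geo'_has_derivative: "((\<lambda>s. geo' N u s) has_derivative (\<lambda>h. h *\<^sub>R (- geo N u s))) (at s)"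
  unfolding geo_def geo'_def
  by (auto intro!: derivative_eq_intros simp: algebra_simps)

lemma geo_linear: "linear f \<Longrightarrow> f (geo N u s) = geo (f N) (f u) s"
  unfolding geo_def by (simp add: linear_add linear_scale)

lemma geo_norm:
  fixes N :: "'a::real_inner"
  assumes "N \<bullet> N = 1" "u \<bullet> u = 1" "u \<bullet> N = 0"
  shows "norm (geo N u s) = 1"
proof -
  have "geo N u s \<bullet> geo N u s = (cos s)\<^sup>2 + (sin s)\<^sup>2"
    using assms unfolding geo_def
    by (simp add: inner_add_left inner_add_right inner_commute[of N u] power2_eq_square)
  then show ?thesis by (simp add: norm_eq_sqrt_inner)
qed

lemma geo_cont: "isCont (geo N u) s"
  using geo_has_derivative has_derivative_continuous by blast

lemma Cap_inner: "N \<in> Cap c \<Longrightarrow> N \<bullet> N = 1"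
  by (simp add: Cap_def dot_square_norm)

text \<open>Along a geodesic the barrier \<open>x g (L / x)\<close> is computed from the scalar functions
  \<open>x = cos s x\<^sub>0 + sin s y\<close> and \<open>L = cos s a + sin s b - 1\<close>.\<close>
lemma barrier_derivs:
  fixes g g1 :: "real \<Rightarrow> real" and x y a b g2 :: real
  defines "X \<equiv> \<lambda>s. cos s * x + sin s * y" and "X' \<equiv> \<lambda>s. cos s * y - sin s * x"
    and "L \<equiv> \<lambda>s. cos s * a + sin s * b - 1" and "L' \<equiv> \<lambda>s. cos s * b - sin s * a"
  defines "\<phi> \<equiv> \<lambda>s. X s * g (L s / X s)"
    and "\<phi>' \<equiv> \<lambda>s. X' s * g (L s / X s) + g1 (L s / X s) * ((L' s * X s - L s * X' s) / X s)"
  assumes g: "\<And>z. z < 0 \<Longrightarrow> (g has_real_derivative g1 z) (at z)"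
    and g1: "(g1 has_real_derivative g2) (at ((a - 1) / x))"
    and x: "x > 0" and a: "a < 1"
  shows "\<And>s. X s > 0 \<Longrightarrow> L s < 0 \<Longrightarrow> (\<phi> has_real_derivative \<phi>' s) (at s)"
    and "(\<phi>' has_real_derivative (- (x * g ((a - 1) / x)) - g1 ((a - 1) / x) + g2 * (b * x - (a - 1) * y)\<^sup>2 / x ^ 3)) (at 0)"
proof -
  have X: "(X has_real_derivative X' s) (at s)" for s
    unfolding X_def X'_def by (auto intro!: derivative_eq_intros)
  have X': "(X' has_real_derivative - X s) (at s)" for s
    unfolding X_def X'_def by (auto intro!: derivative_eq_intros)
  have L: "(L has_real_derivative L' s) (at s)" for s
    unfolding L_def L'_def by (auto intro!: derivative_eq_intros)
  have L': "(L' has_real_derivative - (L s + 1)) (at s)" for s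
    unfolding L_def L'_def by (auto intro!: derivative_eq_intros)
  have Z: "((\<lambda>s. L s / X s) has_real_derivative (L' s * X s - L s * X' s) / (X s * X s)) (at s)" if "X s > 0" for s
    using that by (auto intro!: derivative_eq_intros L X)
  show d1: "(\<phi> has_real_derivative \<phi>' s) (at s)" if s: "X s > 0" "L s < 0" for s
  proof -
    have "L s / X s < 0" using s by (simp add: divide_neg_pos)
    note dg = DERIV_chain2[OF g[OF this] Z[OF s(1)]]
    show ?thesis unfolding \<phi>_def \<phi>'_def
      by (rule derivative_eq_intros dg X refl)+ (use s in \<open>simp add: field_simps\<close>)
  qed
  have X0: "X 0 = x" "X' 0 = y" "L 0 = a - 1" "L' 0 = b" by (simp_all add: X_def X'_def L_def L'_def)
  let ?z = "(a - 1) / x" and ?K = "(b * x - (a - 1) * y) / x"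
  have z: "?z < 0" using x a by (simp add: divide_neg_pos)
  have Z0: "((\<lambda>s. L s / X s) has_real_derivative ?K / x) (at 0)"
    using Z[of 0] x unfolding X0 by simp
  have z0: "L 0 / X 0 = ?z" unfolding X0 ..
  have dg: "((\<lambda>s. g (L s / X s)) has_real_derivative g1 ?z * (?K / x)) (at 0)"
    by (rule DERIV_chain2[OF _ Z0]) (simp add: z0 g[OF z])
  have dg1: "((\<lambda>s. g1 (L s / X s)) has_real_derivative g2 * (?K / x)) (at 0)"
    by (rule DERIV_chain2[OF _ Z0]) (simp add: z0 g1)
  \<comment> \<open>Since X'' = -X and L'' = -(L + 1), the Wronskian L' X - L X' has derivative -X.
    The resulting -1 is the origin of the term -g' \<sigma> in the tensor of the barrier.\<close>
  have dK: "((\<lambda>s. (L' s * X s - L s * X' s) / X s) has_real_derivative (- 1 - ?K * y / x)) (at 0)"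
  proof -
    have "X 0 \<noteq> 0" using x X0 by simp
    have "((\<lambda>s. (L' s * X s - L s * X' s) / X s) has_real_derivative
       ((- (L 0 + 1) * X 0 + X' 0 * L' 0 - (L' 0 * X' 0 + (- X 0) * L 0)) * X 0 - (L' 0 * X 0 - L 0 * X' 0) * X' 0) / (X 0 * X 0)) (at 0)"
      by (intro DERIV_divide DERIV_diff DERIV_mult L X L' X' \<open>X 0 \<noteq> 0\<close>)
    moreover have "((- (L 0 + 1) * X 0 + X' 0 * L' 0 - (L' 0 * X' 0 + (- X 0) * L 0)) * X 0 - (L' 0 * X 0 - L 0 * X' 0) * X' 0) / (X 0 * X 0)
       = - 1 - ?K * y / x"
      unfolding X0 using x by (simp add: field_simps)
    ultimately show ?thesis by simp
  qed
  have "(\<phi>' has_real_derivative ((- X 0) * g (L 0 / X 0) + g1 ?z * (?K / x) * X' 0 +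
      (g2 * (?K / x) * ((L' 0 * X 0 - L 0 * X' 0) / X 0) + (- 1 - ?K * y / x) * g1 (L 0 / X 0)))) (at 0)"
    unfolding \<phi>'_def by (intro DERIV_add DERIV_mult X' dg dg1 dK)
  moreover have "((- X 0) * g (L 0 / X 0) + g1 ?z * (?K / x) * X' 0 +
      (g2 * (?K / x) * ((L' 0 * X 0 - L 0 * X' 0) / X 0) + (- 1 - ?K * y / x) * g1 (L 0 / X 0)))
    = - (x * g ?z) - g1 ?z + g2 * (b * x - (a - 1) * y)\<^sup>2 / x ^ 3"
    unfolding z0 unfolding X0 using x by (simp add: field_simps power2_eq_square power3_eq_cube)
  ultimately show "(\<phi>' has_real_derivative (- (x * g ?z) - g1 ?z + g2 * (b * x - (a - 1) * y)\<^sup>2 / x ^ 3)) (at 0)"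
    by simp
qed

section \<open>Derivatives along great circles and the boundary conormal\<close>

context sphere_C2 begin

lemma F_geo_deriv:
  assumes "geo N u s \<in> U"
  shows "((\<lambda>s. F (geo N u s)) has_real_derivative D (geo N u s) \<bullet> geo' N u s) (at s)"
  using has_derivative_compose[OF geo_has_derivative F_deriv[OF assms]]
  by (simp add: has_field_derivative_def mult_commute_abs)

lemma D_geo_deriv:
  assumes "geo N u s \<in> U"
  shows "((\<lambda>s. D (geo N u s) \<bullet> geo' N u s) has_real_derivative
    D' (geo N u s) (geo' N u s) \<bullet> geo' N u s - D (geo N u s) \<bullet> geo N u s) (at s)"
proof -
  note l = D'_linear[OF assms]
  have "((\<lambda>s. D (geo N u s)) has_derivative (\<lambda>h. D' (geo N u s) (h *\<^sub>R geo' N u s))) (at s)"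
    by (rule has_derivative_compose[OF geo_has_derivative D_deriv[OF assms]])
  from has_derivative_inner[OF this geo'_has_derivative]
  show ?thesis unfolding has_field_derivative_def
    by (rule has_derivative_eq_rhs) (auto simp: linear_scale[OF l] algebra_simps inner_commute)
qed

text \<open>The acceleration of a great circle is minus its position, so the second derivative of F
  along it is the intrinsic Hessian, that is, W minus F.\<close>

lemma D_geo_deriv_0:
  assumes "N \<in> U" "u \<bullet> u = 1"
  shows "((\<lambda>s. D (geo N u s) \<bullet> geo' N u s) has_real_derivative (W N u u - F N)) (at 0)"
  using D_geo_deriv[of N u 0] assms by (simp add: geo_0 W_def inner_commute)

lemma geo_near_Cap:
  assumes p: "p \<in> Cap c" "p $ None > c" and u: "u \<bullet> u = 1" "u \<bullet> p = 0"
  shows "\<exists>r>0. \<forall>s. \<bar>s\<bar> < r \<longrightarrow> geo p u s \<in> Cap c"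
proof -
  have pp: "p \<bullet> p = 1" using Cap_inner[OF p(1)] .
  have "isCont (\<lambda>s. geo p u s $ None) 0" unfolding geo_def by (intro continuous_intros)
  then have "((\<lambda>s. geo p u s $ None) \<longlongrightarrow> p $ None) (at 0)" by (simp add: isCont_def geo_0)
  then have "\<forall>\<^sub>F s in at 0. geo p u s $ None > c" using p(2) order_tendstoD(1) by blast
  then obtain r where "r > 0" "\<And>s. s \<noteq> 0 \<Longrightarrow> \<bar>s\<bar> < r \<Longrightarrow> geo p u s $ None > c"
    unfolding eventually_at by (auto simp: dist_norm)
  moreover have "geo p u s \<in> Cap c" if "geo p u s $ None > c" for s
    using that geo_norm[OF pp u, of s] by (simp add: Cap_def)
  moreover have "geo p u 0 \<in> Cap c" using p(1) by (simp add: geo_0)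
  ultimately show ?thesis by metis
qed

text \<open>Removing from the vertical vector its component along p leaves a tangent vector of
  length S, the sine of the contact angle. The great circle along m starts with vertical speed S > 0
  and so enters the region strictly above the boundary plane.\<close>

lemma inward_conormal:
  fixes p :: "real^'n option"
  assumes p: "p \<in> Cap c" "p $ None = c"
  defines "S \<equiv> sqrt (1 - c\<^sup>2)"
  defines "m \<equiv> (1 / S) *\<^sub>R (axis None 1 - c *\<^sub>R p)"
  shows "S > 0" "m \<bullet> m = 1" "m \<bullet> p = 0"
    and "\<exists>r>0. \<forall>s. 0 < s \<longrightarrow> s < r \<longrightarrow> geo p m s \<in> Cap c \<and> geo p m s $ None > c"
proof -
  have pp: "p \<bullet> p = 1" using Cap_inner[OF p(1)] .
  have c2: "c\<^sup>2 < 1" using c by (simp add: abs_square_less_1)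
  then have S: "S > 0" "S\<^sup>2 = 1 - c\<^sup>2" by (simp_all add: S_def)
  have axn: "axis None 1 \<bullet> v = v $ None" for v :: "real^('n option)" by (simp add: inner_axis')
  have "(axis None 1 - c *\<^sub>R p) \<bullet> (axis None 1 - c *\<^sub>R p) = S\<^sup>2"
    unfolding inner_diff_left inner_diff_right inner_scaleR_left inner_scaleR_right S(2) pp
    by (simp add: axn p(2) inner_commute[of p "axis None 1"] power2_eq_square)
  then have m1: "m \<bullet> m = 1" using S(1) unfolding m_def inner_scaleR_left inner_scaleR_right
    by (simp add: power2_eq_square)
  have m2: "m \<bullet> p = 0" unfolding m_def using pp p(2) by (simp add: inner_diff_left axn)
  have "(1 - c * c) / S = S" using S unfolding power2_eq_square[symmetric] S(2)[symmetric]
    by (simp add: power2_eq_square)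
  then have m3: "m $ None = S" unfolding m_def using p(2) by simp
  have "((\<lambda>s. cos s * c + sin s * S) has_real_derivative S) (at 0)"
    by (auto intro!: derivative_eq_intros)
  from DERIV_pos_inc_right[OF this S(1)] obtain r where r: "r > 0" "\<And>h. 0 < h \<Longrightarrow> h < r \<Longrightarrow> c < cos h * c + sin h * S" by auto
  have "geo p m s \<in> Cap c \<and> geo p m s $ None > c" if "0 < s" "s < r" for s
  proof -
    have "norm (geo p m s) = 1" by (rule geo_norm[OF pp m1 m2])
    moreover have "geo p m s $ None = cos s * c + sin s * S" by (simp add: geo_def p(2) m3)
    ultimately show ?thesis using r(2)[OF that] by (simp add: Cap_def)
  qed
  then show "\<exists>r>0. \<forall>s. 0 < s \<longrightarrow> s < r \<longrightarrow> geo p m s \<in> Cap c \<and> geo p m s $ None > c"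
    using r(1) by blast
  show "S > 0" "m \<bullet> m = 1" "m \<bullet> p = 0" by (fact S(1) m1 m2)+
qed

end

text \<open>In \<open>robin\<close> the Robin condition is multiplied by sin \<theta>: with c = cos
  \<theta>, the vector \<open>c *\<^sub>R N - axis None 1\<close> is sin \<theta> times the outward
  conormal.\<close>

locale capillary_eq = curvature_eq F D D' U c k l c0
  for F :: "real^('n::finite option) \<Rightarrow> real" and D D' U c k l c0 +
  assumes robin: "\<And>N. N \<in> Cap c \<Longrightarrow> N $ None = c \<Longrightarrow> D N \<bullet> (c *\<^sub>R N - axis None 1) = c * F N"
begin

text \<open>At a boundary point the Robin condition excludes contact with a barrier of this kind; at an
  interior point the second derivatives along geodesics and ellipticity bound its concavity.\<close>
lemma touch:
  fixes n P p :: "real^('n option)" and g g1 :: "real \<Rightarrow> real" and g2 :: real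
  assumes n: "n \<bullet> n = 1" "n $ None = 0" and p: "p \<in> Cap c" "p \<bullet> n > 0"
    and P: "P $ None > c" "p \<bullet> P < 1"
    and g: "\<And>z. z < 0 \<Longrightarrow> (g has_real_derivative g1 z) (at z)"
    and g1: "(g1 has_real_derivative g2) (at ((p \<bullet> P - 1) / (p \<bullet> n)))"
    and sgn: "g1 ((p \<bullet> P - 1) / (p \<bullet> n)) < 0" "g2 \<le> 0"
    and e: "0 < e"
    and le: "\<And>q. q \<in> Cap c \<Longrightarrow> dist q p < e \<Longrightarrow> F (mirror n q) - F q \<le> (q \<bullet> n) * g ((q \<bullet> P - 1) / (q \<bullet> n))"
    and eq: "F (mirror n p) - F p = (p \<bullet> n) * g ((p \<bullet> P - 1) / (p \<bullet> n))"
  defines "w \<equiv> (p \<bullet> n) *\<^sub>R P - (p \<bullet> P - 1) *\<^sub>R n"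
  shows "- g2 / (p \<bullet> n) ^ 3 * (w \<bullet> w - (w \<bullet> p)\<^sup>2) \<le> Cell * (- g1 ((p \<bullet> P - 1) / (p \<bullet> n)))"
proof -
  let ?x = "p \<bullet> n" and ?a = "p \<bullet> P" and ?p = "mirror n p"
  let ?z = "(?a - 1) / ?x"
  have pp: "p \<bullet> p = 1" using Cap_inner[OF p(1)] .
  have rp: "?p \<in> Cap c" using mirror_Cap[OF n p(1)] .
  have U: "p \<in> U" "?p \<in> U" using p(1) rp CapU by auto
  define X where "X u s = cos s * ?x + sin s * (u \<bullet> n)" for u s
  define L where "L u s = cos s * ?a + sin s * (u \<bullet> P) - 1" for u s
  define ph where "ph u s = X u s * g (L u s / X u s)" for u s
  define ph' where "ph' u s = (cos s * (u \<bullet> n) - sin s * ?x) * g (L u s / X u s) +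
    g1 (L u s / X u s) * (((cos s * (u \<bullet> P) - sin s * ?a) * X u s - L u s * (cos s * (u \<bullet> n) - sin s * ?x)) / X u s)" for u s
  have XL: "geo p u s \<bullet> n = X u s" "geo p u s \<bullet> P - 1 = L u s" for u s
    by (simp_all add: geo_def X_def L_def inner_add_left)
  have rgeo: "mirror n (geo p u s) = geo ?p (mirror n u) s" for u s
    by (rule geo_linear[OF mirror_linear])
  \<comment> \<open>The contact function along a great circle and its mirror image: zero at s = 0,
    and nonpositive nearby as long as the great circle stays in the cap.\<close>
  define f where "f u s = F (geo ?p (mirror n u) s) - F (geo p u s) - ph u s" for u s
  define f' where "f' u s = D (geo ?p (mirror n u) s) \<bullet> geo' ?p (mirror n u) s - D (geo p u s) \<bullet> geo' p u s - ph' u s" for u s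
  have f0: "f u 0 = 0" for u
    using eq by (simp add: f_def geo_0 ph_def X_def L_def)
  have fle: "f u s \<le> 0" if "geo p u s \<in> Cap c" "dist (geo p u s) p < e" for u s
    using le[OF that] unfolding rgeo XL by (simp add: f_def ph_def)
  have pd1: "(ph u has_real_derivative ph' u s) (at s)" if "X u s > 0" "L u s < 0" for u s
    using barrier_derivs(1)[OF g g1 p(2) P(2), where s = s and y = "u \<bullet> n" and b = "u \<bullet> P"] that
    unfolding ph_def[abs_def] ph'_def X_def L_def by blast
  have pd2: "(ph' u has_real_derivative (- (?x * g ?z) - g1 ?z + g2 * ((u \<bullet> P) * ?x - (?a - 1) * (u \<bullet> n))\<^sup>2 / ?x ^ 3)) (at 0)" for u
    using barrier_derivs(2)[OF g g1 p(2) P(2), where y = "u \<bullet> n" and b = "u \<bullet> P"]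
    unfolding ph'_def[abs_def] X_def L_def by blast
  have near: "\<exists>r>0. \<forall>s. \<bar>s\<bar> < r \<longrightarrow> geo p u s \<in> U \<and> geo ?p (mirror n u) s \<in> U \<and> X u s > 0 \<and> L u s < 0 \<and> dist (geo p u s) p < e" for u
  proof -
    have c1: "((\<lambda>s. geo p u s) \<longlongrightarrow> p) (at 0)" using geo_cont[where N = p and u = u and s = 0] by (simp add: isCont_def geo_0)
    have c2: "((\<lambda>s. geo ?p (mirror n u) s) \<longlongrightarrow> ?p) (at 0)" using geo_cont[where N = ?p and u = "mirror n u" and s = 0] by (simp add: isCont_def geo_0)
    have "\<forall>\<^sub>F s in at 0. geo p u s \<in> U" by (rule topological_tendstoD[OF c1 open_U U(1)])
    moreover have "\<forall>\<^sub>F s in at 0. geo ?p (mirror n u) s \<in> U" by (rule topological_tendstoD[OF c2 open_U U(2)])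
    moreover have "\<forall>\<^sub>F s in at 0. X u s > 0"
    proof -
      have "isCont (X u) 0" unfolding X_def[abs_def] by (intro continuous_intros)
      then have "(X u \<longlongrightarrow> ?x) (at 0)" by (simp add: isCont_def X_def)
      then show ?thesis using p(2) order_tendstoD(1) by blast
    qed
    moreover have "\<forall>\<^sub>F s in at 0. L u s < 0"
    proof -
      have "isCont (L u) 0" unfolding L_def[abs_def] by (intro continuous_intros)
      then have "(L u \<longlongrightarrow> ?a - 1) (at 0)" by (simp add: isCont_def L_def)
      then show ?thesis using P(2) order_tendstoD(2)[of "L u" "?a - 1" "at 0" 0] by simp
    qed
    moreover have "\<forall>\<^sub>F s in at 0. dist (geo p u s) p < e" using c1 e by (rule tendstoD)
    ultimately have "\<forall>\<^sub>F s in at 0. geo p u s \<in> U \<and> geo ?p (mirror n u) s \<in> U \<and> X u s > 0 \<and> L u s < 0 \<and> dist (geo p u s) p < e"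
      by eventually_elim blast
    then obtain r where r: "r > 0" "\<And>s. s \<noteq> 0 \<Longrightarrow> \<bar>s\<bar> < r \<Longrightarrow> geo p u s \<in> U \<and> geo ?p (mirror n u) s \<in> U \<and> X u s > 0 \<and> L u s < 0 \<and> dist (geo p u s) p < e"
      unfolding eventually_at by (auto simp: dist_norm)
    moreover have "geo p u 0 \<in> U \<and> geo ?p (mirror n u) 0 \<in> U \<and> X u 0 > 0 \<and> L u 0 < 0 \<and> dist (geo p u 0) p < e"
      using U p P e by (simp add: geo_0 X_def L_def)
    ultimately show ?thesis by metis
  qed
  have fd: "(f u has_real_derivative f' u s) (at s)"
    if "geo p u s \<in> U" "geo ?p (mirror n u) s \<in> U" "X u s > 0" "L u s < 0" for u s
    unfolding f_def[abs_def] f'_def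
    by (intro DERIV_diff F_geo_deriv pd1 that)
  have interior: "p $ None > c"
  proof (rule ccontr)
    assume "\<not> p $ None > c"
    then have pc: "p $ None = c" using p(1) by (simp add: Cap_def)
    define S where "S = sqrt (1 - c\<^sup>2)"
    define m where "m = (1 / S) *\<^sub>R (axis None 1 - c *\<^sub>R p)"
    note ic = inward_conormal[OF p(1) pc, folded S_def, folded m_def]
    note S = ic(1)
    have rpc: "?p $ None = c" using pc n(2) by (simp add: mirror_nth)
    have axn: "axis None 1 \<bullet> v = v $ None" for v :: "real^('n option)" by (simp add: inner_axis')
    have rm: "mirror n m = (1 / S) *\<^sub>R (axis None 1 - c *\<^sub>R ?p)"
    proof -
      have "mirror n (axis None 1) = axis None 1" using n(2) by (simp add: mirror_def axn)
      then show ?thesis unfolding m_def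
        by (simp add: linear_scale[OF mirror_linear] linear_diff[OF mirror_linear])
    qed
    have rob: "D ?p \<bullet> mirror n m - D p \<bullet> m = - (c / S) * (F ?p - F p)"
    proof -
      have "D N \<bullet> ((1 / S) *\<^sub>R (axis None 1 - c *\<^sub>R N)) = - (c / S) * F N" if "N \<in> Cap c" "N $ None = c" for N
        using robin[OF that] S by (simp add: inner_diff_right field_simps)
      then have "D p \<bullet> m = - (c / S) * F p" "D ?p \<bullet> mirror n m = - (c / S) * F ?p"
        unfolding rm using p(1) rp pc rpc by (simp_all only: m_def)
      then show ?thesis by (simp add: right_diff_distrib)
    qed
    obtain r where r: "r > 0" "\<And>s. \<bar>s\<bar> < r \<Longrightarrow> geo p m s \<in> U \<and> geo ?p (mirror n m) s \<in> U \<and> X m s > 0 \<and> L m s < 0 \<and> dist (geo p m s) p < e"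
      using near[of m] by blast
    obtain r1 where r1: "r1 > 0" and inC: "\<And>s. 0 < s \<Longrightarrow> s < r1 \<Longrightarrow> geo p m s \<in> Cap c"
      using ic(4) by blast
    have mn: "m \<bullet> n = - (c / S) * ?x" unfolding m_def using n(2) by (simp add: inner_diff_left axn)
    have mP: "m \<bullet> P = (P $ None - c * ?a) / S" unfolding m_def by (simp add: inner_diff_left axn)
    \<comment> \<open>This is x times the derivative of \<zeta> along m. It is positive exactly
      because P lies above the boundary plane.\<close>
    have K: "((m \<bullet> P) * ?x - (?a - 1) * (m \<bullet> n)) / ?x = (P $ None - c) / S"
      unfolding mn mP using p(2) S by (simp add: field_simps)
    \<comment> \<open>By \<open>mn\<close> the function x satisfies the same Robin relation as the
      difference of the two values of F, so the zeroth-order terms cancel and only the derivative of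
      \<zeta> remains. Its sign makes f increase into the cap from a contact point.\<close>
    have "f' m 0 = - g1 ?z * ((P $ None - c) / S)"
      unfolding f'_def ph'_def geo_0 rob X_def L_def
      using K eq mn by (simp add: algebra_simps)
    then have "f' m 0 > 0" using sgn(1) P(1) S by (simp add: mult_neg_pos divide_neg_pos)
    moreover have "(f m has_real_derivative f' m 0) (at 0)" using fd[of m 0] r(2)[of 0] r(1) by simp
    ultimately obtain r2 where r2: "r2 > 0" "\<And>h. 0 < h \<Longrightarrow> h < r2 \<Longrightarrow> f m 0 < f m (0 + h)"
      using DERIV_pos_inc_right by blast
    define h where "h = min r (min r1 r2) / 2"
    have h: "0 < h" "h < r" "h < r1" "h < r2" using r(1) r1 r2(1) by (auto simp: h_def)
    then have "f m h > 0" using r2(2)[of h] f0 by simp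
    moreover have "f m h \<le> 0" using fle inC[of h] r(2)[of h] h by simp
    ultimately show False by simp
  qed
  \<comment> \<open>The vector w is x^2 times the gradient of \<zeta>, so
    \<open>(u \<bullet> w)\<^sup>2\<close> divided by x^3 is x times the square of d\<zeta>(u): the
    concavity term of the barrier.\<close>
  have unit: "W ?p (mirror n u) (mirror n u) + (- g2 / ?x ^ 3) * (u \<bullet> w)\<^sup>2 \<le> W p u u + (- g1 ?z) * (u \<bullet> u)"
    if u: "u \<bullet> p = 0" "u \<bullet> u = 1" for u
  proof -
    obtain r where r: "r > 0" "\<And>s. \<bar>s\<bar> < r \<Longrightarrow> geo p u s \<in> U \<and> geo ?p (mirror n u) s \<in> U \<and> X u s > 0 \<and> L u s < 0 \<and> dist (geo p u s) p < e"
      using near[of u] by blast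
    obtain r' where r': "r' > 0" "\<And>s. \<bar>s\<bar> < r' \<Longrightarrow> geo p u s \<in> Cap c"
      using geo_near_Cap[OF p(1) interior u(2,1)] by blast
    have ru: "mirror n u \<bullet> mirror n u = 1" using mirror_inner[OF n(1)] u(2) by simp
    have "(W ?p (mirror n u) (mirror n u) - F ?p) - (W p u u - F p)
       - (- (?x * g ?z) - g1 ?z + g2 * ((u \<bullet> P) * ?x - (?a - 1) * (u \<bullet> n))\<^sup>2 / ?x ^ 3) \<le> 0"
    proof (rule second_derivative_at_max)
      show "0 < min r r'" using r(1) r'(1) by simp
      show "f u s \<le> f u 0" if "\<bar>s\<bar> < min r r'" for s
        unfolding f0 using fle r(2)[of s] r'(2)[of s] that by simp
      show "(f u has_real_derivative f' u s) (at s)" if "\<bar>s\<bar> < min r r'" for s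
        using fd r(2)[of s] that by simp
      show "(f' u has_real_derivative (W ?p (mirror n u) (mirror n u) - F ?p) - (W p u u - F p)
       - (- (?x * g ?z) - g1 ?z + g2 * ((u \<bullet> P) * ?x - (?a - 1) * (u \<bullet> n))\<^sup>2 / ?x ^ 3)) (at 0)"
        unfolding f'_def[abs_def]
        by (intro DERIV_diff D_geo_deriv_0 U ru u(2) pd2)
    qed
    moreover have "(u \<bullet> P) * ?x - (?a - 1) * (u \<bullet> n) = u \<bullet> w"
      unfolding w_def by (simp add: inner_diff_right algebra_simps)
    ultimately show ?thesis using eq u(2) by (simp add: algebra_simps)
  qed
  have "W ?p (mirror n u) (mirror n u) + (- g2 / ?x ^ 3) * (u \<bullet> w)\<^sup>2 \<le> W p u u + (- g1 ?z) * (u \<bullet> u)"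
    if u: "u \<bullet> p = 0" for u
  proof (cases "u = 0")
    case True
    have "bilinear (W p)" "bilinear (W ?p)" using bil_sym_W U by (auto simp: bil_sym_def)
    then show ?thesis using True by (simp add: bilinear_lzero linear_0[OF mirror_linear])
  next
    case False
    define v where "v = u /\<^sub>R norm u"
    have uv: "u = norm u *\<^sub>R v" using False by (simp add: v_def)
    have v: "v \<bullet> p = 0" "v \<bullet> v = 1" unfolding v_def using u False by (simp_all add: dot_square_norm power2_eq_square)
    have b: "bilinear (W p)" "bilinear (W ?p)" using bil_sym_W U by (auto simp: bil_sym_def)
    have "(norm u)\<^sup>2 * (W ?p (mirror n v) (mirror n v) + (- g2 / ?x ^ 3) * (v \<bullet> w)\<^sup>2)
       \<le> (norm u)\<^sup>2 * (W p v v + (- g1 ?z) * (v \<bullet> v))"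
      by (rule mult_left_mono[OF unit[OF v]]) simp
    moreover have "W p u u = (norm u)\<^sup>2 * W p v v"
      by (subst (1 2) uv) (simp add: bilinear_lmul[OF b(1)] bilinear_rmul[OF b(1)] power2_eq_square)
    moreover have "W ?p (mirror n u) (mirror n u) = (norm u)\<^sup>2 * W ?p (mirror n v) (mirror n v)"
      by (subst (1 2) uv) (simp add: linear_scale[OF mirror_linear] bilinear_lmul[OF b(2)] bilinear_rmul[OF b(2)] power2_eq_square)
    moreover have "(u \<bullet> w)\<^sup>2 = (norm u)\<^sup>2 * (v \<bullet> w)\<^sup>2" by (subst uv) (simp add: power_mult_distrib)
    moreover have "u \<bullet> u = (norm u)\<^sup>2 * (v \<bullet> v)" using v(2) by (simp add: dot_square_norm)
    ultimately show ?thesis by (simp only: distrib_left mult.left_commute)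
  qed
  moreover have "0 \<le> - g2 / ?x ^ 3" using sgn(2) p(2) by (simp add: divide_nonpos_pos)
  moreover have "0 \<le> - g1 ?z" using sgn(1) by simp
  ultimately show ?thesis
    by (intro elliptic_comparison[OF p(1) rp mirror_orthogonal[OF n(1)] refl]) auto
qed

end
section \<open>The maximum principle for the reflection quotient\<close>

context sphere_C2 begin

text \<open>The cap is not convex, so the gradient bound yields only local Lipschitz constants,
  which compactness makes global. The one-point set containing 0 is a dummy time interval demanded
  by the notion of local Lipschitz continuity used here.\<close>

lemma F_lipschitz: "\<exists>K\<ge>0. \<forall>x\<in>Cap c. \<forall>y\<in>Cap c. \<bar>F x - F y\<bar> \<le> K * dist x y"
proof -
  have "local_lipschitz {0::real} (Cap c) (\<lambda>_. F)"
  proof (rule local_lipschitzI)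
    fix t and x :: "real^'n option" assume "t \<in> {0::real}" and x: "x \<in> Cap c"
    then have xU: "x \<in> U" using CapU by blast
    obtain d1 where d1: "d1 > 0" "cball x d1 \<subseteq> U" using open_U xU open_contains_cball by blast
    have "isCont D x" using D_cont open_U xU by (simp add: continuous_on_eq_continuous_at)
    then obtain d2 where d2: "d2 > 0" "\<And>y. dist y x < d2 \<Longrightarrow> dist (D y) (D x) < 1"
      unfolding continuous_at_eps_delta using zero_less_one by blast
    define d where "d = min d1 (d2 / 2)"
    have d: "d > 0" "cball x d \<subseteq> U" using d1 d2(1) by (auto simp: d_def)
    let ?B = "norm (D x) + 1"
    have B: "norm (D y) \<le> ?B" if "y \<in> cball x d" for y
    proof -
      have "dist y x < d2" using that d2(1) by (auto simp: d_def dist_commute)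
      then have "dist (D y) (D x) < 1" by (rule d2(2))
      then show ?thesis using norm_triangle_sub[of "D y" "D x"] by (simp add: dist_norm)
    qed
    have "?B-lipschitz_on (cball x d) F"
    proof (rule lipschitz_onI)
      fix y z assume y: "y \<in> cball x d" and z: "z \<in> cball x d"
      show "dist (F y) (F z) \<le> ?B * dist y z"
        unfolding dist_norm
      proof (rule differentiable_bound[OF convex_cball _ _ y z])
        fix u assume u: "u \<in> cball x d"
        then show "(F has_derivative (\<lambda>v. D u \<bullet> v)) (at u within cball x d)"
          using F_deriv d(2) by (blast intro: has_derivative_at_withinI)
        show "onorm (\<lambda>v. D u \<bullet> v) \<le> ?B"
        proof (rule onorm_le)
          fix v
          have "norm (D u \<bullet> v) \<le> norm (D u) * norm v" using Cauchy_Schwarz_ineq2 by simp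
          also have "\<dots> \<le> ?B * norm v" by (rule mult_right_mono[OF B[OF u]]) simp
          finally show "norm (D u \<bullet> v) \<le> ?B * norm v" .
        qed
      qed
    qed simp
    then have "?B-lipschitz_on (cball x d \<inter> Cap c) F" by (rule lipschitz_on_subset) simp
    then show "\<exists>u>0. \<exists>L. \<forall>t\<in>cball t u \<inter> {0}. L-lipschitz_on (cball x u \<inter> Cap c) F"
      using d(1) by blast
  qed
  then obtain K where K: "\<And>t. t \<in> {0::real} \<Longrightarrow> K-lipschitz_on (Cap c) F"
    by (rule local_lipschitz_compact_implies_lipschitz) (auto simp: compact_Cap)
  have "K-lipschitz_on (Cap c) F" by (rule K) simp
  then show ?thesis by (auto simp: lipschitz_on_def dist_real_def)
qed

text \<open>A point and its mirror image are at distance 2 (N . n), so the Lipschitz bound cancels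
  the denominator.\<close>

lemma mirror_diff_bound:
  assumes n: "n \<bullet> n = 1" "n $ None = 0"
  shows "\<exists>K. \<forall>N\<in>Cap c. N \<bullet> n > 0 \<longrightarrow> (F (mirror n N) - F N) / (N \<bullet> n) \<le> K"
proof -
  obtain K where K: "K \<ge> 0" "\<And>x y. x \<in> Cap c \<Longrightarrow> y \<in> Cap c \<Longrightarrow> \<bar>F x - F y\<bar> \<le> K * dist x y"
    using F_lipschitz by blast
  have "(F (mirror n N) - F N) / (N \<bullet> n) \<le> 2 * K" if N: "N \<in> Cap c" "N \<bullet> n > 0" for N
  proof -
    have "norm n = 1" using n(1) by (simp add: norm_eq_sqrt_inner)
    then have "dist (mirror n N) N = 2 * (N \<bullet> n)" using N(2) by (simp add: mirror_def dist_norm)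
    then have "F (mirror n N) - F N \<le> K * (2 * (N \<bullet> n))"
      using K(2)[OF mirror_Cap[OF n N(1)] N(1)] by simp
    then show ?thesis using N(2) by (simp add: field_simps)
  qed
  then show ?thesis by blast
qed

lemma mirror_diff_cont:
  assumes n: "n \<bullet> n = 1" "n $ None = 0" and A: "A \<subseteq> Cap c"
  shows "continuous_on A (\<lambda>N. F (mirror n N) - F N)"
proof -
  have "continuous_on A (\<lambda>N. mirror n N)" unfolding mirror_def by (intro continuous_intros)
  moreover have "(\<lambda>N. mirror n N) ` A \<subseteq> U" using mirror_Cap[OF n] A CapU by blast
  ultimately have "continuous_on A (\<lambda>N. F (mirror n N))" by (rule continuous_on_compose2[OF F_cont])
  moreover have "continuous_on A F" using F_cont A CapU continuous_on_subset by blast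
  ultimately show ?thesis by (intro continuous_intros)
qed

lemma mirror_quotient_cont:
  assumes n: "n \<bullet> n = 1" "n $ None = 0" and A: "A \<subseteq> Cap c" "\<And>N. N \<in> A \<Longrightarrow> N \<bullet> n > 0"
  shows "continuous_on A (\<lambda>N. (F (mirror n N) - F N) / (N \<bullet> n))"
proof (intro continuous_on_divide mirror_diff_cont[OF n A(1)] continuous_intros)
  show "\<forall>N\<in>A. N \<bullet> n \<noteq> 0" using A(2) by force
qed

end

lemma Cap_abs_inner:
  assumes "N \<in> Cap c" "n \<bullet> n = 1"
  shows "\<bar>N \<bullet> n\<bar> \<le> 1"
proof -
  have "norm n = 1" "norm N = 1" using assms by (simp_all add: norm_eq_sqrt_inner Cap_def)
  then show ?thesis using Cauchy_Schwarz_ineq2[of N n] by simp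
qed

lemma inner_pos_near:
  assumes "dist q p < p \<bullet> n" "n \<bullet> n = 1"
  shows "q \<bullet> n > 0"
proof -
  have "\<bar>(q - p) \<bullet> n\<bar> \<le> norm (q - p)"
    using Cauchy_Schwarz_ineq2[of "q - p" n] assms(2) by (simp add: norm_eq_sqrt_inner)
  then show ?thesis using assms(1) by (simp add: dist_norm inner_diff_left)
qed

section \<open>Attainment of the supremum away from the mirror\<close>

context capillary_eq begin

text \<open>N0 maximizes q on the compact part x \<ge> \<delta>. Were q larger elsewhere, the
  penalty \<epsilon> sqrt(Y), unbounded at the mirror, would produce a maximum of q minus the
  penalty at a point with 0 < x < \<delta>, and the contact inequality excludes such points.\<close>

lemma mirror_quotient_attains_sup:
  assumes n: "n \<bullet> n = 1" "n $ None = 0"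
  shows "\<exists>N0\<in>Cap c. N0 \<bullet> n > 0 \<and> (\<forall>N\<in>Cap c. N \<bullet> n > 0 \<longrightarrow>
    (F (mirror n N) - F N) / (N \<bullet> n) \<le> (F (mirror n N0) - F N0) / (N0 \<bullet> n))"
proof -
  define q where "q N = (F (mirror n N) - F N) / (N \<bullet> n)" for N
  \<comment> \<open>Above c, so that P lies above the boundary plane, and below 1, so that 1 - N . P
    stays away from 0 on the whole cap.\<close>
  define lam where "lam = (1 + c) / 2"
  have lam: "0 < lam" "lam < 1" "c < lam" using c by (auto simp: lam_def)
  define P :: "real^('n option)" where "P = lam *\<^sub>R axis None 1"
  have P: "N \<bullet> P = lam * N $ None" for N unfolding P_def by (simp add: inner_axis)
  have PP: "P \<bullet> P = lam\<^sup>2" unfolding P_def by (simp add: power2_eq_square inner_axis')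
  have nP: "n \<bullet> P = 0" "P \<bullet> n = 0" using P[of n] n(2) by (simp_all add: inner_commute[of P n])
  define Y where "Y N = (1 - N \<bullet> P) / (N \<bullet> n)" for N
  have z1: "\<bar>N $ None\<bar> \<le> 1" if "N \<in> Cap c" for N
    using component_le_norm_cart[of N None] that by (simp add: Cap_def)
  have L: "1 - lam \<le> 1 - N \<bullet> P" "1 - N \<bullet> P \<le> 2" if "N \<in> Cap c" for N
  proof -
    have "lam * N $ None \<le> lam * 1" "lam * (- 1) \<le> lam * N $ None"
      using z1[OF that] lam by (intro mult_left_mono; simp add: abs_le_iff)+
    then show "1 - lam \<le> 1 - N \<bullet> P" "1 - N \<bullet> P \<le> 2" unfolding P using lam by auto
  qed
  define S where "S = sqrt (1 - c\<^sup>2)"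
  have c2: "c\<^sup>2 < 1" using c by (simp add: abs_square_less_1)
  then have S: "S > 0" "S\<^sup>2 = 1 - c\<^sup>2" by (simp_all add: S_def)
  \<comment> \<open>At most S, so that the point
    \<open>c *\<^sub>R axis None 1 + S *\<^sub>R n\<close> keeps the region x \<ge> \<delta>
    nonempty. The other bound makes the final inequality (1 - lam)^2 \<le> (4 Cell + 1) x^2
    impossible for x < \<delta>.\<close>
  define \<delta> where "\<delta> = min S ((1 - lam) / (4 * Cell + 1))"
  have C1: "4 * Cell + 1 \<ge> 1" using Cell(1) by simp
  have d: "\<delta> > 0" "\<delta> \<le> S" unfolding \<delta>_def using S lam C1 by auto
  have d2: "(4 * Cell + 1) * \<delta>\<^sup>2 \<le> (1 - lam)\<^sup>2"
  proof -
    have "(4 * Cell + 1) * \<delta> \<le> 1 - lam"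
    proof -
      have "(4 * Cell + 1) * \<delta> \<le> (4 * Cell + 1) * ((1 - lam) / (4 * Cell + 1))"
        using C1 unfolding \<delta>_def by (intro mult_left_mono) auto
      then show ?thesis using C1 by simp
    qed
    then have a: "((4 * Cell + 1) * \<delta>)\<^sup>2 \<le> (1 - lam)\<^sup>2"
      using C1 d(1) by (intro power_mono) auto
    have "(4 * Cell + 1) * \<delta>\<^sup>2 \<le> (4 * Cell + 1) * ((4 * Cell + 1) * \<delta>\<^sup>2)"
      using mult_right_mono[OF C1, of "(4 * Cell + 1) * \<delta>\<^sup>2"] C1 by simp
    then show ?thesis using a by (simp add: power2_eq_square mult_ac)
  qed
  let ?A = "\<lambda>r. Cap c \<inter> {N. r \<le> N \<bullet> n}"
  have cA: "compact (?A r)" for r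
    by (intro compact_Int_closed compact_Cap closed_Collect_le continuous_intros)
  have qc: "continuous_on (?A r) q" if "r > 0" for r
    unfolding q_def using that by (intro mirror_quotient_cont n) auto
  have "c *\<^sub>R axis None 1 + S *\<^sub>R n \<in> ?A \<delta>"
  proof -
    let ?N = "c *\<^sub>R axis None 1 + S *\<^sub>R n"
    have "?N \<bullet> ?N = c\<^sup>2 + S\<^sup>2"
      using n by (simp add: inner_add_left inner_add_right inner_axis inner_axis' power2_eq_square)
    then have "norm ?N = 1" using S(2) by (simp add: norm_eq_sqrt_inner)
    moreover have "?N \<bullet> n = S" using n by (simp add: inner_add_left inner_axis')
    ultimately show ?thesis using d(2) n(2) by (simp add: Cap_def)
  qed
  then have "?A \<delta> \<noteq> {}" by blast
  from continuous_attains_sup[OF cA this qc[OF d(1)]]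
  obtain N0 where N0: "N0 \<in> ?A \<delta>" "\<And>N. N \<in> ?A \<delta> \<Longrightarrow> q N \<le> q N0" by blast
  have "q Na \<le> q N0" if Na: "Na \<in> Cap c" "Na \<bullet> n > 0" for Na
  proof (rule ccontr)
    assume "\<not> q Na \<le> q N0"
    then have qa: "q Na > q N0" by simp
    have Ypos: "Y N > 0" if "N \<in> Cap c" "N \<bullet> n > 0" for N
      using L(1)[OF that(1)] lam that(2) unfolding Y_def by simp
    \<comment> \<open>The penalty takes away half of the excess of q at Na, so the penalized
      function still exceeds q N0 there.\<close>
    define \<epsilon> where "\<epsilon> = (q Na - q N0) / (2 * sqrt (Y Na))"
    have sY: "sqrt (Y Na) > 0" using Ypos[OF Na] by simp
    have e: "\<epsilon> > 0" unfolding \<epsilon>_def using qa sY by simp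
    define r where "r N = q N - \<epsilon> * sqrt (Y N)" for N
    have ra: "r Na > q N0" unfolding r_def \<epsilon>_def using qa sY by (simp add: field_simps)
    obtain K where K: "\<And>N. N \<in> Cap c \<Longrightarrow> N \<bullet> n > 0 \<Longrightarrow> q N \<le> K"
      using mirror_diff_bound[OF n] unfolding q_def by blast
    \<comment> \<open>Once Y reaches T, the penalty outweighs the a priori bound K. The summand 1
      keeps the divisor T positive.\<close>
    define T where "T = (\<bar>K - q N0\<bar> / \<epsilon>)\<^sup>2 + 1"
    have T: "T > 0" unfolding T_def by (simp add: add_nonneg_pos)
    define \<eta> where "\<eta> = min ((1 - lam) / T) (Na \<bullet> n)"
    have eta: "\<eta> > 0" "\<eta> \<le> Na \<bullet> n" unfolding \<eta>_def using lam T Na by auto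
    have small: "r N \<le> q N0" if N: "N \<in> Cap c" "N \<bullet> n > 0" "N \<bullet> n < \<eta>" for N
    proof -
      have "N \<bullet> n < (1 - lam) / T" using N(3) by (simp add: \<eta>_def)
      then have "T * (N \<bullet> n) \<le> 1 - N \<bullet> P" using T L(1)[OF N(1)] by (simp add: field_simps)
      then have "T \<le> Y N" unfolding Y_def using N(2) by (simp add: field_simps)
      then have "(\<bar>K - q N0\<bar> / \<epsilon>)\<^sup>2 \<le> Y N" by (simp add: T_def)
      then have "\<bar>K - q N0\<bar> / \<epsilon> \<le> sqrt (Y N)" using e by (intro real_le_rsqrt) auto
      then have "\<bar>K - q N0\<bar> \<le> \<epsilon> * sqrt (Y N)" using e by (simp add: field_simps)
      then show ?thesis unfolding r_def using K[OF N(1,2)] by linarith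
    qed
    have "continuous_on (?A \<eta>) r"
      unfolding r_def Y_def
      by (intro continuous_intros qc eta) (use eta in auto)
    moreover have "?A \<eta> \<noteq> {}" using Na eta by auto
    ultimately obtain p where p: "p \<in> ?A \<eta>" "\<And>N. N \<in> ?A \<eta> \<Longrightarrow> r N \<le> r p"
      using continuous_attains_sup[OF cA] by metis
    have pC: "p \<in> Cap c" "p \<bullet> n > 0" using p(1) eta by auto
    have rp: "r p > q N0" using p(2)[of Na] ra Na eta by auto
    have rmax: "r N \<le> r p" if "N \<in> Cap c" "N \<bullet> n > 0" for N
    proof (cases "N \<bullet> n < \<eta>")
      case True then show ?thesis using small[OF that] rp by simp
    next
      case False then show ?thesis using p(2) that by simp
    qed
    have xd: "p \<bullet> n < \<delta>"
    proof (rule ccontr)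
      assume "\<not> p \<bullet> n < \<delta>"
      then have "q p \<le> q N0" using N0(2) pC by simp
      moreover have "0 \<le> \<epsilon> * sqrt (Y p)" using e Ypos[OF pC] by simp
      ultimately show False using rp unfolding r_def by linarith
    qed
    let ?x = "p \<bullet> n"
    let ?g = "\<lambda>z. r p + \<epsilon> * sqrt (- z)" and ?g1 = "\<lambda>z. - \<epsilon> / (2 * sqrt (- z))"
    let ?y = "Y p"
    have zy: "(N \<bullet> P - 1) / (N \<bullet> n) = - Y N" for N unfolding Y_def by (simp add: divide_simps)
    define s where "s = sqrt ?y"
    have s: "s > 0" "s * s = ?y" unfolding s_def using Ypos[OF pC] by simp_all
    have g1d: "(?g1 has_real_derivative - \<epsilon> / (4 * s ^ 3)) (at (- ?y))"
      using Ypos[OF pC] unfolding s_def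
      by (auto intro!: derivative_eq_intros simp: field_simps power3_eq_cube)
    let ?w = "?x *\<^sub>R P - (p \<bullet> P - 1) *\<^sub>R n"
    have "- (- \<epsilon> / (4 * s ^ 3)) / ?x ^ 3 * (?w \<bullet> ?w - (?w \<bullet> p)\<^sup>2) \<le> Cell * (- (?g1 ((p \<bullet> P - 1) / ?x)))"
    proof (rule touch[OF n pC, where g = ?g and e = ?x])
      show "c < P $ None" unfolding P_def using lam by simp
      show "p \<bullet> P < 1" using L(1)[OF pC(1)] lam by simp
      show "(?g has_real_derivative ?g1 z) (at z)" if "z < 0" for z
        using that by (auto intro!: derivative_eq_intros simp: field_simps)
      show "(?g1 has_real_derivative - \<epsilon> / (4 * s ^ 3)) (at ((p \<bullet> P - 1) / ?x))" unfolding zy by (rule g1d)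
      show "?g1 ((p \<bullet> P - 1) / ?x) < 0" unfolding zy using e Ypos[OF pC] by simp
      show "- \<epsilon> / (4 * s ^ 3) \<le> 0" using e s by simp
      show "0 < ?x" by (rule pC)
      show "F (mirror n N) - F N \<le> (N \<bullet> n) * ?g ((N \<bullet> P - 1) / (N \<bullet> n))" if "N \<in> Cap c" "dist N p < ?x" for N
      proof -
        have x: "N \<bullet> n > 0" by (rule inner_pos_near[OF that(2) n(1)])
        have "q N \<le> r p + \<epsilon> * sqrt (Y N)" using rmax[OF that(1) x] by (simp add: r_def)
        then show ?thesis unfolding zy q_def using x by (simp add: field_simps)
      qed
      show "F (mirror n p) - F p = ?x * ?g ((p \<bullet> P - 1) / ?x)"
        unfolding zy r_def q_def using pC(2) by simp
    qed
    then have "\<epsilon> / (4 * s ^ 3) / ?x ^ 3 * (?w \<bullet> ?w - (?w \<bullet> p)\<^sup>2) \<le> Cell * (\<epsilon> / (2 * s))"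
      unfolding zy by (simp add: s_def)
    then have "(4 * s ^ 3 * ?x ^ 3 / \<epsilon>) * (\<epsilon> / (4 * s ^ 3) / ?x ^ 3 * (?w \<bullet> ?w - (?w \<bullet> p)\<^sup>2))
        \<le> (4 * s ^ 3 * ?x ^ 3 / \<epsilon>) * (Cell * (\<epsilon> / (2 * s)))"
      using s(1) e pC(2) by (intro mult_left_mono) auto
    moreover have "(4 * s ^ 3 * ?x ^ 3 / \<epsilon>) * (\<epsilon> / (4 * s ^ 3) / ?x ^ 3 * t) = t" for t
      using s(1) e pC(2) by simp
    moreover have "(4 * s ^ 3 * ?x ^ 3 / \<epsilon>) * (Cell * (\<epsilon> / (2 * s))) = 2 * Cell * (s * s) * ?x ^ 3"
      using s(1) e by (simp add: field_simps power3_eq_cube)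
    ultimately have "?w \<bullet> ?w - (?w \<bullet> p)\<^sup>2 \<le> 2 * Cell * (s * s) * ?x ^ 3" by (simp only:)
    also have "\<dots> = 2 * Cell * (1 - p \<bullet> P) * ?x\<^sup>2"
      unfolding s(2) Y_def using pC(2) by (simp add: field_simps power3_eq_cube power2_eq_square)
    also have "\<dots> \<le> 4 * Cell * ?x\<^sup>2"
      using mult_left_mono[OF L(2)[OF pC(1)], of "2 * Cell * ?x\<^sup>2"] Cell(1) by (simp add: mult_ac)
    finally have 1: "?w \<bullet> ?w - (?w \<bullet> p)\<^sup>2 \<le> 4 * Cell * ?x\<^sup>2" .
    have wp: "?w \<bullet> p = ?x"
      by (simp add: inner_diff_left inner_commute[of P] inner_commute[of n] algebra_simps)
    have ww: "?w \<bullet> ?w = ?x\<^sup>2 * lam\<^sup>2 + (1 - p \<bullet> P)\<^sup>2"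
      using n(1) by (simp add: inner_diff_left inner_diff_right nP PP power2_eq_square algebra_simps)
    \<comment> \<open>In the tangential length of w the terms in x are of second order, whereas 1 -
      p . P is bounded below. Hence the gradient of \<zeta> does not degenerate at the mirror and
      the concavity term wins for small x.\<close>
    have "(1 - lam)\<^sup>2 \<le> (1 - p \<bullet> P)\<^sup>2" using L(1)[OF pC(1)] lam by (intro power_mono) auto
    moreover have "0 \<le> ?x\<^sup>2 * lam\<^sup>2" by simp
    ultimately have "(1 - lam)\<^sup>2 \<le> (4 * Cell + 1) * ?x\<^sup>2" using 1 unfolding wp ww distrib_right by linarith
    also have "\<dots> < (4 * Cell + 1) * \<delta>\<^sup>2"
      using xd pC(2) C1 by (intro mult_strict_left_mono power_strict_mono) auto
    finally show False using d2 by simp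
  qed
  then show ?thesis using N0(1) d(1) unfolding q_def by (intro bexI[of _ N0]) auto
qed

end

lemma inner_le_one:
  assumes "N \<in> Cap c" "n \<bullet> n = 1"
  shows "N \<bullet> n \<le> 1"
  using Cap_abs_inner[OF assms] by simp

lemma inner_eq_one:
  assumes "N \<bullet> N = 1" "n \<bullet> n = 1" "N \<bullet> n = 1"
  shows "N = n"
proof -
  have "(N - n) \<bullet> (N - n) = 0" using assms by (simp add: inner_diff_left inner_diff_right inner_commute)
  then show ?thesis by simp
qed

section \<open>The strong maximum principle\<close>

context capillary_eq begin

text \<open>Hopf's argument with the levels of Y in the role of concentric spheres around Nb. The
  annulus may meet the boundary of the cap: contact there is excluded because Nb lies above the
  boundary plane.\<close>

lemma mirror_quotient_constant:
  assumes n: "n \<bullet> n = 1" "n $ None = 0"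
    and N0: "N0 \<in> Cap c" "N0 \<bullet> n > 0"
    and mx: "\<And>N. N \<in> Cap c \<Longrightarrow> N \<bullet> n > 0 \<Longrightarrow> (F (mirror n N) - F N) / (N \<bullet> n) \<le> (F (mirror n N0) - F N0) / (N0 \<bullet> n)"
    and Nb: "Nb \<in> Cap c" "Nb \<bullet> n > 0" "Nb $ None > c"
  shows "(F (mirror n Nb) - F Nb) / (Nb \<bullet> n) = (F (mirror n N0) - F N0) / (N0 \<bullet> n)"
proof (rule ccontr)
  define q where "q N = (F (mirror n N) - F N) / (N \<bullet> n)" for N
  define M where "M = q N0"
  assume "\<not> ?thesis"
  then have qb: "q Nb < M" using mx[OF Nb(1,2)] unfolding q_def M_def by simp
  have qM: "q N \<le> M" if "N \<in> Cap c" "N \<bullet> n > 0" for N using mx[OF that] by (simp add: q_def M_def)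
  have bb: "Nb \<bullet> Nb = 1" using Cap_inner[OF Nb(1)] .
  have a1: "N \<bullet> Nb \<le> 1" if "N \<in> Cap c" for N by (rule inner_le_one[OF that bb])
  have a1': "N = Nb" if "N \<in> Cap c" "N \<bullet> Nb = 1" for N
    using inner_eq_one[OF Cap_inner[OF that(1)] bb that(2)] .
  define Y where "Y N = (1 - N \<bullet> Nb) / (N \<bullet> n)" for N
  have Y0: "Y N \<ge> 0" if "N \<in> Cap c" "N \<bullet> n > 0" for N
    using a1[OF that(1)] that(2) by (simp add: Y_def)
  \<comment> \<open>Sublevel sets of Y are written without the quotient, which makes them compact.
    They cannot reach x \<le> 0, because there N . Nb = 1 would force N = Nb.\<close>
  have xpos: "N \<bullet> n > 0" if "N \<in> Cap c" "1 - N \<bullet> Nb \<le> r * (N \<bullet> n)" "r \<ge> 0" for N r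
  proof (rule ccontr)
    assume x: "\<not> N \<bullet> n > 0"
    then have "r * (N \<bullet> n) \<le> 0" using that(3) by (simp add: mult_nonneg_nonpos)
    then have "N \<bullet> Nb = 1" using that(2) a1[OF that(1)] by simp
    then show False using a1'[OF that(1)] x Nb(2) by simp
  qed
  have Yle: "Y N \<le> r \<longleftrightarrow> 1 - N \<bullet> Nb \<le> r * (N \<bullet> n)" if "N \<bullet> n > 0" for N r
    using that by (simp add: Y_def field_simps)
  have Yge: "r \<le> Y N \<longleftrightarrow> r * (N \<bullet> n) \<le> 1 - N \<bullet> Nb" if "N \<bullet> n > 0" for N r
    using that by (simp add: Y_def field_simps)
  let ?B = "\<lambda>r. Cap c \<inter> {N. 1 - N \<bullet> Nb \<le> r * (N \<bullet> n)}"
  have cB: "compact (?B r)" for r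
    by (intro compact_Int_closed compact_Cap closed_Collect_le continuous_intros)
  have qc: "continuous_on A q" if "A \<subseteq> Cap c" "\<And>N. N \<in> A \<Longrightarrow> N \<bullet> n > 0" for A
    unfolding q_def using that by (intro mirror_quotient_cont n) auto
  have Yc: "continuous_on A Y" if "\<And>N. N \<in> A \<Longrightarrow> N \<bullet> n > 0" for A
    unfolding Y_def using that by (intro continuous_intros) force
  define Z where "Z = {N \<in> ?B (Y N0). q N = M}"
  have Zx: "N \<bullet> n > 0" if "N \<in> ?B r" "r \<ge> 0" for N r using xpos that by blast
  have "compact Z"
  proof -
    have "closed Z" unfolding Z_def
      using Zx Y0[OF N0] by (intro continuous_closed_preimage_constant qc compact_imp_closed cB) auto
    then have "compact (?B (Y N0) \<inter> Z)" by (rule compact_Int_closed[OF cB])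
    moreover have "?B (Y N0) \<inter> Z = Z" by (auto simp: Z_def)
    ultimately show ?thesis by simp
  qed
  moreover have "N0 \<in> Z" using N0 Yle[OF N0(2), of "Y N0"] by (simp add: Z_def M_def)
  moreover have "continuous_on Z Y"
    using Zx[of _ "Y N0"] Y0[OF N0] by (intro Yc) (auto simp: Z_def)
  ultimately obtain p1 where p1: "p1 \<in> Z" "\<And>N. N \<in> Z \<Longrightarrow> Y p1 \<le> Y N"
    using continuous_attains_inf[of Z Y] by blast
  have p1C: "p1 \<in> Cap c" "p1 \<bullet> n > 0" "q p1 = M"
    using p1(1) Zx[of p1 "Y N0"] Y0[OF N0] by (auto simp: Z_def)
  \<comment> \<open>The lowest level of Y at which q takes its maximal value M; it is positive
    because q Nb < M.\<close>
  define \<kappa> where "\<kappa> = Y p1"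
  have kmin: "\<kappa> \<le> Y N" if "N \<in> Cap c" "N \<bullet> n > 0" "q N = M" for N
  proof (cases "Y N \<le> Y N0")
    case True
    then have "N \<in> Z" using that Yle[OF that(2)] by (simp add: Z_def)
    then show ?thesis using p1(2) by (simp add: \<kappa>_def)
  next
    case False
    then show ?thesis using p1(2)[OF \<open>N0 \<in> Z\<close>] by (simp add: \<kappa>_def)
  qed
  have k: "\<kappa> > 0"
  proof (rule ccontr)
    assume "\<not> \<kappa> > 0"
    then have "1 - p1 \<bullet> Nb \<le> 0" using Yle[OF p1C(2), of 0] by (simp add: \<kappa>_def)
    then have "p1 = Nb" using a1'[OF p1C(1)] a1[OF p1C(1)] by simp
    then show False using p1C(3) qb by simp
  qed
  have kx: "N \<bullet> n > 0" if "N \<in> ?B (\<kappa> / 2)" for N using that k by (intro Zx[of N "\<kappa> / 2"]) auto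
  have "Nb \<in> ?B (\<kappa> / 2)" using Nb k bb by simp
  then have B0: "?B (\<kappa> / 2) \<noteq> {}" by blast
  have B1: "continuous_on (?B (\<kappa> / 2)) q" using kx by (intro qc) auto
  from continuous_attains_sup[OF cB B0 B1] obtain p0 where p0: "p0 \<in> ?B (\<kappa> / 2)" "\<And>N. N \<in> ?B (\<kappa> / 2) \<Longrightarrow> q N \<le> q p0"
    by blast
  define \<eta> where "\<eta> = M - q p0"
  have eta: "\<eta> > 0"
  proof (rule ccontr)
    assume "\<not> \<eta> > 0"
    moreover have p0C: "p0 \<in> Cap c" "p0 \<bullet> n > 0" using p0(1) kx by auto
    ultimately have "q p0 = M" using qM[of p0] by (simp add: \<eta>_def)
    then have "\<kappa> \<le> Y p0" using kmin p0C by blast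
    moreover have "Y p0 \<le> \<kappa> / 2" using p0(1) Yle[OF p0C(2), of "\<kappa> / 2"] by blast
    ultimately show False using k by simp
  qed
  \<comment> \<open>Large enough that contact gives (Cell + 1) x^2 \<le> Cell x^2, since Y is at
    least \<kappa> / 2 there.\<close>
  define A where "A = 4 * (Cell + 1) / \<kappa>\<^sup>2"
  have A: "A > 0" unfolding A_def using Cell(1) k by simp
  define \<epsilon> where "\<epsilon> = \<eta> / 2"
  have e: "\<epsilon> > 0" unfolding \<epsilon>_def using eta by simp
  define f where "f N = q N + \<epsilon> * exp (- A * Y N)" for N
  \<comment> \<open>The annulus with Y between \<kappa> / 2 and 2 \<kappa>. The maximum of f lies
    strictly inside: on the outer edge the exponential is smaller than at p1, and on the inner edge
    the deficit \<eta> of q exceeds the gain \<epsilon> = \<eta> / 2.\<close>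
  let ?R = "?B (2 * \<kappa>) \<inter> {N. \<kappa> / 2 * (N \<bullet> n) \<le> 1 - N \<bullet> Nb}"
  have Rx: "N \<bullet> n > 0" if "N \<in> ?R" for N using Zx[of N "2 * \<kappa>"] that k by auto
  have "compact ?R" by (intro compact_Int_closed cB closed_Collect_le continuous_intros)
  moreover have p1R: "p1 \<in> ?R"
    using p1C Yle[OF p1C(2), of "2 * \<kappa>"] Yge[OF p1C(2), of "\<kappa> / 2"] k by (simp add: \<kappa>_def)
  moreover have "continuous_on ?R f"
    unfolding f_def using Rx by (intro continuous_intros qc Yc) auto
  ultimately obtain p where p: "p \<in> ?R" "\<And>N. N \<in> ?R \<Longrightarrow> f N \<le> f p"
    using continuous_attains_sup[of ?R f] by blast
  have pC: "p \<in> Cap c" "p \<bullet> n > 0" using p(1) Rx by auto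
  have fp: "f p \<ge> M + \<epsilon> * exp (- A * \<kappa>)" using p(2)[OF p1R] p1C(3) by (simp add: f_def \<kappa>_def)
  have Yp1: "Y p < 2 * \<kappa>"
  proof (rule ccontr)
    assume "\<not> Y p < 2 * \<kappa>"
    then have "\<kappa> < Y p" using k by simp
    then have "exp (- A * Y p) < exp (- A * \<kappa>)" using A by simp
    then have "\<epsilon> * exp (- A * Y p) < \<epsilon> * exp (- A * \<kappa>)" using e by simp
    then show False using fp qM[OF pC] by (simp add: f_def)
  qed
  have Yp2: "\<kappa> / 2 < Y p"
  proof (rule ccontr)
    assume "\<not> \<kappa> / 2 < Y p"
    then have "Y p \<le> \<kappa> / 2" by linarith
    then have "p \<in> ?B (\<kappa> / 2)" using pC(1) Yle[OF pC(2), of "\<kappa> / 2"] by blast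
    then have "q p \<le> M - \<eta>" using p0(2) by (simp add: \<eta>_def)
    moreover have "\<epsilon> * exp (- A * Y p) \<le> \<epsilon> * 1"
      using e A Y0[OF pC] by (intro mult_left_mono) auto
    moreover have "0 < \<epsilon> * exp (- A * \<kappa>)" using e by simp
    ultimately show False using fp eta \<epsilon>_def unfolding f_def by linarith
  qed
  let ?x = "p \<bullet> n"
  have "open ({N. 0 < N \<bullet> n} \<inter> ({N. 1 - N \<bullet> Nb < (2 * \<kappa>) * (N \<bullet> n)} \<inter> {N. \<kappa> / 2 * (N \<bullet> n) < 1 - N \<bullet> Nb}))"
    by (intro open_Int open_Collect_less continuous_intros)
  moreover have "p \<in> {N. 0 < N \<bullet> n} \<inter> ({N. 1 - N \<bullet> Nb < (2 * \<kappa>) * (N \<bullet> n)} \<inter> {N. \<kappa> / 2 * (N \<bullet> n) < 1 - N \<bullet> Nb})"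
    using pC Yp1 Yp2 by (simp add: Y_def field_simps)
  ultimately obtain d where d: "d > 0" "\<And>N. dist N p < d \<Longrightarrow>
      N \<in> {N. 0 < N \<bullet> n} \<inter> ({N. 1 - N \<bullet> Nb < (2 * \<kappa>) * (N \<bullet> n)} \<inter> {N. \<kappa> / 2 * (N \<bullet> n) < 1 - N \<bullet> Nb})"
    unfolding open_dist by blast
  have near: "N \<bullet> n > 0 \<and> f N \<le> f p" if "N \<in> Cap c" "dist N p < d" for N
    using d(2)[OF that(2)] that(1) by (auto intro!: p(2))
  have zy: "(N \<bullet> Nb - 1) / (N \<bullet> n) = - Y N" for N unfolding Y_def by (simp add: divide_simps)
  let ?g = "\<lambda>z. f p - \<epsilon> * exp (A * z)" and ?g1 = "\<lambda>z. - (\<epsilon> * A * exp (A * z))"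
  let ?w = "?x *\<^sub>R Nb - (p \<bullet> Nb - 1) *\<^sub>R n"
  let ?E = "exp (A * (- Y p))"
  have "- (- (\<epsilon> * A\<^sup>2 * ?E)) / ?x ^ 3 * (?w \<bullet> ?w - (?w \<bullet> p)\<^sup>2) \<le> Cell * (- (?g1 ((p \<bullet> Nb - 1) / ?x)))"
  proof (rule touch[OF n pC, where g = ?g and e = d])
    show "c < Nb $ None" by (rule Nb(3))
    show "p \<bullet> Nb < 1"
    proof -
      have "0 < Y p" using Yp2 k by simp
      then show ?thesis unfolding Y_def using pC(2) by (simp add: zero_less_divide_iff)
    qed
    show "(?g has_real_derivative ?g1 z) (at z)" for z
      by (auto intro!: derivative_eq_intros)
    show "(?g1 has_real_derivative - (\<epsilon> * A\<^sup>2 * ?E)) (at ((p \<bullet> Nb - 1) / ?x))"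
      unfolding zy by (auto intro!: derivative_eq_intros simp: power2_eq_square)
    show "?g1 ((p \<bullet> Nb - 1) / ?x) < 0" using e A by simp
    show "- (\<epsilon> * A\<^sup>2 * ?E) \<le> 0" using e by simp
    show "0 < d" by (rule d)
    show "F (mirror n N) - F N \<le> (N \<bullet> n) * ?g ((N \<bullet> Nb - 1) / (N \<bullet> n))" if "N \<in> Cap c" "dist N p < d" for N
    proof -
      have x: "N \<bullet> n > 0" using near[OF that] by blast
      have "q N \<le> f p - \<epsilon> * exp (A * (- Y N))" using near[OF that] by (simp add: f_def)
      then show ?thesis unfolding zy q_def using x by (simp add: field_simps)
    qed
    show "F (mirror n p) - F p = ?x * ?g ((p \<bullet> Nb - 1) / ?x)"
      unfolding zy f_def q_def using pC(2) by simp
  qed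
  then have "\<epsilon> * A\<^sup>2 * ?E / ?x ^ 3 * (?w \<bullet> ?w - (?w \<bullet> p)\<^sup>2) \<le> Cell * (\<epsilon> * A * ?E)"
    unfolding zy by simp
  then have "(?x ^ 3 / (\<epsilon> * A * ?E)) * (\<epsilon> * A\<^sup>2 * ?E / ?x ^ 3 * (?w \<bullet> ?w - (?w \<bullet> p)\<^sup>2))
      \<le> (?x ^ 3 / (\<epsilon> * A * ?E)) * (Cell * (\<epsilon> * A * ?E))"
    using e A pC(2) by (intro mult_left_mono) auto
  moreover have "(?x ^ 3 / (\<epsilon> * A * ?E)) * (\<epsilon> * A\<^sup>2 * ?E / ?x ^ 3 * t) = A * t" for t
    using e A pC(2) by (simp add: power2_eq_square)
  moreover have "(?x ^ 3 / (\<epsilon> * A * ?E)) * (Cell * (\<epsilon> * A * ?E)) = Cell * ?x ^ 3"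
    using e A by simp
  ultimately have 1: "A * (?w \<bullet> ?w - (?w \<bullet> p)\<^sup>2) \<le> Cell * ?x ^ 3" by (simp only:)
  have wp: "?w \<bullet> p = ?x"
    by (simp add: inner_diff_left inner_commute[of Nb] inner_commute[of n] algebra_simps)
  have ww: "?w \<bullet> ?w = ?x\<^sup>2 + 2 * ?x * (1 - p \<bullet> Nb) * (Nb \<bullet> n) + (1 - p \<bullet> Nb)\<^sup>2"
    unfolding inner_diff_left inner_diff_right inner_scaleR_left inner_scaleR_right n(1) bb inner_commute[of n Nb]
    by (simp add: power2_eq_square algebra_simps)
  have "(\<kappa> / 2 * ?x)\<^sup>2 \<le> (1 - p \<bullet> Nb)\<^sup>2"
    using Yp2 Yge[OF pC(2), of "\<kappa> / 2"] k pC(2) by (intro power_mono) auto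
  moreover have "0 \<le> 2 * ?x * (1 - p \<bullet> Nb) * (Nb \<bullet> n)"
    using pC(2) Nb(2) a1[OF pC(1)] by (intro mult_nonneg_nonneg) auto
  ultimately have "(\<kappa> / 2 * ?x)\<^sup>2 \<le> ?w \<bullet> ?w - (?w \<bullet> p)\<^sup>2" unfolding wp ww by linarith
  then have "A * (\<kappa> / 2 * ?x)\<^sup>2 \<le> A * (?w \<bullet> ?w - (?w \<bullet> p)\<^sup>2)" using A by simp
  also have "\<dots> \<le> Cell * ?x ^ 3" by (rule 1)
  also have "\<dots> \<le> Cell * ?x\<^sup>2"
    using inner_le_one[OF pC(1) n(1)] pC(2) Cell(1)
    by (intro mult_left_mono power_decreasing) auto
  also have "A * (\<kappa> / 2 * ?x)\<^sup>2 = (Cell + 1) * ?x\<^sup>2"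
    unfolding A_def using k by (simp add: field_simps power2_eq_square)
  finally show False using pC(2) by (simp add: algebra_simps)
qed

text \<open>Constancy of the quotient was proved only strictly above the boundary plane. Boundary
  points follow by continuity along an inward great circle, and x < 0 follows because both sides are
  odd under the reflection.\<close>

lemma mirror_diff_linear:
  assumes n: "n \<bullet> n = 1" "n $ None = 0"
  shows "\<exists>M. \<forall>N\<in>Cap c. F (mirror n N) - F N = M * (N \<bullet> n)"
proof -
  obtain N0 where N0: "N0 \<in> Cap c" "N0 \<bullet> n > 0" and mx: "\<And>N. N \<in> Cap c \<Longrightarrow> N \<bullet> n > 0 \<Longrightarrow>
    (F (mirror n N) - F N) / (N \<bullet> n) \<le> (F (mirror n N0) - F N0) / (N0 \<bullet> n)"
    using mirror_quotient_attains_sup[OF n] by blast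
  define M where "M = (F (mirror n N0) - F N0) / (N0 \<bullet> n)"
  have int: "F (mirror n N) - F N = M * (N \<bullet> n)" if "N \<in> Cap c" "N \<bullet> n > 0" "N $ None > c" for N
    using mirror_quotient_constant[OF n N0 mx that] that(2) unfolding M_def[symmetric] by (simp add: field_simps)
  have pos: "F (mirror n N) - F N = M * (N \<bullet> n)" if N: "N \<in> Cap c" "N \<bullet> n > 0" for N
  proof (cases "N $ None > c")
    case True
    then show ?thesis using int N by blast
  next
    case False
    then have "N $ None = c" using N(1) by (simp add: Cap_def)
    from inward_conormal(4)[OF N(1) this] obtain m r where
      mr: "0 < r" "\<And>s. 0 < s \<Longrightarrow> s < r \<Longrightarrow> geo N m s \<in> Cap c \<and> geo N m s $ None > c"
      by blast
    let ?f = "\<lambda>s. F (mirror n (geo N m s)) - F (geo N m s) - M * (geo N m s \<bullet> n)"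
    have U: "N \<in> U" "mirror n N \<in> U" using N(1) mirror_Cap[OF n N(1)] CapU by auto
    have gc: "isCont (geo N m) 0" by (rule geo_cont)
    have "isCont F (geo N m 0)" "isCont F (mirror n (geo N m 0))"
      unfolding geo_0 using U F_deriv has_derivative_continuous by blast+
    moreover have "isCont (\<lambda>s. mirror n (geo N m s)) 0"
      unfolding mirror_def using gc by (intro continuous_intros)
    ultimately have "isCont ?f 0"
      using gc by (intro continuous_intros) (auto intro: isCont_o2)
    then have t1: "(?f \<longlongrightarrow> ?f 0) (at_right 0)"
      unfolding isCont_def by (rule tendsto_mono[rotated]) (simp add: at_le)
    have ev: "\<forall>\<^sub>F s in at_right 0. ?f s = 0"
    proof -
      have "((\<lambda>s. geo N m s \<bullet> n) \<longlongrightarrow> N \<bullet> n) (at_right 0)"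
      proof -
        have "isCont (\<lambda>s. geo N m s \<bullet> n) 0" using gc by (intro continuous_intros)
        then have "((\<lambda>s. geo N m s \<bullet> n) \<longlongrightarrow> N \<bullet> n) (at 0)" by (simp add: isCont_def geo_0)
        then show ?thesis by (rule tendsto_mono[rotated]) (simp add: at_le)
      qed
      then have "\<forall>\<^sub>F s in at_right 0. geo N m s \<bullet> n > 0" using N(2) order_tendstoD(1) by blast
      moreover have "\<forall>\<^sub>F s in at_right 0. 0 < s \<and> s < r"
        using eventually_at_right_real[OF mr(1)] by (auto elim: eventually_mono)
      ultimately show ?thesis
      proof eventually_elim
        case (elim s)
        then show ?case using int[of "geo N m s"] mr(2)[of s] by simp
      qed
    qed
    have "((\<lambda>_ :: real. 0 :: real) \<longlongrightarrow> ?f 0) (at_right 0)"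
      using t1 tendsto_cong[OF ev] by blast
    then have "?f 0 = 0" by (simp add: tendsto_const_iff)
    then show ?thesis by (simp add: geo_0)
  qed
  have "F (mirror n N) - F N = M * (N \<bullet> n)" if N: "N \<in> Cap c" for N
  proof (cases "N \<bullet> n" "0::real" rule: linorder_cases)
    case greater
    then show ?thesis using pos N by blast
  next
    case equal
    then show ?thesis by (simp add: mirror_def)
  next
    case less
    then have "mirror n N \<bullet> n > 0" using mirror_normal[OF n(1), of N] by simp
    from pos[OF mirror_Cap[OF n N] this] show ?thesis
      unfolding mirror_mirror[OF n(1)] mirror_normal[OF n(1)] by simp
  qed
  then show ?thesis by blast
qed

end
section \<open>Rotationally symmetric solutions\<close>

lemma second_derivative_of_zero:
  fixes f :: "real \<Rightarrow> real"
  assumes e: "0 < e" and z: "\<And>s. \<bar>s\<bar> < e \<Longrightarrow> f s = 0"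
    and f': "\<And>s. \<bar>s\<bar> < e \<Longrightarrow> (f has_real_derivative f' s) (at s)"
    and d: "(f' has_real_derivative d) (at 0)"
  shows "d = 0"
proof -
  have "d \<le> 0" using z e by (intro second_derivative_at_max[OF e _ f' d]) auto
  moreover have "- d \<le> 0"
    using z e by (intro second_derivative_at_max[OF e _ DERIV_minus[OF f'] DERIV_minus[OF d]]) auto
  ultimately show ?thesis by simp
qed

lemma mirror_swap:
  fixes N1 N2 :: "'a::euclidean_space"
  assumes "N1 \<bullet> N1 = N2 \<bullet> N2" "N1 \<noteq> N2"
  defines "d \<equiv> N1 - N2"
  shows "mirror (d /\<^sub>R norm d) N1 = N2"
proof -
  have nd: "norm d \<noteq> 0" using assms(2) by (simp add: d_def)
  have "2 * (N1 \<bullet> d) = (norm d)\<^sup>2"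
    using assms(1) by (simp add: d_def power2_norm_eq_inner inner_diff_left inner_diff_right inner_commute)
  then have "2 * (N1 \<bullet> (d /\<^sub>R norm d)) = norm d" using nd by (simp add: field_simps power2_eq_square)
  then have "mirror (d /\<^sub>R norm d) N1 = N1 - norm d *\<^sub>R (d /\<^sub>R norm d)" by (simp only: mirror_def)
  also have "\<dots> = N2" using nd by (simp add: d_def)
  finally show ?thesis .
qed

lemma inner_axis_nth: "v \<bullet> axis i 1 = v $ i" "axis i 1 \<bullet> v = v $ i" for v :: "real^'m::finite"
  by (simp_all add: inner_axis inner_axis')

context sphere_C2 begin

lemma pole_Cap: "axis None 1 \<in> Cap c"
  using c by (simp add: Cap_def)

text \<open>Differentiation at the pole, which every vertical mirror contains. The multiplier
  depends linearly on n through one gradient, so a single linear function corrects all reflections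
  at once.\<close>

lemma mirror_coefficient:
  assumes n: "n \<bullet> n = 1" "n $ None = 0" and M: "\<And>N. N \<in> Cap c \<Longrightarrow> F (mirror n N) - F N = M * (N \<bullet> n)"
  shows "M = - 2 * (D (axis None 1) \<bullet> n)"
proof -
  let ?K = "axis None 1 :: real^('n option)"
  have K: "?K \<in> Cap c" "?K \<in> U" using pole_Cap CapU by auto
  have nK: "n \<bullet> ?K = 0" using n(2) by (simp add: inner_axis_nth)
  obtain r where r: "r > 0" "\<And>s. \<bar>s\<bar> < r \<Longrightarrow> geo ?K n s \<in> Cap c"
    using geo_near_Cap[OF K(1) _ n(1) nK] c by auto
  have rK: "mirror n ?K = ?K" using nK by (simp add: mirror_def inner_commute)
  have rn: "mirror n n = - n" using n(1) by (simp add: mirror_def scaleR_2)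
  have rg: "mirror n (geo ?K n s) = geo ?K (- n) s" for s
    using geo_linear[OF mirror_linear] rK rn by metis
  have gn: "geo ?K n s \<bullet> n = sin s" for s
    using nK n(1) by (simp add: geo_def inner_add_left inner_add_right inner_commute)
  let ?f = "\<lambda>s. F (geo ?K (- n) s) - F (geo ?K n s) - M * sin s"
  have d: "(?f has_real_derivative D ?K \<bullet> (- n) - D ?K \<bullet> n - M) (at 0)"
  proof -
    have "((\<lambda>s. F (geo ?K u s)) has_real_derivative D ?K \<bullet> u) (at 0)" for u
      using F_geo_deriv[of ?K u 0] K(2) by (simp add: geo_0)
    then show ?thesis by (auto intro!: derivative_eq_intros)
  qed
  have f0: "?f s = 0" if "\<bar>s\<bar> < r" for s
    using M[OF r(2)[OF that]] unfolding rg gn by simp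
  have "D ?K \<bullet> (- n) - D ?K \<bullet> n - M = 0"
    by (rule DERIV_local_const[OF d r(1)]) (use f0 f0[of 0] r(1) in auto)
  then show ?thesis by simp
qed

end

section \<open>Meridians and the spectrum of a rotationally symmetric solution\<close>

context capillary_eq begin

text \<open>The meridian from the pole, parametrized by the polar angle; \<open>lat'\<close> is its
  velocity.\<close>

definition lat :: "'n \<Rightarrow> real \<Rightarrow> real^('n option)" where
  "lat \<alpha> = geo (axis None 1) (axis (Some \<alpha>) 1)"

definition lat' :: "'n \<Rightarrow> real \<Rightarrow> real^('n option)" where
  "lat' \<alpha> = geo' (axis None 1) (axis (Some \<alpha>) 1)"

lemma axis_inner: "(axis i 1 :: real^('n option)) \<bullet> axis j 1 = (if i = j then 1 else 0)"
  by (simp add: inner_axis_axis)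

lemma lat_facts:
  "lat \<alpha> s = cos s *\<^sub>R axis None 1 + sin s *\<^sub>R axis (Some \<alpha>) 1"
  "lat' \<alpha> s = cos s *\<^sub>R axis (Some \<alpha>) 1 - sin s *\<^sub>R axis None 1"
  "lat \<alpha> s $ None = cos s" "norm (lat \<alpha> s) = 1" "lat' \<alpha> s \<bullet> lat' \<alpha> s = 1" "lat' \<alpha> s \<bullet> lat \<alpha> s = 0"
proof -
  show 1: "lat \<alpha> s = cos s *\<^sub>R axis None 1 + sin s *\<^sub>R axis (Some \<alpha>) 1"
    and 2: "lat' \<alpha> s = cos s *\<^sub>R axis (Some \<alpha>) 1 - sin s *\<^sub>R axis None 1"
    by (simp_all add: lat_def lat'_def geo_def geo'_def)
  show "lat \<alpha> s $ None = cos s" unfolding 1 by (simp add: axis_def)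
  show "norm (lat \<alpha> s) = 1" unfolding lat_def by (rule geo_norm) (simp_all add: axis_inner)
  show "lat' \<alpha> s \<bullet> lat' \<alpha> s = 1" "lat' \<alpha> s \<bullet> lat \<alpha> s = 0"
    unfolding 1 2 inner_diff_left inner_diff_right inner_add_right inner_add_left
      inner_scaleR_left inner_scaleR_right axis_inner
    by (simp_all add: power2_eq_square[symmetric] mult.commute)
qed

lemma lat_Cap: "c \<le> cos s \<Longrightarrow> lat \<alpha> s \<in> Cap c"
  by (simp add: Cap_def lat_facts(3,4))

text \<open>Two points of equal height are exchanged by the reflection along their difference, which
  is horizontal. Reflections thus replace rotations.\<close>

lemma rotation_invariant:
  assumes sym: "\<And>n N. n \<bullet> n = 1 \<Longrightarrow> n $ None = 0 \<Longrightarrow> N \<in> Cap c \<Longrightarrow> F (mirror n N) = F N"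
    and N: "N1 \<in> Cap c" "N2 \<in> Cap c" "N1 $ None = N2 $ None"
  shows "F N1 = F N2"
proof (cases "N1 = N2")
  case False
  let ?d = "N1 - N2"
  have "mirror (?d /\<^sub>R norm ?d) N1 = N2"
    using mirror_swap[of N1 N2] False Cap_inner[OF N(1)] Cap_inner[OF N(2)] by simp
  moreover have "(?d /\<^sub>R norm ?d) \<bullet> (?d /\<^sub>R norm ?d) = 1" using False by (simp add: dot_square_norm power2_eq_square)
  moreover have "(?d /\<^sub>R norm ?d) $ None = 0" using N(3) by simp
  ultimately show ?thesis using sym[OF _ _ N(1)] by metis
qed simp

text \<open>The frame of the meridian direction and the remaining horizontal axes diagonalizes the
  tensor. Reflection symmetry gives the zeros off the diagonal, and constancy of F on circles of
  latitude gives the repeated eigenvalue.\<close>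

lemma meridian_eig:
  fixes \<alpha> :: 'n
  assumes sym: "\<And>n N. n \<bullet> n = 1 \<Longrightarrow> n $ None = 0 \<Longrightarrow> N \<in> Cap c \<Longrightarrow> F (mirror n N) = F N"
    and t: "c < cos t" "0 < sin t"
  defines "p \<equiv> lat \<alpha> t" and "v \<equiv> lat' \<alpha> t"
  shows "eig p (\<lambda>i. if i = \<alpha> then D' p v \<bullet> v - D p \<bullet> p + F p else (cos t / sin t) * (D p \<bullet> v) + F p)"
proof -
  have pC: "p \<in> Cap c" "p $ None > c" using t lat_Cap[of t \<alpha>] by (simp_all add: p_def lat_facts(3))
  have pU: "p \<in> U" using pC CapU by auto
  have pp: "p \<bullet> p = 1" using Cap_inner[OF pC(1)] .
  have vv: "v \<bullet> v = 1" "v \<bullet> p = 0" unfolding v_def p_def by (simp_all add: lat_facts(5,6))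
  have bs: "bil_sym (W p)" by (rule bil_sym_W[OF pU])
  then have bl: "bilinear (W p)" and Wsym: "\<And>u v. W p u v = W p v u" by (auto simp: bil_sym_def)
  define b where "b i = (if i = \<alpha> then v else axis (Some i) 1)" for i
  have ax: "axis (Some i) 1 \<bullet> p = 0" "axis (Some i) 1 \<bullet> v = 0" if "i \<noteq> \<alpha>" for i
    using that unfolding p_def v_def lat_facts(1,2) inner_diff_right inner_add_right inner_scaleR_right axis_inner
    by simp_all
  have fr: "frame p b"
  proof -
    have "v \<bullet> axis (Some i) 1 = 0" if "i \<noteq> \<alpha>" for i
      using ax(2)[OF that] by (simp only: inner_commute)
    then have "b i \<bullet> b j = (if i = j then 1 else 0)" for i j
      using vv(1) ax(2) axis_inner[of "Some i" "Some j"] by (cases "i = \<alpha>"; cases "j = \<alpha>") (simp_all add: b_def)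
    moreover have "b i \<bullet> p = 0" for i using vv(2) ax(1) by (simp add: b_def)
    ultimately show ?thesis by (simp add: frame_def)
  qed
  \<comment> \<open>The reflection along n fixes p and exchanges the unit vectors along u + n and u
    - n, so the tensor agrees on them; polarization gives the mixed entry.\<close>
  have off: "W p u n = 0" if n: "n \<bullet> n = 1" "n $ None = 0" "n \<bullet> p = 0" and u: "u \<bullet> u = 1" "u \<bullet> p = 0" "u \<bullet> n = 0" for u n
  proof -
    let ?h = "sqrt 2 / 2"
    have hh: "?h * ?h = 1 / 2" by simp
    define up um where "up = ?h *\<^sub>R (u + n)" and "um = ?h *\<^sub>R (u - n)"
    have upm: "up \<bullet> up = 1" "up \<bullet> p = 0" "um \<bullet> um = 1" "um \<bullet> p = 0"
      unfolding up_def um_def inner_scaleR_left inner_scaleR_right inner_add_left inner_add_right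
        inner_diff_left inner_diff_right n u inner_commute[of n u]
      using hh by (simp_all add: mult.assoc[symmetric])
    have rp: "mirror n p = p" using n(3) by (simp add: mirror_def inner_commute[of p])
    have ru: "mirror n up = um"
      unfolding up_def um_def using u(3) n(1)
      by (simp add: linear_scale[OF mirror_linear] linear_add[OF mirror_linear])
         (simp add: mirror_def scaleR_2)
    have rg: "mirror n (geo p up s) = geo p um s" for s
      using geo_linear[OF mirror_linear] rp ru by metis
    obtain r where r: "r > 0" "\<And>s. \<bar>s\<bar> < r \<Longrightarrow> geo p up s \<in> Cap c"
      using geo_near_Cap[OF pC upm(1,2)] by blast
    have r': "geo p um s \<in> Cap c" if "\<bar>s\<bar> < r" for s
      using mirror_Cap[OF n(1,2) r(2)[OF that]] unfolding rg .
    have "(W p up up - F p) - (W p um um - F p) = 0"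
    proof (rule second_derivative_of_zero[OF r(1)])
      show "F (geo p up s) - F (geo p um s) = 0" if "\<bar>s\<bar> < r" for s
        using sym[OF n(1,2) r(2)[OF that]] unfolding rg by simp
      show "((\<lambda>s. F (geo p up s) - F (geo p um s)) has_real_derivative
          D (geo p up s) \<bullet> geo' p up s - D (geo p um s) \<bullet> geo' p um s) (at s)" if "\<bar>s\<bar> < r" for s
        using r(2)[OF that] r'[OF that] CapU by (intro DERIV_diff F_geo_deriv) auto
      show "((\<lambda>s. D (geo p up s) \<bullet> geo' p up s - D (geo p um s) \<bullet> geo' p um s) has_real_derivative
          (W p up up - F p) - (W p um um - F p)) (at 0)"
        by (intro DERIV_diff D_geo_deriv_0 pU upm)
    qed
    moreover have "W p up up - W p um um = 2 * W p u n"
      unfolding up_def um_def bilinear_lmul[OF bl] bilinear_rmul[OF bl] bilinear_ladd[OF bl] bilinear_radd[OF bl]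
        bilinear_lsub[OF bl] bilinear_rsub[OF bl] Wsym[of n u]
      by (simp add: algebra_simps)
    ultimately show ?thesis by simp
  qed
  \<comment> \<open>The circle of latitude through p in direction n is not a great circle: its
    curvature brings in the horizontal component of the gradient, which is then split along p and
    v.\<close>
  have diag: "W p n n = (cos t / sin t) * (D p \<bullet> v) + F p" if i: "i \<noteq> \<alpha>" and nd: "n = axis (Some i) 1" for i n
  proof -
    let ?e = "axis (Some \<alpha>) 1 :: real^('n option)"
    let ?C = "\<lambda>s. cos t *\<^sub>R axis None 1 + sin t *\<^sub>R geo ?e n s"
    have ne: "n \<bullet> n = 1" "?e \<bullet> ?e = 1" "n \<bullet> ?e = 0" using i by (simp_all add: nd axis_inner)
    have Cz: "?C s $ None = cos t" for s
      unfolding geo_def nd by (simp add: axis_def)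
    have CC: "?C s \<in> Cap c" for s
    proof -
      have g1: "geo ?e n s \<bullet> geo ?e n s = 1"
        using geo_norm[OF ne(2,1,3), of s] by (simp add: norm_eq_sqrt_inner)
      have g2: "axis None 1 \<bullet> geo ?e n s = 0"
        unfolding geo_def nd by (simp add: inner_add_right axis_inner)
      have "?C s \<bullet> ?C s = (cos t)\<^sup>2 + (sin t)\<^sup>2"
        unfolding inner_add_left inner_add_right inner_scaleR_left inner_scaleR_right
          inner_commute[of "geo ?e n s" "axis None 1"] g1 g2 axis_inner
        by (simp add: power2_eq_square)
      then have "norm (?C s) = 1" by (simp add: norm_eq_sqrt_inner)
      then show ?thesis using Cz t by (simp add: Cap_def)
    qed
    have CU: "?C s \<in> U" for s using CC CapU by blast
    have C0: "cos t *\<^sub>R axis None 1 + sin t *\<^sub>R ?e = p" unfolding p_def lat_facts(1) ..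
    have dC: "(?C has_derivative (\<lambda>h. h *\<^sub>R (sin t *\<^sub>R geo' ?e n s))) (at s)" for s
      by (rule has_derivative_eq_rhs,
          rule has_derivative_add[OF has_derivative_const has_derivative_scaleR_right[OF geo_has_derivative]])
         (simp add: mult.commute)
    have "sin t * (sin t * (D' p n \<bullet> n)) - sin t * (D p \<bullet> ?e) = 0"
    proof (rule second_derivative_of_zero[of 1])
      show "F (?C s) - F p = 0" for s
        using rotation_invariant[OF sym CC pC(1), of s] unfolding Cz by (simp add: p_def lat_facts(3))
      show "((\<lambda>s. F (?C s) - F p) has_real_derivative D (?C s) \<bullet> (sin t *\<^sub>R geo' ?e n s)) (at s)" for s
      proof -
        have "((\<lambda>s. F (?C s)) has_real_derivative D (?C s) \<bullet> (sin t *\<^sub>R geo' ?e n s)) (at s)"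
          unfolding has_field_derivative_def
          by (rule has_derivative_eq_rhs[OF has_derivative_compose[OF dC F_deriv[OF CU]]]) (simp add: fun_eq_iff)
        from DERIV_diff[OF this DERIV_const] show ?thesis by simp
      qed
      show "((\<lambda>s. D (?C s) \<bullet> (sin t *\<^sub>R geo' ?e n s)) has_real_derivative
          sin t * (sin t * (D' p n \<bullet> n)) - sin t * (D p \<bullet> ?e)) (at 0)"
      proof -
        have l: "linear (D' p)" by (rule D'_linear[OF pU])
        have d1: "((\<lambda>s. D (?C s)) has_derivative (\<lambda>h. D' p (h *\<^sub>R (sin t *\<^sub>R n)))) (at 0)"
          using has_derivative_compose[OF dC D_deriv[OF CU], of 0] unfolding geo_0 C0 .
        have d2: "((\<lambda>s. sin t *\<^sub>R geo' ?e n s) has_derivative (\<lambda>h. sin t *\<^sub>R (h *\<^sub>R (- ?e)))) (at 0)"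
          using has_derivative_scaleR_right[OF geo'_has_derivative[of ?e n 0]] unfolding geo_0 .
        show ?thesis unfolding has_field_derivative_def
          using has_derivative_inner[OF d1 d2] unfolding geo_0 C0
          by (rule has_derivative_eq_rhs) (auto simp: linear_scale[OF l] algebra_simps)
      qed
    qed simp
    then have 1: "sin t * (D' p n \<bullet> n) = D p \<bullet> ?e" using t(2) by (simp add: right_diff_distrib[symmetric])
    have "?e = sin t *\<^sub>R p + cos t *\<^sub>R v"
    proof -
      have "sin t *\<^sub>R p + cos t *\<^sub>R v = (sin t * sin t + cos t * cos t) *\<^sub>R ?e"
      proof -
        have "s *\<^sub>R (k *\<^sub>R K + s *\<^sub>R e) + k *\<^sub>R (k *\<^sub>R e - s *\<^sub>R K) = (s * s + k * k) *\<^sub>R e"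
          for s k :: real and K e :: "real^'n option" by (simp add: algebra_simps)
        then show ?thesis unfolding p_def v_def lat_facts(1,2) .
      qed
      moreover have "sin t * sin t + cos t * cos t = 1" by (simp flip: power2_eq_square)
      ultimately show ?thesis by (simp only: scaleR_one)
    qed
    then have "D p \<bullet> ?e = sin t * (D p \<bullet> p) + cos t * (D p \<bullet> v)" by (metis inner_add_right inner_scaleR_right)
    then have "D' p n \<bullet> n = D p \<bullet> p + (cos t / sin t) * (D p \<bullet> v)"
      using 1 t(2) by (simp add: field_simps)
    then show ?thesis unfolding W_def using ne(1) by (simp add: inner_commute)
  qed
  have Wv: "W p v v = D' p v \<bullet> v - D p \<bullet> p + F p" unfolding W_def using vv by (simp add: inner_commute)
  show ?thesis unfolding eig_def
  proof (intro exI[of _ b] conjI fr allI)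
    fix i j
    have un: "b m \<bullet> b m = 1" "b m \<bullet> p = 0" for m using fr by (auto simp: frame_def)
    have o: "b m \<bullet> b m' = 0" if "m \<noteq> m'" for m m' using fr that by (auto simp: frame_def)
    have z: "b m $ None = 0" if "m \<noteq> \<alpha>" for m using that by (simp add: b_def axis_def)
    show "W p (b i) (b j) = (if i = j then (if i = \<alpha> then D' p v \<bullet> v - D p \<bullet> p + F p else (cos t / sin t) * (D p \<bullet> v) + F p) else 0)"
    proof (cases "i = j")
      case True
      then show ?thesis using Wv diag[of i "axis (Some i) 1"] by (simp add: b_def)
    next
      case False
      then consider "j \<noteq> \<alpha>" | "i \<noteq> \<alpha>" by blast
      then have "W p (b i) (b j) = 0"
      proof cases
        case 1
        then show ?thesis using off[OF un(1) z un(2) un o[OF False]] by blast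
      next
        case 2
        then have "W p (b j) (b i) = 0" using off[OF un(1) z un(2) un o] False by metis
        then show ?thesis using Wsym by simp
      qed
      then show ?thesis using False by simp
    qed
  qed
qed

end

section \<open>The differential inequality along a meridian\<close>

context capillary_eq begin

text \<open>Both parts compare with the vector of ones. If the two values lay strictly on the same
  side of 1, the spectra would be ordered and ellipticity with \<tau> = 0 would force equality; the
  bound is ellipticity with \<tau> equal to the deviation of l2.\<close>

lemma spectra_dichotomy:
  assumes lam: "lam \<in> spectra" and two: "\<And>i. i \<noteq> \<alpha> \<Longrightarrow> lam i = l2" and \<beta>: "\<beta> \<noteq> \<alpha>"
  shows "(lam \<alpha> - 1) * (l2 - 1) \<le> 0" "\<bar>lam \<alpha> - 1\<bar> \<le> Cell * \<bar>l2 - 1\<bar>"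
proof -
  have one: "(\<lambda>_. 1) \<in> spectra" by (simp add: spectra_def)
  have le1: "g i + \<tau> - f i \<le> Cell * \<tau>"
    if "f \<in> spectra" "g \<in> spectra" "\<tau> \<ge> 0" "\<And>i. f i \<le> g i + \<tau>" for f g \<tau> i
  proof -
    have "g i + \<tau> - f i \<le> (\<Sum>i\<in>UNIV. g i + \<tau> - f i)"
      using that(4) by (intro member_le_sum) auto
    then show ?thesis using Cell(2)[OF that] by linarith
  qed
  have cs: "lam i = (if i = \<alpha> then lam \<alpha> else l2)" for i using two by simp
  show "\<bar>lam \<alpha> - 1\<bar> \<le> Cell * \<bar>l2 - 1\<bar>"
  proof (cases "lam \<alpha> \<le> 1")
    case True
    have "lam i \<le> 1 + \<bar>l2 - 1\<bar>" for i using True cs[of i] by (cases "i = \<alpha>") auto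
    from le1[OF lam one _ this, of \<alpha>] show ?thesis using True by auto
  next
    case False
    have "1 \<le> lam i + \<bar>l2 - 1\<bar>" for i using False cs[of i] by (cases "i = \<alpha>") auto
    from le1[OF one lam _ this, of \<alpha>] show ?thesis using False by auto
  qed
  show "(lam \<alpha> - 1) * (l2 - 1) \<le> 0"
  proof (rule ccontr)
    assume "\<not> (lam \<alpha> - 1) * (l2 - 1) \<le> 0"
    then consider "lam \<alpha> > 1" "l2 > 1" | "lam \<alpha> < 1" "l2 < 1"
      by (auto simp: not_le zero_less_mult_iff)
    then show False
    proof cases
      case 1
      then have "1 \<le> lam i + 0" for i using cs[of i] by (cases "i = \<alpha>") auto
      from le1[OF one lam _ this, of \<alpha>] show False using 1 by simp
    next
      case 2
      then have "lam i \<le> 1 + 0" for i using cs[of i] by (cases "i = \<alpha>") auto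
      from le1[OF lam one _ this, of \<alpha>] show False using 2 by simp
    qed
  qed
qed

text \<open>The aim is B = 0 along the meridian: then l2 = 1, the dichotomy makes the remaining
  eigenvalue 1 as well, and A is constant. Hence f - 1 is a multiple of cos t, and the Robin
  condition fixes the factor.\<close>

lemma symmetric_solution:
  assumes sym: "\<And>n N. n \<bullet> n = 1 \<Longrightarrow> n $ None = 0 \<Longrightarrow> N \<in> Cap c \<Longrightarrow> F (mirror n N) = F N"
    and n2: "CARD('n) \<ge> 2" and N: "N \<in> Cap c"
  shows "F N = 1 - c * N $ None"
proof -
  obtain \<alpha> \<beta> :: 'n where ab: "\<beta> \<noteq> \<alpha>"
  proof -
    have "\<not> (\<forall>x y :: 'n. x = y)"
    proof
      assume "\<forall>x y :: 'n. x = y"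
      then have "(UNIV :: 'n set) = {undefined}" by auto
      then have "CARD('n) = 1" by (metis card.empty card.insert empty_iff finite.emptyI One_nat_def)
      then show False using n2 by simp
    qed
    then show ?thesis using that by metis
  qed
  define \<theta> where "\<theta> = arccos c"
  have th: "0 < \<theta>" "\<theta> < pi" "cos \<theta> = c"
    unfolding \<theta>_def using c arccos_lt_bounded[of c] by auto
  have cosge: "c \<le> cos t" if "0 \<le> t" "t \<le> \<theta>" for t
    using cos_monotone_0_pi_le[of t \<theta>] that th by simp
  have cosgt: "c < cos t" if "0 \<le> t" "t < \<theta>" for t
    using cos_monotone_0_pi[of t \<theta>] that th by simp
  have sinp: "0 < sin t" if "0 < t" "t \<le> \<theta>" for t using sin_gt_zero[of t] that th by simp
  define f where "f t = F (lat \<alpha> t)" for t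
  define f1 where "f1 t = D (lat \<alpha> t) \<bullet> lat' \<alpha> t" for t
  define f2 where "f2 t = D' (lat \<alpha> t) (lat' \<alpha> t) \<bullet> lat' \<alpha> t - D (lat \<alpha> t) \<bullet> lat \<alpha> t" for t
  have inU: "lat \<alpha> t \<in> U" if "0 \<le> t" "t \<le> \<theta>" for t using lat_Cap[OF cosge[OF that]] CapU by blast
  have df: "(f has_real_derivative f1 t) (at t)" if "0 \<le> t" "t \<le> \<theta>" for t
    using F_geo_deriv[of "axis None 1" "axis (Some \<alpha>) 1" t] inU[OF that]
    unfolding f_def[abs_def] f1_def lat_def lat'_def by simp
  have df1: "(f1 has_real_derivative f2 t) (at t)" if "0 \<le> t" "t \<le> \<theta>" for t
    using D_geo_deriv[of "axis None 1" "axis (Some \<alpha>) 1" t] inU[OF that]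
    unfolding f1_def[abs_def] f2_def lat_def lat'_def by simp
  define lam where "lam t = (\<lambda>i. if i = \<alpha> then f2 t + f t else (cos t / sin t) * f1 t + f t)" for t
  have lamS: "lam t \<in> spectra" if "0 < t" "t < \<theta>" for t
    using meridian_eig[OF sym cosgt sinp, of t \<alpha>] that lat_Cap[OF cosge, of t \<alpha>]
    unfolding spectra_def lam_def f2_def f1_def f_def by auto
  define l2 where "l2 t = (cos t / sin t) * f1 t + f t" for t
  have lams: "lam t \<alpha> = f2 t + f t" "\<And>i. i \<noteq> \<alpha> \<Longrightarrow> lam t i = l2 t" for t
    by (simp_all add: lam_def l2_def)
  note dich = spectra_dichotomy[OF lamS lams(2) ab, unfolded lams(1)]
  \<comment> \<open>A and B are the pair (f - 1, f') rotated by the angle t, so f - 1 = A0 cos t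
    amounts to A = A0 and B = 0. Moreover B is sin t times the deviation of l2 from 1.\<close>
  define B where "B t = (f t - 1) * sin t + f1 t * cos t" for t
  define A where "A t = (f t - 1) * cos t - f1 t * sin t" for t
  have dB: "(B has_real_derivative (f2 t + f t - 1) * cos t) (at t)" if "0 \<le> t" "t \<le> \<theta>" for t
    unfolding B_def[abs_def]
    by (auto intro!: derivative_eq_intros df[OF that] df1[OF that] simp: algebra_simps)
  have dA: "(A has_real_derivative - (f2 t + f t - 1) * sin t) (at t)" if "0 \<le> t" "t \<le> \<theta>" for t
    unfolding A_def[abs_def]
    by (auto intro!: derivative_eq_intros df[OF that] df1[OF that] simp: algebra_simps)
  have Bl: "B t = (l2 t - 1) * sin t" if "0 < t" "t < \<theta>" for t
    using sinp[of t] that unfolding B_def l2_def by (simp add: field_simps)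
  \<comment> \<open>Symmetry makes every reflection multiplier 0, so the horizontal gradient
    vanishes at the pole. This is the initial value B 0 = 0.\<close>
  have f10: "f1 0 = 0"
  proof -
    let ?a = "axis (Some \<alpha>) 1 :: real^('n option)"
    have "?a \<bullet> ?a = 1" by (simp add: axis_inner)
    moreover have "?a $ None = 0" by (simp add: axis_def)
    ultimately
    have "0 = - 2 * (D (axis None 1) \<bullet> ?a)" using sym by (intro mirror_coefficient) auto
    then show ?thesis by (simp add: f1_def lat_def lat'_def geo_0)
  qed
  define K where "K = 2 * Cell / sin \<theta>"
  have sth: "sin \<theta> > 0" using sinp th by simp
  have K0: "K \<ge> 0" unfolding K_def using Cell(1) sth by simp
  \<comment> \<open>Near the pole a bound through 1 / sin t would be singular, but for cos t \<ge> 0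
    the sign in the dichotomy makes the left side nonpositive. Past the equator that sign is lost,
    but there sin t is at least sin \<theta>, and the linear bound gives K.\<close>
  have gron: "2 * B t * ((f2 t + f t - 1) * cos t) \<le> K * (B t)\<^sup>2" if t: "0 < t" "t < \<theta>" for t
  proof (cases "cos t \<ge> 0")
    case True
    have "B t * ((f2 t + f t - 1) * cos t) = (sin t * cos t) * ((f2 t + f t - 1) * (l2 t - 1))"
      unfolding Bl[OF t] by simp
    also have "\<dots> \<le> 0"
    proof (rule mult_nonneg_nonpos)
      show "0 \<le> sin t * cos t" using True sinp[of t] t by simp
    qed (rule dich(1)[OF t])
    finally have "2 * B t * ((f2 t + f t - 1) * cos t) \<le> 0" unfolding mult.assoc[of 2] by linarith
    also have "\<dots> \<le> K * (B t)\<^sup>2" using K0 by simp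
    finally show ?thesis .
  next
    case False
    have "c < cos t" using cosgt t by simp
    then have "(cos t)\<^sup>2 \<le> c\<^sup>2" using False by (intro abs_le_square_iff[THEN iffD1]) simp
    then have "(sin \<theta>)\<^sup>2 \<le> (sin t)\<^sup>2" unfolding sin_squared_eq th(3) by simp
    then have s: "sin \<theta> \<le> sin t" by (rule power2_le_imp_le) (use sinp[of t] t in simp)
    have "\<bar>f2 t + f t - 1\<bar> \<le> Cell * \<bar>l2 t - 1\<bar>" using dich(2)[OF t] .
    also have "\<bar>l2 t - 1\<bar> \<le> \<bar>B t\<bar> / sin \<theta>"
    proof -
      have "\<bar>l2 t - 1\<bar> = \<bar>B t\<bar> / sin t" unfolding Bl[OF t] using sinp[of t] t by (simp add: abs_mult)
      also have "\<dots> \<le> \<bar>B t\<bar> / sin \<theta>" using s sth by (intro divide_left_mono) auto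
      finally show ?thesis .
    qed
    finally have "\<bar>f2 t + f t - 1\<bar> \<le> Cell * (\<bar>B t\<bar> / sin \<theta>)" using Cell(1) by (simp add: mult_left_mono)
    then have "2 * \<bar>B t\<bar> * \<bar>f2 t + f t - 1\<bar> \<le> 2 * \<bar>B t\<bar> * (Cell * (\<bar>B t\<bar> / sin \<theta>))"
      by (rule mult_left_mono) simp
    moreover have "2 * B t * ((f2 t + f t - 1) * cos t) \<le> 2 * \<bar>B t\<bar> * \<bar>f2 t + f t - 1\<bar>"
    proof -
      have "B t * (f2 t + f t - 1) * cos t \<le> \<bar>B t * (f2 t + f t - 1)\<bar> * \<bar>cos t\<bar>"
        by (metis abs_ge_self abs_mult)
      also have "\<dots> \<le> \<bar>B t * (f2 t + f t - 1)\<bar> * 1" by (intro mult_left_mono) auto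
      finally have "B t * (f2 t + f t - 1) * cos t \<le> \<bar>B t\<bar> * \<bar>f2 t + f t - 1\<bar>" by (simp only: abs_mult mult_1_right)
      then show ?thesis unfolding mult.assoc by linarith
    qed
    moreover have "2 * \<bar>B t\<bar> * (Cell * (\<bar>B t\<bar> / sin \<theta>)) = K * (B t)\<^sup>2"
      unfolding K_def by (simp add: power2_eq_square)
    ultimately show ?thesis by linarith
  qed
  have cf: "continuous_on {0..\<theta>} f" "continuous_on {0..\<theta>} f1"
    using df df1 by (auto intro!: DERIV_isCont continuous_at_imp_continuous_on)
  have cB: "continuous_on {0..\<theta>} B" and cA: "continuous_on {0..\<theta>} A"
    unfolding B_def A_def by (intro continuous_intros cf)+
  have B0: "B t = 0" if t: "0 \<le> t" "t \<le> \<theta>" for t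
  proof (cases "t = 0")
    case True
    then show ?thesis by (simp add: B_def f10)
  next
    case False
    let ?y = "\<lambda>t. (B t)\<^sup>2 * exp (- K * t)"
    have "?y t \<le> ?y 0"
    proof (rule DERIV_nonpos_imp_decreasing_open[where f = ?y and a = 0 and b = t])
      show "0 \<le> t" using t by simp
      show "\<exists>y. (?y has_real_derivative y) (at x) \<and> y \<le> 0" if "0 < x" "x < t" for x
      proof -
        have x: "0 < x" "x < \<theta>" using that t by auto
        have "(?y has_real_derivative (2 * B x * ((f2 x + f x - 1) * cos x) - K * (B x)\<^sup>2) * exp (- K * x)) (at x)"
          using x by (auto intro!: derivative_eq_intros dB simp: algebra_simps power2_eq_square)
        moreover have "(2 * B x * ((f2 x + f x - 1) * cos x) - K * (B x)\<^sup>2) * exp (- K * x) \<le> 0"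
          using gron[OF x] by (intro mult_nonpos_nonneg) auto
        ultimately show ?thesis by blast
      qed
      show "continuous_on {0..t} ?y"
        using t by (intro continuous_intros continuous_on_subset[OF cB]) auto
    qed
    moreover have "?y 0 = 0" by (simp add: B_def f10)
    ultimately have "(B t)\<^sup>2 \<le> 0" by (simp add: mult_le_0_iff)
    then show ?thesis by simp
  qed
  have l1: "f2 t + f t - 1 = 0" if t: "0 < t" "t < \<theta>" for t
  proof -
    have "l2 t - 1 = 0" using B0[of t] Bl[OF t] sinp[of t] t by simp
    then show ?thesis using dich(2)[OF t] by simp
  qed
  define A0 where "A0 = A 0"
  have A0: "A t = A0" if t: "0 \<le> t" "t \<le> \<theta>" for t
  proof (cases "t = 0")
    case False
    have "A t = A 0"
    proof (rule DERIV_isconst_end[where f = A and a = 0 and b = t])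
      show "0 < t" using t False by simp
      show "continuous_on {0..t} A" using t by (intro continuous_on_subset[OF cA]) auto
      show "(A has_real_derivative 0) (at x)" if "0 < x" "x < t" for x
        using dA[of x] l1[of x] that t by simp
    qed
    then show ?thesis by (simp add: A0_def)
  qed (simp add: A0_def)
  have sc: "sin t * sin t + cos t * cos t = 1" for t :: real by (simp flip: power2_eq_square)
  have fA: "f t - 1 = A0 * cos t" and f1A: "f1 t = - A0 * sin t" if t: "0 \<le> t" "t \<le> \<theta>" for t
  proof -
    have "(f t - 1) * (sin t * sin t + cos t * cos t) = A t * cos t + B t * sin t"
    proof -
      have "(y - 1) * (s * s + k * k) = ((y - 1) * k - z * s) * k + ((y - 1) * s + z * k) * s"
        for y z s k :: real by (simp add: algebra_simps)
      then show ?thesis unfolding A_def B_def .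
    qed
    then show "f t - 1 = A0 * cos t" using A0[OF t] B0[OF t] unfolding sc by simp
    have "f1 t * (sin t * sin t + cos t * cos t) = B t * cos t - A t * sin t"
    proof -
      have "z * (s * s + k * k) = ((y - 1) * s + z * k) * k - ((y - 1) * k - z * s) * s"
        for y z s k :: real by (simp add: algebra_simps)
      then show ?thesis unfolding A_def B_def .
    qed
    then show "f1 t = - A0 * sin t" using A0[OF t] B0[OF t] unfolding sc by simp
  qed
  have "A0 = - c"
  proof -
    have th': "0 \<le> \<theta>" "\<theta> \<le> \<theta>" using th by auto
    let ?p = "lat \<alpha> \<theta>"
    have "D ?p \<bullet> (c *\<^sub>R ?p - axis None 1) = c * F ?p"
      using th by (intro robin lat_Cap) (simp_all add: lat_facts(3))
    moreover have "c *\<^sub>R ?p - axis None 1 = sin \<theta> *\<^sub>R lat' \<alpha> \<theta>"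
    proof -
      have "cos \<theta> *\<^sub>R ?p - axis None 1 = cos \<theta> *\<^sub>R ?p - (sin \<theta> * sin \<theta> + cos \<theta> * cos \<theta>) *\<^sub>R axis None 1"
        unfolding sc by simp
      also have "\<dots> = sin \<theta> *\<^sub>R lat' \<alpha> \<theta>"
        unfolding lat_facts(1,2) by (simp only: scaleR_add_left scaleR_add_right scaleR_diff_right scaleR_scaleR)
          (simp add: mult.commute)
      finally show ?thesis using th(3) by simp
    qed
    ultimately have "sin \<theta> * f1 \<theta> = c * f \<theta>" by (simp add: f1_def f_def)
    then have "- A0 * (sin \<theta> * sin \<theta>) = c * (1 + A0 * c)"
      using f1A[OF th'] fA[OF th'] th(3) by (simp add: algebra_simps)
    then have "- A0 * (sin \<theta> * sin \<theta> + cos \<theta> * cos \<theta>) = c" using th(3) by (simp add: algebra_simps)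
    then show ?thesis unfolding sc by simp
  qed
  have z1: "\<bar>N $ None\<bar> \<le> 1" using component_le_norm_cart[of N None] N by (simp add: Cap_def)
  define t where "t = arccos (N $ None)"
  have ct: "cos t = N $ None" unfolding t_def using z1 by (simp add: cos_arccos_abs)
  have t: "0 \<le> t" "t \<le> \<theta>"
    unfolding t_def \<theta>_def using z1 N c by (auto simp: Cap_def arccos_lbound abs_le_iff intro!: arccos_le_mono[THEN iffD2])
  have "F N = F (lat \<alpha> t)"
    using ct N by (intro rotation_invariant[OF sym] lat_Cap) (auto simp: lat_facts(3) Cap_def)
  also have "\<dots> = 1 - c * N $ None"
    using fA[OF t] \<open>A0 = - c\<close> ct by (simp add: f_def)
  finally show ?thesis .
qed

text \<open>The vector a is the horizontal part of the gradient at the pole. Subtracting a . N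
  leaves the tensor unchanged, respects the Robin condition because a is horizontal, and by
  \<open>mirror_coefficient\<close> cancels the defect of every reflection.\<close>

lemma solution_form:
  assumes n2: "CARD('n) \<ge> 2"
  shows "\<exists>a. a $ None = 0 \<and> (\<forall>N\<in>Cap c. F N = 1 - c * N $ None + a \<bullet> N)"
proof -
  let ?K = "axis None 1 :: real^('n option)"
  define a where "a = D ?K - (D ?K $ None) *\<^sub>R ?K"
  have aN: "a $ None = 0" by (simp add: a_def)
  define Ft where "Ft N = F N - a \<bullet> N" for N
  define Dt where "Dt N = D N - a" for N
  have s: "sphere_C2 Ft Dt D' U c"
  proof (unfold_locales)
    have "(Ft has_derivative (\<lambda>v. Dt x \<bullet> v)) (at x)" if "x \<in> U" for x
      unfolding Ft_def[abs_def] Dt_def inner_diff_left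
      by (intro has_derivative_diff F_deriv that has_derivative_inner_right has_derivative_ident)
    moreover have "(Dt has_derivative D' x) (at x)" if "x \<in> U" for x
      using has_derivative_diff[OF D_deriv[OF that] has_derivative_const[of a]] by (simp add: Dt_def[abs_def])
    ultimately show "C2_ext U Ft Dt D'" using C2 by (simp add: C2_ext_def)
  qed (use CapU c in auto)
  interpret T: sphere_C2 Ft Dt D' U c by (rule s)
  have "T.W = W"
    by (intro ext) (simp add: T.W_def W_def Ft_def Dt_def inner_diff_left algebra_simps)
  then have E: "T.eig = eig" by (simp add: T.eig_def[abs_def] eig_def[abs_def] T.frame_def frame_def)
  interpret T: capillary_eq Ft Dt D' U c k l c0
  proof (unfold_locales)
    show "Dt N \<bullet> (c *\<^sub>R N - ?K) = c * Ft N" if "N \<in> Cap c" "N $ None = c" for N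
      using robin[OF that] aN
      by (simp add: Dt_def Ft_def inner_diff_left inner_diff_right inner_axis_nth algebra_simps)
  qed (use lk kn c0 adm eqn E in auto)
  have sym: "Ft (mirror n N) = Ft N" if n: "n \<bullet> n = 1" "n $ None = 0" and N: "N \<in> Cap c" for n N
  proof -
    obtain M where M: "\<And>N. N \<in> Cap c \<Longrightarrow> F (mirror n N) - F N = M * (N \<bullet> n)"
      using mirror_diff_linear[OF n] by blast
    have "M = - 2 * (D ?K \<bullet> n)" by (rule mirror_coefficient[OF n M])
    moreover have "a \<bullet> n = D ?K \<bullet> n" using n(2) by (simp add: a_def inner_diff_left inner_axis_nth)
    moreover have "a \<bullet> mirror n N = a \<bullet> N - 2 * (N \<bullet> n) * (a \<bullet> n)" by (simp add: mirror_def inner_diff_right)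
    ultimately show ?thesis using M[OF N] by (simp add: Ft_def algebra_simps)
  qed
  have "Ft N = 1 - c * N $ None" if "N \<in> Cap c" for N
    by (rule T.symmetric_solution[OF sym n2 that])
  then show ?thesis using aN unfolding Ft_def by (intro exI[of _ a]) (auto simp: algebra_simps)
qed

end

section \<open>Translation from unit normals back to points of the original cap\<close>

theorem theorem5p3:
  fixes H :: "real^('n::finite option) \<Rightarrow> real"
    and G :: "real^('n option) \<Rightarrow> real^('n option)"
    and G' :: "real^('n option) \<Rightarrow> real^('n option) \<Rightarrow> real^('n option)"
    and U :: "(real^('n option)) set"
    and \<theta> :: real and k l :: nat
  assumes "CARD('n) \<ge> 2" and "l < k" and "k \<le> CARD('n)"
    and "0 < \<theta>" and "\<theta> < pi"
    and "C2_ext U H G G'" and "cap \<theta> \<subseteq> U"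
    and "admissible \<theta> k H G G'"
    and "\<forall>\<xi>\<in>cap \<theta>. \<forall>lam. eigvals \<theta> H G G' \<xi> lam \<longrightarrow>
           esym k lam / esym l lam = real (CARD('n) choose k) / real (CARD('n) choose l)"
    and "\<forall>\<xi>\<in>cap_boundary \<theta>. G \<xi> \<bullet> conormal \<theta> \<xi> = cot \<theta> * H \<xi>"
  shows "\<exists>a :: 'n \<Rightarrow> real. \<forall>\<xi>\<in>cap \<theta>.
           H \<xi> = ell \<theta> \<xi> + (\<Sum>\<alpha>\<in>UNIV. a \<alpha> * (\<xi> \<bullet> EE (Some \<alpha>)))"
proof -
  define c where "c = cos \<theta>"
  have sp: "sin \<theta> > 0" using assms(4,5) by (rule sin_gt_zero)
  have c1: "- 1 < c" "c < 1"
    unfolding c_def using cos_monotone_0_pi[of \<theta> pi] cos_monotone_0_pi[of 0 \<theta>] assms(4,5) by auto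
  \<comment> \<open>The centre of the sphere carrying the cap, so that \<open>\<xi> - C\<close> is
    the unit normal at \<xi>.\<close>
  define C :: "real^('n option)" where "C = c *\<^sub>R evec"
  have ev: "evec = - axis None (1::real)" by (simp add: evec_def EE_def)
  have Cn: "C $ None = - c" "\<And>i. C $ Some i = 0" by (simp_all add: C_def ev axis_def)
  have cap: "\<xi> \<in> cap \<theta> \<longleftrightarrow> \<xi> - C \<in> Cap c" for \<xi> :: "real^('n option)"
    by (auto simp: cap_def Cap_def C_def[symmetric] c_def[symmetric] Cn)
  have capN: "N \<in> Cap c \<Longrightarrow> N + C \<in> cap \<theta>" for N by (simp add: cap)
  have sn: "snormal \<theta> (N + C) = N" for N by (simp add: snormal_def C_def c_def)
  define F where "F N = H (N + C)" for N
  define D where "D N = G (N + C)" for N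
  define D' where "D' N = G' (N + C)" for N
  define V where "V = (\<lambda>x. x - C) ` U"
  have V: "N \<in> V \<longleftrightarrow> N + C \<in> U" for N unfolding V_def by (force simp: image_iff)
  have sh: "((\<lambda>N. N + C) has_derivative (\<lambda>v. v)) (at N)" for N by (auto intro!: derivative_eq_intros)
  interpret S: sphere_C2 F D D' V c
  proof unfold_locales
    have U: "open U" "\<And>x. x \<in> U \<Longrightarrow> (H has_derivative (\<lambda>v. G x \<bullet> v)) (at x)"
      "\<And>x. x \<in> U \<Longrightarrow> (G has_derivative G' x) (at x)" "\<And>v. continuous_on U (\<lambda>x. G' x v)"
      using assms(6) by (auto simp: C2_ext_def)
    have "open V" unfolding V_def using open_translation_subtract[OF U(1), of C] by simp
    moreover have "(F has_derivative (\<lambda>v. D N \<bullet> v)) (at N)" if "N \<in> V" for N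
      unfolding F_def[abs_def] D_def using that V by (intro has_derivative_compose[OF sh U(2)]) auto
    moreover have "(D has_derivative D' N) (at N)" if "N \<in> V" for N
      unfolding D_def[abs_def] D'_def using that V by (intro has_derivative_compose[OF sh U(3)]) auto
    moreover have "continuous_on V (\<lambda>N. D' N v)" for v
      unfolding D'_def using V by (intro continuous_on_compose2[OF U(4)] continuous_intros) auto
    ultimately show "C2_ext V F D D'" by (simp add: C2_ext_def)
    show "Cap c \<subseteq> V" using capN assms(7) V by blast
  qed (use c1 in auto)
  have W: "S.W N = Wform \<theta> H G G' (N + C)" for N
    by (intro ext) (simp add: S.W_def Wform_def sn F_def D_def D'_def)
  have eig: "S.eig N lam \<longleftrightarrow> eigvals \<theta> H G G' (N + C) lam" for N lam
    unfolding S.eig_def S.frame_def eigvals_def W sn by (simp only: conj_assoc)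
  interpret S: capillary_eq F D D' V c k l "real (CARD('n) choose k) / real (CARD('n) choose l)"
  proof unfold_locales
    show "l < k" "k \<le> CARD('n)" by fact+
    show adm: "lam \<in> Gamma_cone k" if "N \<in> Cap c" "S.eig N lam" for N lam
      using assms(8) that capN unfolding admissible_def eig by blast
    show "gap k l (real (CARD('n) choose k) / real (CARD('n) choose l)) lam = 0"
      if "N \<in> Cap c" "S.eig N lam" for N lam
    proof -
      have "esym k lam / esym l lam = real (CARD('n) choose k) / real (CARD('n) choose l)"
        using assms(9) that capN unfolding eig by blast
      moreover have "esym l lam > 0" using adm[OF that] assms(2) by (intro esym_pos) auto
      ultimately show ?thesis unfolding gap_def by (simp add: field_simps)
    qed
    show "D N \<bullet> (c *\<^sub>R N - axis None 1) = c * F N" if N: "N \<in> Cap c" "N $ None = c" for N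
    proof -
      have "N + C \<in> cap_boundary \<theta>" using capN[OF N(1)] N(2) Cn by (simp add: cap_boundary_def)
      then have r: "G (N + C) \<bullet> conormal \<theta> (N + C) = cot \<theta> * H (N + C)" using assms(10) by blast
      let ?p = "c *\<^sub>R N - axis None 1"
      have NN: "N \<bullet> N = 1" by (rule Cap_inner[OF N(1)])
      have p: "evec - (evec \<bullet> N) *\<^sub>R N = ?p"
        using N(2) by (simp add: ev inner_axis_nth)
      have "?p \<bullet> ?p = 1 - c\<^sup>2"
        using NN N(2) by (simp add: inner_diff_left inner_diff_right inner_axis_nth power2_eq_square)
      then have "?p \<bullet> ?p = (sin \<theta>)\<^sup>2" by (simp add: c_def sin_squared_eq)
      then have "norm ?p = sin \<theta>" using sp by (simp add: norm_eq_sqrt_inner)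
      then have "conormal \<theta> (N + C) = (1 / sin \<theta>) *\<^sub>R ?p"
        unfolding conormal_def Let_def sn p by simp
      then show ?thesis using r sp by (simp add: D_def F_def cot_def c_def)
    qed
  qed simp
  obtain a where a: "a $ None = 0" "\<And>N. N \<in> Cap c \<Longrightarrow> F N = 1 - c * N $ None + a \<bullet> N"
    using S.solution_form[OF assms(1)] by blast
  show ?thesis
  proof (intro exI[of _ "\<lambda>\<alpha>. a $ Some \<alpha>"] ballI)
    fix \<xi> :: "real^('n option)" assume xi: "\<xi> \<in> cap \<theta>"
    define N where "N = \<xi> - C"
    have N: "N \<in> Cap c" "\<xi> = N + C" using xi by (simp_all add: N_def cap)
    have "H \<xi> = 1 - c * N $ None + a \<bullet> N" using a(2)[OF N(1)] N(2) by (simp add: F_def)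
    moreover have "a \<bullet> N = (\<Sum>\<alpha>\<in>UNIV. a $ Some \<alpha> * (\<xi> \<bullet> EE (Some \<alpha>)))"
    proof -
      have "a \<bullet> N = (\<Sum>i\<in>insert None (range Some). a $ i * N $ i)"
        by (simp add: inner_vec_def UNIV_option_conv)
      also have "\<dots> = (\<Sum>\<alpha>\<in>UNIV. a $ Some \<alpha> * N $ Some \<alpha>)"
        using a(1) by (subst sum.insert) (auto simp: sum.reindex)
      finally show ?thesis unfolding N(2) EE_def by (simp add: inner_axis_nth Cn)
    qed
    moreover have "ell \<theta> \<xi> = 1 - c * N $ None"
    proof -
      have "\<xi> \<bullet> evec = c - N $ None" by (simp add: N(2) ev inner_axis_nth Cn)
      then have "ell \<theta> \<xi> = 1 - c\<^sup>2 + c * (c - N $ None)" by (simp only: ell_def c_def sin_squared_eq)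
      then show ?thesis by (simp add: algebra_simps power2_eq_square)
    qed
    ultimately show "H \<xi> = ell \<theta> \<xi> + (\<Sum>\<alpha>\<in>UNIV. a $ Some \<alpha> * (\<xi> \<bullet> EE (Some \<alpha>)))" by simp
  qed
qed

end
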